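(* For each $N$ and $L=L(N)$, let $\mathbf{A}_N$ be an $N\times N$ symmetric/Hermitian random matrix, let $\mathbf{T}_L$ be an $L\times L$ diagonal random matrix with real entries, and let $\mathbf{G}_{L,N}$ be an $L\times N$ Gaussian-like random matrix, with $\mathbf{A}_N$, $\mathbf{T}_L$ and $\mathbf{G}_{L,N}$ independent. Suppose that $\mathbf{A}_N\overset{a.s.}{\longmapsto}A\in\mathcal{M}_{\mathrm{alg}}$, that $\mathbf{T}_L\overset{a.s.}{\longmapsto}T$ with $F^T$ an atomic distribution, and that $N,L\to\infty$ with $N/L\to c\in(0,\infty)$. Then $$\mathbf{B}_N=\mathbf{A}_N+\mathbf{G}_{L,N}'\,\mathbf{T}_L\,\mathbf{G}_{L,N}\overset{a.s.}{\longmapsto}B\in\mathcal{M}_{\mathrm{alg}}.$$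
   Context: For an $N\times N$ matrix $\mathbf{M}$ with real eigenvalues, let $F^{\mathbf{M}}(x)=\frac1N\#\{\text{eigenvalues of }\mathbf{M}\le x\}$ (counted with multiplicity). For a sequence of random matrices $\mathbf{A}_N$ of size $N\times N$ with real eigenvalues, $\mathbf{A}_N\overset{a.s.}{\longmapsto}A$ means that there is a non-random probability distribution function $F^A$ on $\mathbb{R}$ such that, almost surely, $F^{\mathbf{A}_N}(x)\to F^A(x)$ as $N\to\infty$ at every continuity point $x$ of $F^A$; here $A$ is only a symbol naming the limit. The Stieltjes transform of $F^A$ is $m_A(z)=\int\frac{1}{x-z}\,dF^A(x)$ for $z\in\mathbb{C}^+$ (the open upper half plane). The distribution $F^A$ is algebraic if there is a nonzero bivariate polynomial $L(m,z)$ with real coefficients such that $L(m_A(z),z)=0$ for all $z\in\mathbb{C}^+$. One writes $\mathbf{A}_N\overset{a.s.}{\longmapsto}A\in\mathcal{M}_{\mathrm{alg}}$ if $\mathbf{A}_N\overset{a.s.}{\longmapsto}A$ and $F^A$ is algebraic. A conclusion $\mathbf{B}_N\overset{a.s.}{\longmapsto}B\in\mathcal{M}_{\mathrm{alg}}$ asserts both that the limiting distribution $F^B$ exists and that it is algebraic. A distribution function is atomic if it has the form $\sum_{i=1}^{K}p_i\,\mathbb{I}_{[\lambda_i,\infty)}$ with $K$ finite, $\lambda_i\in\mathbb{R}$, $p_i\ge 0$, $\sum_i p_i=1$. A $P\times Q$ Gaussian-like random matrix is $\mathbf{G}_{P,Q}=\frac{1}{\sqrt{Q}}\mathbf{Y}_{P,Q}$,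 where $\mathbf{Y}_{P,Q}$ is a $P\times Q$ matrix with i.i.d. (real or complex) entries of zero mean and unit variance, with all higher order moments bounded (uniformly in the dimensions). The prime $'$ denotes transpose (conjugate transpose in the complex case). *)

theory Defs
  imports
    "HOL-Probability.Probability"
    "HOL-Computational_Algebra.Polynomial"
    "Jordan_Normal_Form.Char_Poly"
    "Jordan_Normal_Form.Schur_Decomposition"
begin

(* All matrices are complex; a real symmetric matrix is a Hermitian one with entries in the
   reals, and the adjoint of a real matrix is its transpose, so the real case is included. *)

(* Random p x q matrices are carrier-valued maps all of whose entries are measurable;
   see measurable_mat_borel_iff below. *)
definition mat_borel :: "nat \<Rightarrow> nat \<Rightarrow> complex mat measure" where
  "mat_borel p q =
     vimage_algebra (carrier_mat p q)
       (\<lambda>X. \<lambda>ij\<in>{..<p} \<times> {..<q}. X $$ ij)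
       (PiM ({..<p} \<times> {..<q}) (\<lambda>_. borel))"

lemma measurable_mat_borel_iff:
  "X \<in> measurable M (mat_borel p q) \<longleftrightarrow>
     X \<in> space M \<rightarrow> carrier_mat p q \<and>
     (\<forall>i<p. \<forall>j<q. (\<lambda>\<omega>. X \<omega> $$ (i, j)) \<in> borel_measurable M)"
  (is "?l \<longleftrightarrow> ?r")
proof
  let ?P = "PiM ({..<p} \<times> {..<q}) (\<lambda>_. borel :: complex measure)"
  let ?f = "\<lambda>X. \<lambda>ij\<in>{..<p} \<times> {..<q}. X $$ ij"
  have f: "?f \<in> carrier_mat p q \<rightarrow> space ?P"
    by (auto simp: space_PiM)
  {
    assume l: ?l
    have X: "X \<in> space M \<rightarrow> carrier_mat p q"
      using measurable_space[OF l] by (auto simp: mat_borel_def)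
    have *: "(\<lambda>\<omega>. ?f (X \<omega>)) \<in> measurable M ?P"
      using measurable_compose[OF l, of ?f ?P] measurable_vimage_algebra1[OF f]
      unfolding mat_borel_def by blast
    have "(\<lambda>\<omega>. X \<omega> $$ (i, j)) \<in> borel_measurable M" if "i < p" "j < q" for i j
      using measurable_component_singleton[of "(i, j)" "{..<p} \<times> {..<q}" "\<lambda>_. borel"] that
        measurable_compose[OF *, of "\<lambda>g. g (i, j)" borel] by simp
    with X show ?r by blast
  next
    assume r: ?r
    have "(\<lambda>\<omega>. ?f (X \<omega>)) \<in> measurable M ?P"
      using r by (intro measurable_restrict) auto
    with r show ?l
      unfolding mat_borel_def by (intro measurable_vimage_algebra2) auto
  }
qed

(* F^X(x), for a square matrix X whose eigenvalues are all real; the roots of the characteristic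
   polynomial form a multiset, which accounts for multiplicities. Re only mediates the comparison
   of the (real) eigenvalues with x. *)
definition spectral_cdf :: "complex mat \<Rightarrow> real \<Rightarrow> real" where
  "spectral_cdf X x =
     real (size {#e \<in># proots (char_poly X). Re e \<le> x#}) / real (dim_row X)"

(* A distribution function F on the reals is represented by its measure \<mu>: F = cdf \<mu>.
   weak_conv is convergence at every continuity point of the limit. *)
definition spectral_limit ::
    "'w measure \<Rightarrow> (nat \<Rightarrow> 'w \<Rightarrow> complex mat) \<Rightarrow> real measure \<Rightarrow> bool" where
  "spectral_limit M X \<mu> \<longleftrightarrow>
     real_distribution \<mu> \<and> (AE \<omega> in M. weak_conv (\<lambda>N. spectral_cdf (X N \<omega>)) (cdf \<mu>))"

definition stieltjes_transform :: "real measure \<Rightarrow> complex \<Rightarrow> complex" where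
  "stieltjes_transform \<mu> z = (LINT x|\<mu>. 1 / (complex_of_real x - z))"

(* P is a polynomial in m (outer variable) with coefficients polynomials in z. *)
definition bipoly_eval :: "real poly poly \<Rightarrow> complex \<Rightarrow> complex \<Rightarrow> complex" where
  "bipoly_eval P m z = poly (poly (map_poly (map_poly complex_of_real) P) [:m:]) z"

definition algebraic_distribution :: "real measure \<Rightarrow> bool" where
  "algebraic_distribution \<mu> \<longleftrightarrow>
     (\<exists>P. P \<noteq> 0 \<and> (\<forall>z. Im z > 0 \<longrightarrow> bipoly_eval P (stieltjes_transform \<mu> z) z = 0))"

definition atomic_cdf :: "(real \<Rightarrow> real) \<Rightarrow> bool" where
  "atomic_cdf F \<longleftrightarrow>
     (\<exists>(K::nat) p l. (\<forall>i<K. p i \<ge> 0) \<and> (\<Sum>i<K. p i) = 1 \<and>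
        F = (\<lambda>x. \<Sum>i<K. p i * indicator {l i..} x))"

(* The k-th absolute moment of the entries is bounded by C k. The law of the entries may depend on
   the dimensions; using one and the same C for all of them makes the bound uniform. *)
definition gaussian_like ::
    "'w measure \<Rightarrow> (nat \<Rightarrow> real) \<Rightarrow> nat \<Rightarrow> nat \<Rightarrow> ('w \<Rightarrow> complex mat) \<Rightarrow> bool" where
  "gaussian_like M C p q G \<longleftrightarrow>
     (\<exists>Y. Y \<in> measurable M (mat_borel p q) \<and>
        prob_space.indep_vars M (\<lambda>_. borel) (\<lambda>ij \<omega>. Y \<omega> $$ ij) ({..<p} \<times> {..<q}) \<and>
        (\<forall>ij \<in> {..<p} \<times> {..<q}. \<forall>ij' \<in> {..<p} \<times> {..<q}.
           distr M borel (\<lambda>\<omega>. Y \<omega> $$ ij) = distr M borel (\<lambda>\<omega>. Y \<omega> $$ ij')) \<and>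
        (\<forall>ij \<in> {..<p} \<times> {..<q}.
           integrable M (\<lambda>\<omega>. Y \<omega> $$ ij) \<and> (LINT \<omega>|M. Y \<omega> $$ ij) = 0 \<and>
           integrable M (\<lambda>\<omega>. (cmod (Y \<omega> $$ ij))\<^sup>2) \<and> (LINT \<omega>|M. (cmod (Y \<omega> $$ ij))\<^sup>2) = 1 \<and>
           (\<forall>k>2. integrable M (\<lambda>\<omega>. cmod (Y \<omega> $$ ij) ^ k) \<and>
                  (LINT \<omega>|M. cmod (Y \<omega> $$ ij) ^ k) \<le> C k)) \<and>
        (\<forall>\<omega>\<in>space M. G \<omega> = complex_of_real (1 / sqrt (real q)) \<cdot>\<^sub>m Y \<omega>))"

end

theory Submission
  imports Defs "HOL-Complex_Analysis.Conformal_Mappings" "HOL-Real_Asymp.Real_Asymp"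
begin

text \<open>
  Write \<open>B = A + \<Sum>\<^sub>i \<tau>\<^sub>i g\<^sub>i' g\<^sub>i\<close> with \<open>g\<^sub>i\<close> the rows of \<open>G\<close>, and fix \<open>z = i y\<close> with \<open>y\<close> large. Let \<open>m\<close> be the
  solution of \<open>m = m\<^sub>A(z - h(m))\<close>, where \<open>h(m) = (1 / c) \<integral> x / (1 + x m) dF\<^sup>T(x)\<close>; it exists by contraction.
  Comparing the resolvent \<open>Q = (B - z)\<^sup>-\<^sup>1\<close> with \<open>R = (A - z + h(m))\<^sup>-\<^sup>1\<close>, one finds that
  \<open>tr (R - Q) / N\<close> is small as soon as the quadratic forms \<open>g\<^sub>i X g\<^sub>i'\<close> are close to \<open>tr X / N\<close> on average over \<open>i\<close>, for
  \<open>X\<close> built from \<open>R\<close> and the resolvent of \<open>B\<close> without its \<open>i\<close>-th term. Since \<open>m\<close> is a constant, such an \<open>X\<close> is independent of \<open>g\<^sub>i\<close>,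
  and fourth moments bound the expected average error by \<open>O(N\<^sup>-\<^sup>2)\<close>, which is summable. Hence \<open>tr Q / N\<close> tends to \<open>m\<close> almost surely.
  Because \<open>y\<close> is large, no lower bound on imaginary parts is needed. Large entries of \<open>T\<close> can be truncated, because
  a rank one perturbation changes \<open>tr Q\<close> by at most \<open>2 / y\<close>.

  The asymptotics \<open>i y m \<rightarrow> -1\<close> give tightness, and a distribution is determined by its Stieltjes transform on a
  set with a limit point; so the spectral distributions converge. The fixed point equation turns a polynomial
  relation for \<open>m\<^sub>A\<close> into one for \<open>m\<close> near the imaginary axis far up, and the identity theorem extends it to the upper half plane.
\<close>

section \<open>Resolvents of Hermitian matrices\<close>

text \<open>The comparison bound contains the unknown \<open>|m - tr Q / N|\<close> itself:
  \<open>g_i Q_i g_i'\<close> approximates \<open>tr Q / N\<close>, whereas independence requires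
  the constant \<open>m\<close> in its place. The coefficient of this term tends to
  \<open>4 \<Lambda>^2 / (c y^2)\<close>, so for large \<open>y\<close> it is absorbed on the left,
  and no prior concentration of \<open>tr Q / N\<close> about its mean is needed. The same small
  quantity \<open>\<Lambda>^2 / (c y^2)\<close> makes the fixed point map a contraction. Second
  moments would leave an average error of order \<open>1 / N\<close>, which is not summable; hence
  fourth moments. \<open>A\<close> and \<open>T\<close> are random as well, but the pair is
  independent of \<open>G\<close>, so both can be frozen by Fubini. The almost sure statement is
  obtained for one \<open>z\<close> at a time, and null sets can only be united over a countable set
  of points \<open>i y\<close>; that set has to be unbounded, for tightness, and to have a limit
  point, for uniqueness. That \<open>F^T\<close> is atomic enters in two ways: its support is
  bounded, which fixes the truncation level \<open>\<Lambda>\<close>, and \<open>h\<close> is a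
  rational function of \<open>m\<close>, so the fixed point equation can be cleared of
  denominators.\<close>

definition mtrace :: "complex mat \<Rightarrow> complex" where
  "mtrace X = (\<Sum>i<dim_row X. X $$ (i, i))"

text \<open>With \<open>f\<close> read as a row vector and \<open>'\<close> as adjoint this is
  \<open>f X f'\<close>, the form in which a row of \<open>G\<close> meets a matrix;
  \<open>rank1\<close> below is accordingly \<open>f' f\<close>.\<close>

definition qform :: "nat \<Rightarrow> complex mat \<Rightarrow> (nat \<Rightarrow> complex) \<Rightarrow> complex" where
  "qform n X f = (\<Sum>a<n. \<Sum>b<n. f a * X $$ (a, b) * cnj (f b))"

definition l2norm :: "nat \<Rightarrow> (nat \<Rightarrow> complex) \<Rightarrow> real" where
  "l2norm n x = L2_set (\<lambda>i. cmod (x i)) {..<n}"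

definition mapp :: "nat \<Rightarrow> complex mat \<Rightarrow> (nat \<Rightarrow> complex) \<Rightarrow> nat \<Rightarrow> complex" where
  "mapp n X x = (\<lambda>i. \<Sum>b<n. X $$ (i, b) * x b)"

text \<open>An upper bound for the operator norm. Vectors are plain functions of which only the
  first \<open>n\<close> values matter, so no carrier conditions arise. The condition
  \<open>0 \<le> K\<close> is demanded because it does not follow for \<open>n = 0\<close>.\<close>

definition opbound :: "nat \<Rightarrow> complex mat \<Rightarrow> real \<Rightarrow> bool" where
  "opbound n X K \<longleftrightarrow> 0 \<le> K \<and> (\<forall>x. l2norm n (mapp n X x) \<le> K * l2norm n x)"

definition rank1 :: "nat \<Rightarrow> (nat \<Rightarrow> complex) \<Rightarrow> complex mat" where
  "rank1 n f = mat n n (\<lambda>(a, b). cnj (f a) * f b)"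

text \<open>Cramer's formula instead of an abstract inverse: the function is total and its entries
  are rational in the entries of \<open>X\<close>, which makes measurability elementary.\<close>

definition resolvent :: "complex mat \<Rightarrow> complex \<Rightarrow> complex mat" where
  "resolvent X z = (1 / Determinant.det (X - z \<cdot>\<^sub>m 1\<^sub>m (dim_row X))) \<cdot>\<^sub>m adj_mat (X - z \<cdot>\<^sub>m 1\<^sub>m (dim_row X))"

section \<open>Traces, Euclidean norms and operator bounds\<close>

lemma mult_mat_entry:
  assumes "X \<in> carrier_mat n k" "Y \<in> carrier_mat k m" "i < n" "j < m"
  shows "(X * Y) $$ (i, j) = (\<Sum>a<k. X $$ (i, a) * Y $$ (a, j))"
  using assms by (simp add: scalar_prod_def atLeast0LessThan)

lemma mat_adjoint_carrier [simp]: "X \<in> carrier_mat n m \<Longrightarrow> mat_adjoint X \<in> carrier_mat m n"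
  by (auto simp: mat_adjoint_def)

lemma mat_adjoint_entry:
  fixes X :: "complex mat"
  assumes "X \<in> carrier_mat n m" "i < m" "j < n"
  shows "mat_adjoint X $$ (i, j) = cnj (X $$ (j, i))"
  using assms by (simp add: mat_adjoint_def mat_of_rows_def)

lemma mtrace_mult_comm:
  assumes "X \<in> carrier_mat n k" "Y \<in> carrier_mat k n"
  shows "mtrace (X * Y) = mtrace (Y * X)"
proof -
  have "mtrace (X * Y) = (\<Sum>i<n. \<Sum>a<k. X $$ (i, a) * Y $$ (a, i))"
    using assms unfolding mtrace_def by (auto simp: mult_mat_entry simp del: index_mult_mat(1) intro!: sum.cong)
  also have "\<dots> = (\<Sum>a<k. \<Sum>i<n. Y $$ (a, i) * X $$ (i, a))"
    by (subst sum.swap) (simp add: mult.commute)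
  also have "\<dots> = mtrace (Y * X)"
    using assms unfolding mtrace_def by (auto simp: mult_mat_entry simp del: index_mult_mat(1) intro!: sum.cong)
  finally show ?thesis .
qed

lemma l2norm_nonneg [simp]: "0 \<le> l2norm n x"
  by (simp add: l2norm_def)

lemma l2norm_sq: "(l2norm n x)\<^sup>2 = (\<Sum>i<n. (cmod (x i))\<^sup>2)"
  by (simp add: l2norm_def L2_set_def sum_nonneg)

lemma l2norm_cong: "(\<And>i. i < n \<Longrightarrow> cmod (x i) = cmod (y i)) \<Longrightarrow> l2norm n x = l2norm n y"
  unfolding l2norm_def by (intro L2_set_cong) auto

lemma l2norm_cnj [simp]: "l2norm n (\<lambda>i. cnj (x i)) = l2norm n x"
  by (simp add: l2norm_def)

lemma l2norm_triangle: "l2norm n (\<lambda>i. x i - y i) \<le> l2norm n x + l2norm n y"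
proof -
  have "l2norm n (\<lambda>i. x i - y i) \<le> L2_set (\<lambda>i. cmod (x i) + cmod (y i)) {..<n}"
    unfolding l2norm_def by (intro L2_set_mono norm_triangle_ineq4) auto
  also have "\<dots> \<le> l2norm n x + l2norm n y"
    unfolding l2norm_def by (rule L2_set_triangle_ineq)
  finally show ?thesis .
qed

lemma l2norm_CS: "cmod (\<Sum>i<n. x i * y i) \<le> l2norm n x * l2norm n y"
proof -
  have "cmod (\<Sum>i<n. x i * y i) \<le> (\<Sum>i<n. \<bar>cmod (x i)\<bar> * \<bar>cmod (y i)\<bar>)"
    by (rule order_trans[OF norm_sum]) (simp add: norm_mult)
  also have "\<dots> \<le> l2norm n x * l2norm n y"
    unfolding l2norm_def by (rule L2_set_mult_ineq)
  finally show ?thesis .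
qed

lemma l2norm_scale: "l2norm n (\<lambda>i. x i * s) = l2norm n x * cmod s"
  using L2_set_left_distrib[of "cmod s" "\<lambda>i. cmod (x i)" "{..<n}"]
  by (simp add: l2norm_def norm_mult)

lemma l2norm_unit:
  assumes "i < n"
  shows "l2norm n (\<lambda>b. if b = i then 1 else 0) = 1"
proof -
  have "(l2norm n (\<lambda>b. if b = i then 1 else 0))\<^sup>2 = 1"
    using assms by (simp add: l2norm_sq if_distrib[of cmod] if_distrib[of "\<lambda>x. x\<^sup>2"] cong: if_cong)
  thus ?thesis
    using l2norm_nonneg power2_eq_1_iff by (metis abs_of_nonneg real_sqrt_abs real_sqrt_one)
qed

lemma opboundD: "opbound n X K \<Longrightarrow> l2norm n (mapp n X x) \<le> K * l2norm n x"
  and opbound_nonneg: "opbound n X K \<Longrightarrow> 0 \<le> K"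
  by (auto simp: opbound_def)

lemma opbound_mono: "opbound n X K \<Longrightarrow> K \<le> J \<Longrightarrow> opbound n X J"
  unfolding opbound_def by (meson l2norm_nonneg mult_right_mono order_trans)

lemma mapp_mult:
  assumes "X \<in> carrier_mat n n" "Y \<in> carrier_mat n n" "i < n"
  shows "mapp n (X * Y) x i = mapp n X (mapp n Y x) i"
proof -
  have "mapp n (X * Y) x i = (\<Sum>b<n. \<Sum>a<n. X $$ (i, a) * Y $$ (a, b) * x b)"
    using assms by (simp add: mapp_def mult_mat_entry sum_distrib_right del: index_mult_mat(1))
  also have "\<dots> = mapp n X (mapp n Y x) i"
    by (subst sum.swap) (simp add: mapp_def sum_distrib_left mult.assoc)
  finally show ?thesis .
qed

lemma opbound_mult:
  assumes "X \<in> carrier_mat n n" "Y \<in> carrier_mat n n" "opbound n X K" "opbound n Y J"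
  shows "opbound n (X * Y) (K * J)"
  unfolding opbound_def
proof (intro conjI allI)
  show "0 \<le> K * J" using assms by (simp add: opbound_def)
  fix x
  have "l2norm n (mapp n (X * Y) x) = l2norm n (mapp n X (mapp n Y x))"
    using assms by (intro l2norm_cong) (simp add: mapp_mult)
  also have "\<dots> \<le> K * (J * l2norm n x)"
    using opboundD[OF assms(3)] opboundD[OF assms(4)] opbound_nonneg[OF assms(3)]
    by (meson mult_left_mono order_trans)
  finally show "l2norm n (mapp n (X * Y) x) \<le> K * J * l2norm n x" by (simp add: mult.assoc)
qed

lemma opbound_one: "opbound n (1\<^sub>m n) 1"
proof -
  have "mapp n (1\<^sub>m n) x i = x i" if "i < n" for x i
    using that by (simp add: mapp_def if_distrib[of "\<lambda>c. c * _"] cong: if_cong)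
  thus ?thesis unfolding opbound_def
    by (metis l2norm_cong mult_1 order_refl zero_le_one)
qed

lemma qform_bound:
  assumes "opbound n X K"
  shows "cmod (qform n X f) \<le> K * (l2norm n f)\<^sup>2"
proof -
  have "qform n X f = (\<Sum>a<n. f a * mapp n X (\<lambda>b. cnj (f b)) a)"
    by (simp add: qform_def mapp_def sum_distrib_left mult.assoc)
  also have "cmod \<dots> \<le> l2norm n f * l2norm n (mapp n X (\<lambda>b. cnj (f b)))"
    by (rule l2norm_CS)
  also have "\<dots> \<le> l2norm n f * (K * l2norm n (\<lambda>b. cnj (f b)))"
    by (intro mult_left_mono opboundD assms) auto
  finally show ?thesis by (simp add: power2_eq_square mult_ac)
qed

lemma mapp_unit: "j < n \<Longrightarrow> mapp n X (\<lambda>b. if b = j then 1 else 0) i = X $$ (i, j)"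
  by (simp add: mapp_def if_distrib cong: if_cong)

text \<open>Each column is the image of a unit vector, so its squared norm is at most
  \<open>K^2\<close>. Fourth moments of quadratic forms are controlled by the Frobenius norm,
  whereas resolvents come with bounds on the operator norm.\<close>

lemma frobenius_bound:
  assumes "opbound n X K"
  shows "(\<Sum>a<n. \<Sum>b<n. (cmod (X $$ (a, b)))\<^sup>2) \<le> real n * K\<^sup>2"
proof -
  have "(\<Sum>a<n. (cmod (X $$ (a, b)))\<^sup>2) \<le> K\<^sup>2" if "b < n" for b
  proof -
    have "l2norm n (mapp n X (\<lambda>i. if i = b then 1 else 0)) \<le> K"
      using opboundD[OF assms, of "\<lambda>i. if i = b then 1 else 0"] l2norm_unit[OF that] by simp
    hence "(l2norm n (mapp n X (\<lambda>i. if i = b then 1 else 0)))\<^sup>2 \<le> K\<^sup>2"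
      by (intro power_mono) auto
    thus ?thesis using that by (simp add: l2norm_sq mapp_unit)
  qed
  hence "(\<Sum>b<n. \<Sum>a<n. (cmod (X $$ (a, b)))\<^sup>2) \<le> (\<Sum>b<n. K\<^sup>2)"
    by (intro sum_mono) auto
  thus ?thesis by (subst sum.swap) simp
qed

lemma mtrace_bound:
  assumes "X \<in> carrier_mat n n" "opbound n X K"
  shows "cmod (mtrace X) \<le> real n * K"
proof -
  have "cmod (X $$ (i, i)) \<le> K" if "i < n" for i
  proof -
    have "(cmod (X $$ (i, i)))\<^sup>2 \<le> (l2norm n (mapp n X (\<lambda>b. if b = i then 1 else 0)))\<^sup>2"
      unfolding l2norm_sq using that mapp_unit[OF that]
      by (auto intro!: member_le_sum[of i "{..<n}" "\<lambda>a. (cmod (X $$ (a, i)))\<^sup>2"])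
    hence "cmod (X $$ (i, i)) \<le> l2norm n (mapp n X (\<lambda>b. if b = i then 1 else 0))"
      using power2_le_imp_le l2norm_nonneg by blast
    also have "\<dots> \<le> K" using opboundD[OF assms(2)] l2norm_unit[OF that] by (metis mult.right_neutral)
    finally show ?thesis .
  qed
  hence "(\<Sum>i<n. cmod (X $$ (i, i))) \<le> (\<Sum>i<n. K)" by (intro sum_mono) auto
  moreover have "cmod (mtrace X) \<le> (\<Sum>i<n. cmod (X $$ (i, i)))"
    using assms(1) unfolding mtrace_def by (auto intro: norm_sum)
  ultimately show ?thesis by simp
qed

section \<open>Hermitian matrices and their resolvents\<close>

lemma hermitian_entry:
  fixes X :: "complex mat"
  assumes "X \<in> carrier_mat n n" "mat_adjoint X = X" "i < n" "j < n"
  shows "cnj (X $$ (i, j)) = X $$ (j, i)"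
  using mat_adjoint_entry[OF assms(1), of j i] assms by simp

lemma hermitian_quadratic_real:
  assumes "X \<in> carrier_mat n n" "mat_adjoint X = X"
  shows "Im (\<Sum>a<n. cnj (x a) * mapp n X x a) = 0"
proof -
  let ?s = "\<Sum>a<n. cnj (x a) * mapp n X x a"
  have "cnj ?s = (\<Sum>a<n. \<Sum>b<n. x a * cnj (X $$ (a, b)) * cnj (x b))"
    by (simp add: mapp_def sum_distrib_left mult.assoc)
  also have "\<dots> = (\<Sum>a<n. \<Sum>b<n. cnj (x b) * X $$ (b, a) * x a)"
    using hermitian_entry[OF assms] by (intro sum.cong refl) (auto simp: mult_ac)
  also have "\<dots> = ?s"
    by (subst sum.swap) (simp add: mapp_def sum_distrib_left mult.assoc)
  finally have "cnj ?s = ?s" .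
  hence "?s \<in> \<real>" by (simp only: Reals_cnj_iff)
  thus ?thesis by (simp only: complex_is_Real_iff)
qed

text \<open>Since \<open>x' X x\<close> is real, the imaginary part of \<open>x' (X - z) x\<close>
  is \<open>- Im z\<close> times the squared norm of \<open>x\<close>; Cauchy-Schwarz does the rest.
  Invertibility of \<open>X - z\<close> and the bound \<open>1 / Im z\<close> on its inverse both
  come from here.\<close>

lemma hermitian_lower_bound:
  assumes "X \<in> carrier_mat n n" "mat_adjoint X = X"
  shows "\<bar>Im z\<bar> * l2norm n x \<le> l2norm n (mapp n (X - z \<cdot>\<^sub>m 1\<^sub>m n) x)"
proof -
  let ?y = "mapp n (X - z \<cdot>\<^sub>m 1\<^sub>m n) x"
  have y: "?y a = mapp n X x a - z * x a" if "a < n" for a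
  proof -
    have "?y a = (\<Sum>b<n. X $$ (a, b) * x b - (if a = b then z * x b else 0))"
      using that assms(1) by (auto simp: mapp_def algebra_simps intro!: sum.cong)
    thus ?thesis using that by (simp add: mapp_def sum_subtractf)
  qed
  define S where "S = (\<Sum>a<n. cnj (x a) * ?y a)"
  define W where "W = (\<Sum>a<n. cnj (x a) * mapp n X x a)"
  have "S = (\<Sum>a<n. cnj (x a) * mapp n X x a - z * (cnj (x a) * x a))"
    unfolding S_def
  proof (intro sum.cong refl)
    fix a assume "a \<in> {..<n}"
    hence "?y a = mapp n X x a - z * x a" by (intro y) simp
    thus "cnj (x a) * ?y a = cnj (x a) * mapp n X x a - z * (cnj (x a) * x a)"
      by (simp only: right_diff_distrib mult.left_commute)
  qed
  also have "\<dots> = W - z * (\<Sum>a<n. cnj (x a) * x a)"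
    by (simp only: sum_subtractf sum_distrib_left W_def)
  also have "(\<Sum>a<n. cnj (x a) * x a) = of_real ((l2norm n x)\<^sup>2)"
    by (simp only: l2norm_sq of_real_sum complex_norm_square) (simp add: mult.commute)
  finally have "Im S = - (Im z * (l2norm n x)\<^sup>2)"
    using hermitian_quadratic_real[OF assms, of x] by (simp add: W_def)
  hence "\<bar>Im z\<bar> * (l2norm n x)\<^sup>2 = \<bar>Im S\<bar>" by (simp add: abs_mult)
  also have "\<dots> \<le> cmod (\<Sum>a<n. cnj (x a) * ?y a)"
    unfolding S_def by (rule abs_Im_le_cmod)
  also have "\<dots> \<le> l2norm n x * l2norm n ?y"
    using l2norm_CS[of "\<lambda>a. cnj (x a)" ?y n] by simp
  finally have *: "l2norm n x * (\<bar>Im z\<bar> * l2norm n x) \<le> l2norm n x * l2norm n ?y"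
    by (simp add: power2_eq_square mult_ac)
  show ?thesis
  proof (cases "l2norm n x = 0")
    case False
    hence "l2norm n x > 0" using l2norm_nonneg[of n x] by linarith
    thus ?thesis using * by simp
  qed simp
qed

lemma l2norm_eq_0: "l2norm n x = 0 \<Longrightarrow> i < n \<Longrightarrow> x i = 0"
  unfolding l2norm_def by (simp add: L2_set_eq_0_iff)

lemma hermitian_det_nonzero:
  assumes "X \<in> carrier_mat n n" "mat_adjoint X = X" "Im z \<noteq> 0"
  shows "Determinant.det (X - z \<cdot>\<^sub>m 1\<^sub>m n) \<noteq> 0"
proof
  assume d: "Determinant.det (X - z \<cdot>\<^sub>m 1\<^sub>m n) = 0"
  have c: "X - z \<cdot>\<^sub>m 1\<^sub>m n \<in> carrier_mat n n" using assms by auto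
  obtain v where v: "v \<in> carrier_vec n" "v \<noteq> 0\<^sub>v n" "(X - z \<cdot>\<^sub>m 1\<^sub>m n) *\<^sub>v v = 0\<^sub>v n"
    using d det_0_iff_vec_prod_zero[OF c] by blast
  have "mapp n (X - z \<cdot>\<^sub>m 1\<^sub>m n) (\<lambda>i. v $ i) i = 0" if "i < n" for i
  proof -
    have "mapp n (X - z \<cdot>\<^sub>m 1\<^sub>m n) (\<lambda>i. v $ i) i = ((X - z \<cdot>\<^sub>m 1\<^sub>m n) *\<^sub>v v) $ i"
      using that v(1) c by (simp add: mapp_def scalar_prod_def atLeast0LessThan)
    thus ?thesis using v(3) that by simp
  qed
  hence "l2norm n (mapp n (X - z \<cdot>\<^sub>m 1\<^sub>m n) (\<lambda>i. v $ i)) = l2norm n (\<lambda>i. 0)"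
    by (intro l2norm_cong) auto
  also have "\<dots> = 0" by (simp add: l2norm_def L2_set_def)
  finally have "l2norm n (mapp n (X - z \<cdot>\<^sub>m 1\<^sub>m n) (\<lambda>i. v $ i)) = 0" .
  hence "\<bar>Im z\<bar> * l2norm n (\<lambda>i. v $ i) \<le> 0"
    using hermitian_lower_bound[OF assms(1,2), of z "\<lambda>i. v $ i"] by simp
  hence "l2norm n (\<lambda>i. v $ i) = 0"
    using assms(3) l2norm_nonneg[of n "\<lambda>i. v $ i"]
    by (metis abs_eq_0 less_eq_real_def mult_le_0_iff not_less zero_less_abs_iff)
  hence "v = 0\<^sub>v n" using v(1) l2norm_eq_0[of n "\<lambda>i. v $ i"] by auto
  with v(2) show False by simp
qed

lemma resolvent_carrier [simp]: "X \<in> carrier_mat n n \<Longrightarrow> resolvent X z \<in> carrier_mat n n"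
  unfolding resolvent_def using adj_mat(1)[of "X - z \<cdot>\<^sub>m 1\<^sub>m n" n] by (simp add: minus_carrier_mat)

lemma smult_smult: "c \<cdot>\<^sub>m (k \<cdot>\<^sub>m X) = (c * k) \<cdot>\<^sub>m (X :: complex mat)"
  by (rule eq_matI) auto

lemma resolvent_inverse:
  assumes "X \<in> carrier_mat n n" "mat_adjoint X = X" "Im z \<noteq> 0"
  shows "(X - z \<cdot>\<^sub>m 1\<^sub>m n) * resolvent X z = 1\<^sub>m n"
    and "resolvent X z * (X - z \<cdot>\<^sub>m 1\<^sub>m n) = 1\<^sub>m n"
proof -
  have c: "X - z \<cdot>\<^sub>m 1\<^sub>m n \<in> carrier_mat n n" and d: "dim_row X = n" using assms by auto
  note adj = adj_mat[OF c] and nz = hermitian_det_nonzero[OF assms]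
  show "(X - z \<cdot>\<^sub>m 1\<^sub>m n) * resolvent X z = 1\<^sub>m n"
    unfolding resolvent_def d using nz
    by (subst mult_smult_distrib[OF c adj(1)]) (simp add: adj(2) smult_smult, auto intro!: eq_matI)
  show "resolvent X z * (X - z \<cdot>\<^sub>m 1\<^sub>m n) = 1\<^sub>m n"
    unfolding resolvent_def d using nz
    by (subst mult_smult_assoc_mat[OF adj(1) c]) (simp add: adj(3) smult_smult, auto intro!: eq_matI)
qed

lemma resolvent_opbound:
  assumes "X \<in> carrier_mat n n" "mat_adjoint X = X" "Im z > 0"
  shows "opbound n (resolvent X z) (1 / Im z)"
  unfolding opbound_def
proof (intro conjI allI)
  show "0 \<le> 1 / Im z" using assms by simp
  fix x
  have c: "X - z \<cdot>\<^sub>m 1\<^sub>m n \<in> carrier_mat n n" using assms by auto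
  have "mapp n (X - z \<cdot>\<^sub>m 1\<^sub>m n) (mapp n (resolvent X z) x) i = x i" if "i < n" for i
  proof -
    have "mapp n (X - z \<cdot>\<^sub>m 1\<^sub>m n) (mapp n (resolvent X z) x) i = mapp n (1\<^sub>m n) x i"
      using mapp_mult[OF c resolvent_carrier[OF assms(1)] that, of z x]
        resolvent_inverse(1)[OF assms(1,2), of z] assms(3) by simp
    thus ?thesis using that by (simp add: mapp_def if_distrib[of "\<lambda>c. c * _"] cong: if_cong)
  qed
  hence "l2norm n (mapp n (X - z \<cdot>\<^sub>m 1\<^sub>m n) (mapp n (resolvent X z) x)) = l2norm n x"
    by (intro l2norm_cong) auto
  with hermitian_lower_bound[OF assms(1,2), of z "mapp n (resolvent X z) x"] assms(3)
  show "l2norm n (mapp n (resolvent X z) x) \<le> 1 / Im z * l2norm n x"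
    by (simp add: field_simps)
qed

text \<open>Two different spectral parameters are allowed because \<open>B\<close> at
  \<open>z\<close> will be compared with \<open>A\<close> at \<open>z - h\<close>.\<close>

lemma resolvent_identity:
  assumes "X \<in> carrier_mat n n" "mat_adjoint X = X" "Im z \<noteq> 0"
    and "Y \<in> carrier_mat n n" "mat_adjoint Y = Y" "Im w \<noteq> 0"
  shows "resolvent X z - resolvent Y w =
    resolvent X z * ((Y - w \<cdot>\<^sub>m 1\<^sub>m n) - (X - z \<cdot>\<^sub>m 1\<^sub>m n)) * resolvent Y w"
proof -
  let ?x = "X - z \<cdot>\<^sub>m 1\<^sub>m n" and ?y = "Y - w \<cdot>\<^sub>m 1\<^sub>m n"
  let ?Q = "resolvent X z" and ?R = "resolvent Y w"
  have c: "?x \<in> carrier_mat n n" "?y \<in> carrier_mat n n" "?Q \<in> carrier_mat n n" "?R \<in> carrier_mat n n"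
    using assms by auto
  have "?Q * (?y - ?x) * ?R = (?Q * ?y - ?Q * ?x) * ?R"
    using c by (simp add: mult_minus_distrib_mat)
  also have "\<dots> = ?Q * ?y * ?R - ?Q * ?x * ?R"
    using c by (intro minus_mult_distrib_mat) auto
  also have "?Q * ?y * ?R = ?Q * (?y * ?R)"
    using c by (intro assoc_mult_mat) auto
  finally show ?thesis
    using c resolvent_inverse[OF assms(1-3)] resolvent_inverse[OF assms(4-6)] by simp
qed

section \<open>Rank one perturbations\<close>

lemma rank1_carrier [simp]: "rank1 n f \<in> carrier_mat n n"
  by (simp add: rank1_def)

lemma mult_rank1_mult_entry:
  assumes "U \<in> carrier_mat n n" "W \<in> carrier_mat n n" "x < n" "y < n"
  shows "(U * rank1 n f * W) $$ (x, y) = (\<Sum>a<n. U $$ (x, a) * cnj (f a)) * (\<Sum>b<n. f b * W $$ (b, y))"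
proof -
  have "(U * rank1 n f * W) $$ (x, y) = (\<Sum>b<n. (\<Sum>a<n. U $$ (x, a) * rank1 n f $$ (a, b)) * W $$ (b, y))"
    using assms by (simp add: mult_mat_entry[of _ n n _ n] del: index_mult_mat(1))
  also have "\<dots> = (\<Sum>b<n. (\<Sum>a<n. U $$ (x, a) * cnj (f a)) * (f b * W $$ (b, y)))"
    by (intro sum.cong refl) (simp add: rank1_def sum_distrib_right sum_distrib_left mult_ac)
  finally show ?thesis by (simp add: sum_distrib_left)
qed

lemma qform_eq_sum:
  "qform n X f = (\<Sum>a<n. (\<Sum>b<n. f b * X $$ (b, a)) * cnj (f a))"
  unfolding qform_def by (subst sum.swap) (simp add: sum_distrib_right)

lemma qform_mult:
  assumes "W \<in> carrier_mat n n" "U \<in> carrier_mat n n"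
  shows "qform n (W * U) f = (\<Sum>x<n. (\<Sum>a<n. U $$ (x, a) * cnj (f a)) * (\<Sum>b<n. f b * W $$ (b, x)))"
proof -
  have "qform n (W * U) f = (\<Sum>b<n. \<Sum>a<n. \<Sum>x<n. f b * (W $$ (b, x) * U $$ (x, a)) * cnj (f a))"
    unfolding qform_def using assms
    by (intro sum.cong refl) (simp add: mult_mat_entry[of _ n n _ n] sum_distrib_left sum_distrib_right del: index_mult_mat(1))
  also have "\<dots> = (\<Sum>b<n. \<Sum>x<n. \<Sum>a<n. f b * (W $$ (b, x) * U $$ (x, a)) * cnj (f a))"
    by (rule sum.cong[OF refl], rule sum.swap)
  also have "\<dots> = (\<Sum>x<n. \<Sum>b<n. \<Sum>a<n. f b * (W $$ (b, x) * U $$ (x, a)) * cnj (f a))"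
    by (rule sum.swap)
  also have "\<dots> = (\<Sum>x<n. (\<Sum>a<n. U $$ (x, a) * cnj (f a)) * (\<Sum>b<n. f b * W $$ (b, x)))"
    by (rule sum.cong[OF refl], subst sum.swap, simp only: sum_product, simp add: mult_ac)
  finally show ?thesis .
qed

lemma mtrace_mult_rank1_mult:
  assumes "U \<in> carrier_mat n n" "W \<in> carrier_mat n n"
  shows "mtrace (U * rank1 n f * W) = qform n (W * U) f"
  unfolding qform_mult[OF assms(2,1)] mtrace_def using assms
  by (intro sum.cong) (auto simp: mult_rank1_mult_entry simp del: index_mult_mat(1))

text \<open>As \<open>rank1 n f\<close> is \<open>f' f\<close>, the product splits into the scalars
  \<open>f U f'\<close> and \<open>f W f'\<close>. This is the origin of the factor
  \<open>1 + \<tau> q\<close> when a row is removed.\<close>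

lemma qform_mult_rank1_mult:
  assumes "U \<in> carrier_mat n n" "W \<in> carrier_mat n n"
  shows "qform n (U * rank1 n f * W) f = qform n U f * qform n W f"
proof -
  have "qform n (U * rank1 n f * W) f =
      (\<Sum>x<n. \<Sum>y<n. (f x * (\<Sum>a<n. U $$ (x, a) * cnj (f a))) * ((\<Sum>b<n. f b * W $$ (b, y)) * cnj (f y)))"
    unfolding qform_def using assms
    by (intro sum.cong refl) (simp add: mult_rank1_mult_entry mult_ac del: index_mult_mat(1))
  also have "\<dots> = (\<Sum>x<n. f x * (\<Sum>a<n. U $$ (x, a) * cnj (f a))) * qform n W f"
    by (simp only: sum_product[symmetric] qform_eq_sum)
  also have "(\<Sum>x<n. f x * (\<Sum>a<n. U $$ (x, a) * cnj (f a))) = qform n U f"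
    by (simp add: qform_def sum_distrib_left mult.assoc)
  finally show ?thesis .
qed

lemma qform_minus:
  "X \<in> carrier_mat n n \<Longrightarrow> Y \<in> carrier_mat n n \<Longrightarrow> qform n (X - Y) f = qform n X f - qform n Y f"
  by (simp add: qform_def algebra_simps sum_subtractf)

lemma qform_smult: "X \<in> carrier_mat n n \<Longrightarrow> qform n (s \<cdot>\<^sub>m X) f = s * qform n X f"
  by (simp add: qform_def sum_distrib_left mult_ac)

lemma qform_one: "qform n (1\<^sub>m n) f = of_real ((l2norm n f)\<^sup>2)"
  unfolding qform_def l2norm_sq of_real_sum complex_norm_square
  by (intro sum.cong refl) (simp add: if_distrib if_distribR cong: if_cong)

lemma mtrace_minus: "X \<in> carrier_mat n n \<Longrightarrow> Y \<in> carrier_mat n n \<Longrightarrow> mtrace (X - Y) = mtrace X - mtrace Y"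
  by (simp add: mtrace_def sum_subtractf)

lemma mtrace_smult: "X \<in> carrier_mat n n \<Longrightarrow> mtrace (s \<cdot>\<^sub>m X) = s * mtrace X"
  by (simp add: mtrace_def sum_distrib_left)

lemma mtrace_one: "mtrace (1\<^sub>m n) = of_nat n"
  by (simp add: mtrace_def)

definition hermitian_mat :: "nat \<Rightarrow> complex mat \<Rightarrow> bool" where
  "hermitian_mat n X \<longleftrightarrow> X \<in> carrier_mat n n \<and> mat_adjoint X = X"

lemma hermitian_matI:
  assumes "X \<in> carrier_mat n n" "\<And>i j. i < n \<Longrightarrow> j < n \<Longrightarrow> cnj (X $$ (j, i)) = X $$ (i, j)"
  shows "hermitian_mat n X"
proof -
  have "mat_adjoint X = X"
  proof (rule eq_matI)
    fix i j assume "i < dim_row X" "j < dim_col X"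
    thus "mat_adjoint X $$ (i, j) = X $$ (i, j)"
      using assms mat_adjoint_entry[OF assms(1), of i j] by simp
  qed (use assms(1) carrier_matD[OF mat_adjoint_carrier[OF assms(1)]] in auto)
  thus ?thesis using assms by (simp add: hermitian_mat_def)
qed

lemma hermitian_matD:
  assumes "hermitian_mat n X"
  shows "X \<in> carrier_mat n n" "mat_adjoint X = X"
    "\<And>i j. i < n \<Longrightarrow> j < n \<Longrightarrow> cnj (X $$ (j, i)) = X $$ (i, j)"
  using assms hermitian_entry[of X n] unfolding hermitian_mat_def by auto

lemma hermitian_mat_rank1_update:
  assumes "hermitian_mat n X"
  shows "hermitian_mat n (X + complex_of_real s \<cdot>\<^sub>m rank1 n f)"
  using hermitian_matD[OF assms] by (intro hermitian_matI) (auto simp: rank1_def)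

lemma resolvent_rank1:
  fixes f :: "nat \<Rightarrow> complex" and s :: real
  assumes X: "hermitian_mat n X" and z: "Im z > 0"
  defines "Y \<equiv> X + complex_of_real s \<cdot>\<^sub>m rank1 n f"
  shows "resolvent X z - resolvent Y z = of_real s \<cdot>\<^sub>m (resolvent X z * rank1 n f * resolvent Y z)"
proof -
  have Y: "hermitian_mat n Y" unfolding Y_def by (rule hermitian_mat_rank1_update[OF X])
  note XD = hermitian_matD[OF X] and YD = hermitian_matD[OF Y]
  have eq: "(Y - z \<cdot>\<^sub>m 1\<^sub>m n) - (X - z \<cdot>\<^sub>m 1\<^sub>m n) = of_real s \<cdot>\<^sub>m rank1 n f"
    using XD(1) by (intro eq_matI) (auto simp: Y_def rank1_def)
  have "resolvent X z - resolvent Y z = resolvent X z * (of_real s \<cdot>\<^sub>m rank1 n f) * resolvent Y z"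
    using resolvent_identity[OF XD(1,2) _ YD(1,2), of z z] z by (simp add: eq)
  thus ?thesis
    using XD(1) YD(1) mult_smult_distrib[of "resolvent X z" n n "rank1 n f" n]
      mult_smult_assoc_mat[OF mult_carrier_mat[of "resolvent X z" n n "rank1 n f" n], of "resolvent Y z" n] by simp
qed

text \<open>A rank one matrix \<open>u w\<^sup>T\<close> has trace \<open>w \<bullet> u\<close> and operator norm \<open>\<parallel>u\<parallel> \<parallel>w\<parallel>\<close>; hence the
  bound does not depend on the size of the perturbation.\<close>

lemma mtrace_resolvent_rank1:
  fixes f :: "nat \<Rightarrow> complex" and s :: real
  assumes X: "hermitian_mat n X" and z: "Im z > 0"
  defines "Y \<equiv> X + complex_of_real s \<cdot>\<^sub>m rank1 n f"
  shows "cmod (mtrace (resolvent X z) - mtrace (resolvent Y z)) \<le> 2 / Im z"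
proof -
  have Y: "hermitian_mat n Y" unfolding Y_def by (rule hermitian_mat_rank1_update[OF X])
  note XD = hermitian_matD[OF X] and YD = hermitian_matD[OF Y]
  let ?Q = "resolvent X z" and ?R = "resolvent Y z"
  have c: "?Q \<in> carrier_mat n n" "?R \<in> carrier_mat n n" using XD YD by auto
  define D where "D = ?Q - ?R"
  define u where "u x = of_real s * (\<Sum>a<n. ?Q $$ (x, a) * cnj (f a))" for x
  define w where "w y = (\<Sum>b<n. f b * ?R $$ (b, y))" for y
  have cD: "D \<in> carrier_mat n n" using c unfolding D_def by auto
  have D: "D $$ (x, y) = u x * w y" if "x < n" "y < n" for x y
  proof -
    have "D $$ (x, y) = of_real s * (?Q * rank1 n f * ?R) $$ (x, y)"
      unfolding D_def Y_def resolvent_rank1[OF X z, of s f]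
      using that c carrier_matD[OF c(1)] carrier_matD[OF c(2)] unfolding Y_def by (intro index_smult_mat) auto
    thus ?thesis using that c by (simp add: mult_rank1_mult_entry u_def w_def mult.assoc del: index_mult_mat(1))
  qed
  \<comment> \<open>The vector \<open>cnj w\<close> extracts the norms: \<open>D\<close> maps it to
    \<open>u\<close> times the squared norm of \<open>w\<close>. Bounding \<open>D\<close> as a
    difference of two resolvents gives \<open>2 / Im z\<close>, whatever the size of
    \<open>s\<close> and \<open>f\<close>.\<close>
  have "l2norm n (mapp n D (\<lambda>y. cnj (w y))) \<le> l2norm n (mapp n ?Q (\<lambda>y. cnj (w y))) + l2norm n (mapp n ?R (\<lambda>y. cnj (w y)))"
  proof -
    have "l2norm n (mapp n D (\<lambda>y. cnj (w y))) = l2norm n (\<lambda>i. mapp n ?Q (\<lambda>y. cnj (w y)) i - mapp n ?R (\<lambda>y. cnj (w y)) i)"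
      using c by (intro l2norm_cong) (simp add: mapp_def D_def algebra_simps sum_subtractf)
    thus ?thesis using l2norm_triangle by metis
  qed
  also have "\<dots> \<le> 1 / Im z * l2norm n w + 1 / Im z * l2norm n w"
    using opboundD[OF resolvent_opbound[OF XD(1,2) z], of "\<lambda>y. cnj (w y)"]
      opboundD[OF resolvent_opbound[OF YD(1,2) z], of "\<lambda>y. cnj (w y)"] by simp
  finally have 1: "l2norm n (mapp n D (\<lambda>y. cnj (w y))) \<le> 2 / Im z * l2norm n w" by simp
  have "mapp n D (\<lambda>y. cnj (w y)) i = u i * of_real ((l2norm n w)\<^sup>2)" if "i < n" for i
    unfolding l2norm_sq of_real_sum complex_norm_square sum_distrib_left mapp_def
    using that by (intro sum.cong refl) (simp add: D mult_ac)
  hence "l2norm n (mapp n D (\<lambda>y. cnj (w y))) = l2norm n (\<lambda>i. u i * of_real ((l2norm n w)\<^sup>2))"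
    by (intro l2norm_cong) simp
  also have "\<dots> = l2norm n u * (l2norm n w)\<^sup>2" unfolding l2norm_scale by (simp add: norm_power)
  finally have 2: "l2norm n w * (l2norm n u * l2norm n w) \<le> l2norm n w * (2 / Im z)"
    using 1 by (simp add: power2_eq_square mult_ac)
  have uw: "l2norm n u * l2norm n w \<le> 2 / Im z"
  proof (cases "l2norm n w = 0")
    case False
    hence "l2norm n w > 0" using l2norm_nonneg[of n w] by linarith
    thus ?thesis using 2 by (simp only: mult_le_cancel_left_pos)
  qed (use z in auto)
  have "mtrace ?Q - mtrace ?R = (\<Sum>i<n. u i * w i)"
    using mtrace_minus[OF c] cD D by (simp add: D_def[symmetric] mtrace_def)
  thus ?thesis using l2norm_CS[of u w n] uw by simp
qed

section \<open>The weighted sample covariance matrix\<close>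

text \<open>The matrix \<open>G' diag(\<tau>) G\<close>.\<close>

definition covar :: "nat \<Rightarrow> nat \<Rightarrow> (nat \<Rightarrow> real) \<Rightarrow> complex mat \<Rightarrow> complex mat" where
  "covar n L \<tau> G = mat n n (\<lambda>(a, b). \<Sum>i<L. of_real (\<tau> i) * (cnj (G $$ (i, a)) * G $$ (i, b)))"

lemma covar_carrier [simp]: "covar n L \<tau> G \<in> carrier_mat n n"
  by (simp add: covar_def)

lemma covar_eq:
  assumes G: "G \<in> carrier_mat L n" and T: "T \<in> carrier_mat L L" "diagonal_mat T" "\<And>i. i < L \<Longrightarrow> T $$ (i, i) \<in> \<real>"
  shows "mat_adjoint G * T * G = covar n L (\<lambda>i. Re (T $$ (i, i))) G"
proof (rule eq_matI)
  fix a b assume "a < dim_row (covar n L (\<lambda>i. Re (T $$ (i, i))) G)" "b < dim_col (covar n L (\<lambda>i. Re (T $$ (i, i))) G)"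
  hence ab: "a < n" "b < n" by (auto simp: covar_def)
  have c: "mat_adjoint G \<in> carrier_mat n L" "mat_adjoint G * T \<in> carrier_mat n L"
    using mat_adjoint_carrier[OF G] mult_carrier_mat[OF mat_adjoint_carrier[OF G] T(1)] by auto
  have "(mat_adjoint G * T) $$ (a, i) = of_real (Re (T $$ (i, i))) * cnj (G $$ (i, a))" if "i < L" for i
  proof -
    have "(mat_adjoint G * T) $$ (a, i) = (\<Sum>k<L. mat_adjoint G $$ (a, k) * T $$ (k, i))"
      using ab that c T by (simp add: mult_mat_entry del: index_mult_mat(1))
    also have "\<dots> = (\<Sum>k<L. if k = i then mat_adjoint G $$ (a, i) * T $$ (i, i) else 0)"
      using T that by (intro sum.cong refl) (auto simp: diagonal_mat_def)
    finally show ?thesis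
      using that T(3)[OF that] ab by (simp add: mat_adjoint_entry[OF G] mult.commute)
  qed
  thus "(mat_adjoint G * T * G) $$ (a, b) = covar n L (\<lambda>i. Re (T $$ (i, i))) G $$ (a, b)"
    using ab c G by (subst mult_mat_entry[OF c(2) G ab]) (simp add: covar_def mult.assoc)
qed (use assms carrier_matD[OF mat_adjoint_carrier[OF G]] in \<open>auto simp: covar_def\<close>)

lemma hermitian_mat_add_covar:
  assumes "hermitian_mat n A"
  shows "hermitian_mat n (A + covar n L \<tau> G)"
  using hermitian_matD[OF assms] by (intro hermitian_matI) (auto simp: covar_def mult.commute)

text \<open>Isolates row \<open>i\<close>. The value \<open>s = 0\<close> leaves the matrix without
  that row; other values replace one weight by another, as truncation does.\<close>

lemma add_covar_update:
  assumes "A \<in> carrier_mat n n" "i < L"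
  shows "A + covar n L \<tau> G = (A + covar n L (\<tau>(i := s)) G) + complex_of_real (\<tau> i - s) \<cdot>\<^sub>m rank1 n (\<lambda>b. G $$ (i, b))"
proof (rule eq_matI)
  fix a b assume "a < dim_row ((A + covar n L (\<tau>(i := s)) G) + complex_of_real (\<tau> i - s) \<cdot>\<^sub>m rank1 n (\<lambda>b. G $$ (i, b)))"
    "b < dim_col ((A + covar n L (\<tau>(i := s)) G) + complex_of_real (\<tau> i - s) \<cdot>\<^sub>m rank1 n (\<lambda>b. G $$ (i, b)))"
  hence ab: "a < n" "b < n" by (auto simp: covar_def rank1_def)
  let ?g = "\<lambda>k. cnj (G $$ (k, a)) * G $$ (k, b)"
  have "(\<Sum>k<L. of_real (\<tau> k) * ?g k) = of_real (\<tau> i) * ?g i + (\<Sum>k\<in>{..<L} - {i}. of_real (\<tau> k) * ?g k)"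
    using assms by (intro sum.remove) auto
  moreover have "(\<Sum>k<L. of_real ((\<tau>(i := s)) k) * ?g k) = of_real s * ?g i + (\<Sum>k\<in>{..<L} - {i}. of_real (\<tau> k) * ?g k)"
    using assms by (subst sum.remove[of "{..<L}" i]) auto
  ultimately show "(A + covar n L \<tau> G) $$ (a, b) = ((A + covar n L (\<tau>(i := s)) G) + complex_of_real (\<tau> i - s) \<cdot>\<^sub>m rank1 n (\<lambda>b. G $$ (i, b))) $$ (a, b)"
    using ab assms(1) by (simp add: covar_def rank1_def algebra_simps)
qed (use assms in \<open>auto simp: covar_def rank1_def\<close>)

lemma covar_cong: "(\<And>i. i < L \<Longrightarrow> \<tau> i = \<sigma> i) \<Longrightarrow> covar n L \<tau> G = covar n L \<sigma> G"
  by (simp add: covar_def)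

text \<open>The weights are exchanged one index at a time. An exchange of equal weights is free, and
  any other is a rank one update with a cost that does not depend on the weights.\<close>

lemma mtrace_resolvent_covar_change:
  assumes A: "hermitian_mat n A" and z: "Im z > 0"
  shows "cmod (mtrace (resolvent (A + covar n L \<tau> G) z) - mtrace (resolvent (A + covar n L \<sigma> G) z))
    \<le> 2 / Im z * real (card {i. i < L \<and> \<tau> i \<noteq> \<sigma> i})"
proof -
  define h where "h k = (\<lambda>i. if i < k then \<sigma> i else \<tau> i)" for k
  define t where "t k = mtrace (resolvent (A + covar n L (h k) G) z)" for k
  have step: "cmod (t k - t (Suc k)) \<le> (if \<tau> k \<noteq> \<sigma> k then 2 / Im z else 0)" if "k < L" for k
  proof (cases "\<tau> k = \<sigma> k")
    case True
    hence "h (Suc k) = h k" by (auto simp: h_def fun_eq_iff less_Suc_eq)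
    thus ?thesis using True by (simp add: t_def)
  next
    case False
    have "h (Suc k) = (h k)(k := \<sigma> k)" by (auto simp: h_def fun_eq_iff less_Suc_eq)
    hence "A + covar n L (h k) G = (A + covar n L (h (Suc k)) G) + complex_of_real (h k k - \<sigma> k) \<cdot>\<^sub>m rank1 n (\<lambda>b. G $$ (k, b))"
      using add_covar_update[OF hermitian_matD(1)[OF A] that, of "h k" G "\<sigma> k"] by simp
    hence "cmod (t (Suc k) - t k) \<le> 2 / Im z"
      using mtrace_resolvent_rank1[OF hermitian_mat_add_covar[OF A, of L "h (Suc k)" G] z,
        where s="h k k - \<sigma> k" and f="\<lambda>b. G $$ (k, b)"] by (simp add: t_def)
    thus ?thesis using False by (simp add: norm_minus_commute)
  qed
  have "cmod (t 0 - t k) \<le> (\<Sum>i<k. if \<tau> i \<noteq> \<sigma> i then 2 / Im z else 0)" if "k \<le> L" for k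
    using that
  proof (induction k)
    case (Suc k)
    have "cmod (t 0 - t (Suc k)) \<le> cmod (t 0 - t k) + cmod (t k - t (Suc k))"
      using norm_triangle_ineq[of "t 0 - t k" "t k - t (Suc k)"] by simp
    thus ?case using Suc step[of k] by simp
  qed simp
  from this[of L] have "cmod (t 0 - t L) \<le> (\<Sum>i<L. if \<tau> i \<noteq> \<sigma> i then 2 / Im z else 0)" by simp
  also have "\<dots> = (\<Sum>i\<in>{i. i < L \<and> \<tau> i \<noteq> \<sigma> i}. 2 / Im z)"
    by (rule sum.mono_neutral_cong_right) auto
  finally have "cmod (t 0 - t L) \<le> 2 / Im z * real (card {i. i < L \<and> \<tau> i \<noteq> \<sigma> i})" by (simp add: mult.commute)
  moreover have "covar n L (h L) G = covar n L \<sigma> G" by (rule covar_cong) (simp add: h_def)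
  moreover have "h 0 = \<tau>" by (simp add: h_def)
  ultimately show ?thesis by (simp add: t_def)
qed

lemma mtrace_mult_covar_mult:
  assumes "U \<in> carrier_mat n n" "W \<in> carrier_mat n n"
  shows "mtrace (U * covar n L \<tau> G * W) = (\<Sum>i<L. of_real (\<tau> i) * qform n (W * U) (\<lambda>b. G $$ (i, b)))"
proof -
  have c: "U * covar n L \<tau> G \<in> carrier_mat n n" using assms by auto
  have WU: "W * U \<in> carrier_mat n n" using assms by auto
  have "mtrace (U * covar n L \<tau> G * W) = mtrace (W * (U * covar n L \<tau> G))"
    using mtrace_mult_comm[OF c assms(2)] .
  also have "\<dots> = mtrace (W * U * covar n L \<tau> G)"
    using assms assoc_mult_mat[of W n n U n "covar n L \<tau> G" n] by simp
  also have "\<dots> = (\<Sum>a<n. \<Sum>b<n. (W * U) $$ (a, b) * (\<Sum>i<L. of_real (\<tau> i) * (cnj (G $$ (i, b)) * G $$ (i, a))))"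
  proof -
    have "(W * U * covar n L \<tau> G) $$ (a, a) = (\<Sum>b<n. (W * U) $$ (a, b) * (\<Sum>i<L. of_real (\<tau> i) * (cnj (G $$ (i, b)) * G $$ (i, a))))"
      if "a < n" for a
      by (subst mult_mat_entry[OF WU covar_carrier that that], rule sum.cong) (use that in \<open>auto simp: covar_def\<close>)
    thus ?thesis using assms by (simp add: mtrace_def del: index_mult_mat(1))
  qed
  also have "\<dots> = (\<Sum>a<n. \<Sum>i<L. \<Sum>b<n. of_real (\<tau> i) * (G $$ (i, a) * (W * U) $$ (a, b) * cnj (G $$ (i, b))))"
    by (rule sum.cong[OF refl], subst sum.swap) (simp add: sum_distrib_left mult_ac)
  also have "\<dots> = (\<Sum>i<L. of_real (\<tau> i) * qform n (W * U) (\<lambda>b. G $$ (i, b)))"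
    by (subst sum.swap) (simp add: qform_def sum_distrib_left)
  finally show ?thesis .
qed

text \<open>The resolvent identity gives
  \<open>tr R - tr Q = \<Sum> \<tau>_i x_i - h tr (Q R)\<close> with
  \<open>x_i = g_i Q R g_i'\<close>. Passing to the resolvent \<open>Qi\<close> without row
  \<open>i\<close> turns \<open>x_i\<close> into \<open>y_i = (1 + \<tau>_i q_i) x_i\<close>, where
  \<open>q_i = g_i Qi g_i'\<close>. If \<open>q_i\<close> were \<open>m\<close>, this would read
  \<open>\<tau>_i x_i = \<theta>_i y_i\<close>; and \<open>y_i\<close> is close to
  \<open>tr (Q R) / n\<close>, so that \<open>\<Sum> \<theta>_i / n\<close> cancels against
  \<open>h\<close>. The three summands of the bound are the fluctuation of \<open>y_i\<close>, the
  error of replacing \<open>q_i\<close> by \<open>m\<close>, and the mismatch between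
  \<open>\<Sum> \<theta>_i / n\<close> and \<open>h\<close>. The terms
  \<open>\<Lambda> \<eta>_i / n\<close> are the price of exchanging traces with and without row
  \<open>i\<close>.\<close>

lemma resolvent_comparison:
  fixes \<tau> :: "nat \<Rightarrow> real" and G :: "complex mat"
  assumes n: "n > 0" and A: "hermitian_mat n A" and z: "Im z \<ge> 2" and zh: "Im (z - h) \<ge> Im z / 2"
    and \<Lambda>: "\<And>i. i < L \<Longrightarrow> \<bar>\<tau> i\<bar> \<le> \<Lambda>" "\<Lambda> \<ge> 0"
    and m: "\<And>i. i < L \<Longrightarrow> cmod (1 + of_real (\<tau> i) * m) \<ge> 1 / 2"
  defines "Q \<equiv> resolvent (A + covar n L \<tau> G) z"
    and "Qi \<equiv> \<lambda>i. resolvent (A + covar n L (\<tau>(i := 0)) G) z"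
    and "R \<equiv> resolvent A (z - h)"
    and "g \<equiv> \<lambda>i b. G $$ (i, b)"
    and "\<theta> \<equiv> \<lambda>i. of_real (\<tau> i) / (1 + of_real (\<tau> i) * m)"
  defines "\<eta> \<equiv> \<lambda>i. (l2norm n (g i))\<^sup>2"
    and "e \<equiv> \<lambda>i. cmod (qform n (Qi i) (g i) - mtrace (Qi i) / of_nat n)"
    and "f \<equiv> \<lambda>i. cmod (qform n (Qi i * R) (g i) - mtrace (Qi i * R) / of_nat n)"
  shows "cmod (mtrace R / of_nat n - mtrace Q / of_nat n) \<le>
      (2 * \<Lambda> / real n) * (\<Sum>i<L. f i + \<Lambda> * \<eta> i / real n)
    + (2 * \<Lambda>\<^sup>2 / real n) * (\<Sum>i<L. (cmod (m - mtrace Q / of_nat n) + \<Lambda> * \<eta> i / real n + e i) * (2 / (Im z)\<^sup>2 * \<eta> i))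
    + cmod ((\<Sum>i<L. \<theta> i) / of_nat n - h)"
proof -
  define v where "v = Im z"
  have v: "v \<ge> 2" "v > 0" using z by (auto simp: v_def)
  \<comment> \<open>Most products of resolvent norms are simply bounded by 1. Only the factor
    \<open>2 / v^2\<close> on \<open>x i\<close> is kept, since it makes the coefficient of the
    unknown small. The 2 in it comes from \<open>R\<close>, whose spectral parameter has height at
    least \<open>v / 2\<close>.\<close>
  have v1: "1 / v\<^sup>2 \<le> 1" "2 / v\<^sup>2 \<le> 1" "1 / v * (2 / v) * (1 / v) \<le> 1"
  proof -
    have "v\<^sup>2 \<ge> 2\<^sup>2" using v by (intro power_mono) auto
    thus "1 / v\<^sup>2 \<le> 1" and 2: "2 / v\<^sup>2 \<le> 1" using v by (auto simp: field_simps)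
    have "2 / v\<^sup>2 * (1 / v) \<le> 1 * 1" using 2 v by (intro mult_mono) auto
    thus "1 / v * (2 / v) * (1 / v) \<le> 1" by (simp add: power2_eq_square)
  qed
  note AD = hermitian_matD[OF A]
  have H: "hermitian_mat n (A + covar n L \<sigma> G)" for \<sigma> by (rule hermitian_mat_add_covar[OF A])
  have cQ: "Q \<in> carrier_mat n n" and cQi: "Qi i \<in> carrier_mat n n" and cR: "R \<in> carrier_mat n n" for i
    using AD(1) hermitian_matD(1)[OF H] by (auto simp: Q_def Qi_def R_def)
  have oQ: "opbound n Q (1 / v)" and oQi: "opbound n (Qi i) (1 / v)" for i
    using resolvent_opbound[OF hermitian_matD(1,2)[OF H]] v by (auto simp: Q_def Qi_def v_def)
  have oR: "opbound n R (2 / v)"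
  proof (rule opbound_mono)
    show "opbound n R (1 / Im (z - h))"
      unfolding R_def using zh v by (intro resolvent_opbound AD) (auto simp: v_def)
    have "1 / Im (z - h) \<le> 1 / (v / 2)" using zh v unfolding v_def by (intro divide_left_mono) auto
    thus "1 / Im (z - h) \<le> 2 / v" by simp
  qed
  have QR: "Q * R \<in> carrier_mat n n" "opbound n (Q * R) (1 / v * (2 / v))"
    using cQ cR opbound_mult[OF cQ cR oQ oR] by auto
  have \<eta>0: "0 \<le> \<eta> i" for i by (simp add: \<eta>_def)
  define q where "q i = qform n (Qi i) (g i)" for i
  define x where "x i = qform n (Q * R) (g i)" for i
  define y where "y i = qform n (Qi i * R) (g i)" for i
  define T where "T = mtrace (Q * R)"
  have diff: "Qi i - Q = of_real (\<tau> i) \<cdot>\<^sub>m (Qi i * rank1 n (g i) * Q)" if "i < L" for i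
    using resolvent_rank1[OF H[of "\<tau>(i := 0)"], of z "\<tau> i" "g i"] v
      add_covar_update[OF AD(1) that, of \<tau> G 0] by (simp add: Q_def Qi_def g_def v_def)
  have diffR: "Qi i * R - Q * R = of_real (\<tau> i) \<cdot>\<^sub>m (Qi i * rank1 n (g i) * (Q * R))" if "i < L" for i
  proof -
    have c1: "Qi i * rank1 n (g i) \<in> carrier_mat n n" and c2: "Qi i * rank1 n (g i) * Q \<in> carrier_mat n n"
      using cQi[of i] cQ by auto
    have "Qi i * R - Q * R = (Qi i - Q) * R" using minus_mult_distrib_mat[OF cQi cQ cR] by simp
    also have "\<dots> = of_real (\<tau> i) \<cdot>\<^sub>m (Qi i * rank1 n (g i) * Q * R)"
      unfolding diff[OF that] by (rule mult_smult_assoc_mat[OF c2 cR])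
    also have "Qi i * rank1 n (g i) * Q * R = Qi i * rank1 n (g i) * (Q * R)"
      by (rule assoc_mult_mat[OF c1 cQ cR])
    finally show ?thesis .
  qed
  have yx: "y i = x i + of_real (\<tau> i) * q i * x i" if "i < L" for i
  proof -
    have "y i - x i = qform n (Qi i * R - Q * R) (g i)"
      using qform_minus[of "Qi i * R" n "Q * R"] cQi[of i] cR QR(1) by (simp add: y_def x_def)
    also have "\<dots> = of_real (\<tau> i) * (q i * x i)"
      unfolding diffR[OF that] using qform_mult_rank1_mult[OF cQi[of i] QR(1)]
        mult_carrier_mat[OF mult_carrier_mat[OF cQi[of i] rank1_carrier] QR(1)]
      by (subst qform_smult[of _ n]) (auto simp: q_def x_def)
    finally show ?thesis by (simp add: algebra_simps)
  qed
  have xb: "cmod (x i) \<le> 2 / v\<^sup>2 * \<eta> i" for i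
    using qform_bound[OF QR(2), of "g i"] by (simp add: x_def \<eta>_def power2_eq_square)
  have trb: "cmod (mtrace (Qi i * R) - T) \<le> \<Lambda> * \<eta> i" if "i < L" for i
  proof -
    have c: "Qi i * R \<in> carrier_mat n n" by (rule mult_carrier_mat[OF cQi cR])
    have "mtrace (Qi i * R) - T = mtrace (Qi i * R - Q * R)"
      unfolding T_def by (rule mtrace_minus[OF c QR(1), symmetric])
    also have "\<dots> = of_real (\<tau> i) * qform n (Q * R * Qi i) (g i)"
      unfolding diffR[OF that] using mtrace_mult_rank1_mult[OF cQi[of i] QR(1)]
        mult_carrier_mat[OF mult_carrier_mat[OF cQi[of i] rank1_carrier] QR(1)]
      by (subst mtrace_smult[of _ n]) auto
    finally have "cmod (mtrace (Qi i * R) - T) = \<bar>\<tau> i\<bar> * cmod (qform n (Q * R * Qi i) (g i))"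
      by (simp add: norm_mult)
    also have "\<dots> \<le> \<Lambda> * (1 / v * (2 / v) * (1 / v) * \<eta> i)"
      using qform_bound[OF opbound_mult[OF QR(1) cQi[of i] QR(2) oQi]] \<Lambda>(1)[OF that] \<Lambda>(2)
      unfolding \<eta>_def by (intro mult_mono) auto
    also have "\<dots> \<le> \<Lambda> * (1 * \<eta> i)"
      using v1(3) \<Lambda>(2) \<eta>0 by (intro mult_left_mono mult_right_mono) auto
    finally show ?thesis by simp
  qed
  have tr: "cmod (mtrace (Qi i) - mtrace Q) \<le> \<Lambda> * \<eta> i" if "i < L" for i
  proof -
    have "mtrace (Qi i) - mtrace Q = mtrace (Qi i - Q)"
      by (rule mtrace_minus[OF cQi cQ, symmetric])
    also have "\<dots> = of_real (\<tau> i) * qform n (Q * Qi i) (g i)"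
      unfolding diff[OF that] using mtrace_mult_rank1_mult[OF cQi[of i] cQ]
        mult_carrier_mat[OF mult_carrier_mat[OF cQi[of i] rank1_carrier] cQ]
      by (subst mtrace_smult[of _ n]) auto
    finally have "cmod (mtrace (Qi i) - mtrace Q) = \<bar>\<tau> i\<bar> * cmod (qform n (Q * Qi i) (g i))"
      by (simp add: norm_mult)
    also have "\<dots> \<le> \<Lambda> * (1 / v * (1 / v) * \<eta> i)"
      using qform_bound[OF opbound_mult[OF cQ cQi[of i] oQ oQi]] \<Lambda>(1)[OF that] \<Lambda>(2)
      unfolding \<eta>_def by (intro mult_mono) auto
    also have "\<dots> \<le> \<Lambda> * (1 * \<eta> i)"
      using v1(1) \<Lambda>(2) \<eta>0 by (intro mult_left_mono mult_right_mono) (auto simp: power2_eq_square)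
    finally show ?thesis by simp
  qed
  have main: "mtrace R - mtrace Q = (\<Sum>i<L. of_real (\<tau> i) * x i) - h * T"
  proof -
    have eq: "(A + covar n L \<tau> G - z \<cdot>\<^sub>m 1\<^sub>m n) - (A - (z - h) \<cdot>\<^sub>m 1\<^sub>m n) = covar n L \<tau> G - h \<cdot>\<^sub>m 1\<^sub>m n"
      using AD(1) by (intro eq_matI) (auto simp: covar_def algebra_simps)
    have "R - Q = R * (covar n L \<tau> G - h \<cdot>\<^sub>m 1\<^sub>m n) * Q"
      unfolding R_def Q_def using zh v
      by (subst resolvent_identity[OF AD(1,2) _ hermitian_matD(1,2)[OF H]]) (auto simp: eq v_def)
    also have "\<dots> = (R * covar n L \<tau> G - R * (h \<cdot>\<^sub>m 1\<^sub>m n)) * Q"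
      using cR by (subst mult_minus_distrib_mat[of R n n _ n]) auto
    also have "\<dots> = R * covar n L \<tau> G * Q - R * (h \<cdot>\<^sub>m 1\<^sub>m n) * Q"
      using cR cQ mult_carrier_mat[OF cR covar_carrier[of n L \<tau> G]]
      by (intro minus_mult_distrib_mat[of _ n n]) auto
    also have "R * (h \<cdot>\<^sub>m 1\<^sub>m n) = h \<cdot>\<^sub>m R"
      using cR mult_smult_distrib[OF cR one_carrier_mat, of h] by simp
    also have "h \<cdot>\<^sub>m R * Q = h \<cdot>\<^sub>m (R * Q)"
      by (rule mult_smult_assoc_mat[OF cR cQ])
    finally have RQ: "R - Q = R * covar n L \<tau> G * Q - h \<cdot>\<^sub>m (R * Q)" .
    have c: "R * covar n L \<tau> G * Q \<in> carrier_mat n n" "R * Q \<in> carrier_mat n n" "h \<cdot>\<^sub>m (R * Q) \<in> carrier_mat n n"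
      using cR cQ mult_carrier_mat[OF mult_carrier_mat[OF cR covar_carrier[of n L \<tau> G]] cQ] by auto
    have "mtrace R - mtrace Q = mtrace (R - Q)" by (rule mtrace_minus[OF cR cQ, symmetric])
    also have "\<dots> = mtrace (R * covar n L \<tau> G * Q) - mtrace (h \<cdot>\<^sub>m (R * Q))"
      unfolding RQ by (rule mtrace_minus[OF c(1,3)])
    also have "mtrace (h \<cdot>\<^sub>m (R * Q)) = h * T"
      using mtrace_smult[OF c(2)] mtrace_mult_comm[OF cR cQ] by (simp add: T_def)
    also have "mtrace (R * covar n L \<tau> G * Q) = (\<Sum>i<L. of_real (\<tau> i) * x i)"
      unfolding mtrace_mult_covar_mult[OF cR cQ] by (simp add: x_def g_def)
    finally show ?thesis .
  qed
  have \<theta>b: "cmod (\<theta> i) \<le> 2 * \<Lambda>" if "i < L" for i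
  proof -
    have "cmod (\<theta> i) = \<bar>\<tau> i\<bar> / cmod (1 + of_real (\<tau> i) * m)" by (simp add: \<theta>_def norm_divide)
    also have "\<dots> \<le> \<Lambda> / (1 / 2)" using \<Lambda>(1)[OF that] m[OF that] by (intro frac_le) auto
    finally show ?thesis by simp
  qed
  \<comment> \<open>The factor \<open>1 + \<tau>_i m\<close>, bounded away from zero by assumption,
    is inserted and divided out again; \<open>y_i = (1 + \<tau>_i q_i) x_i\<close> then leaves the
    error \<open>\<tau>_i (m - q_i) x_i\<close>.\<close>
  have \<theta>x: "of_real (\<tau> i) * x i = \<theta> i * (y i - T / of_nat n) + \<theta> i * (of_real (\<tau> i) * (m - q i) * x i) + \<theta> i * (T / of_nat n)"
    if "i < L" for i
  proof -
    have nz: "1 + of_real (\<tau> i) * m \<noteq> 0" using m[OF that] by auto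
    have "of_real (\<tau> i) = \<theta> i * (1 + of_real (\<tau> i) * m)" using nz by (simp add: \<theta>_def)
    hence "of_real (\<tau> i) * x i = \<theta> i * (1 + of_real (\<tau> i) * m) * x i" by (rule arg_cong)
    also have "\<dots> = \<theta> i * ((1 + of_real (\<tau> i) * m) * x i)" by (rule mult.assoc)
    also have "(1 + of_real (\<tau> i) * m) * x i = y i + of_real (\<tau> i) * (m - q i) * x i"
      by (simp add: yx[OF that] algebra_simps)
    finally show ?thesis by (simp add: algebra_simps)
  qed
  define M where "M = mtrace Q / of_nat n"
  have dec: "mtrace R / of_nat n - mtrace Q / of_nat n =
      (\<Sum>i<L. \<theta> i * (y i - T / of_nat n)) / of_nat n + (\<Sum>i<L. \<theta> i * (of_real (\<tau> i) * (m - q i) * x i)) / of_nat n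
      + ((\<Sum>i<L. \<theta> i) / of_nat n - h) * (T / of_nat n)"
  proof -
    have "(\<Sum>i<L. of_real (\<tau> i) * x i) = (\<Sum>i<L. \<theta> i * (y i - T / of_nat n)) + (\<Sum>i<L. \<theta> i * (of_real (\<tau> i) * (m - q i) * x i))
      + (\<Sum>i<L. \<theta> i) * (T / of_nat n)"
      unfolding sum_distrib_right sum.distrib[symmetric] by (intro sum.cong refl \<theta>x) simp
    moreover have "(S1 + S2 + S3 * (T / of_nat n) - h * T) / of_nat n = S1 / of_nat n + S2 / of_nat n + (S3 / of_nat n - h) * (T / of_nat n)"
      for S1 S2 S3 by (simp add: add_divide_distrib diff_divide_distrib left_diff_distrib)
    ultimately show ?thesis unfolding diff_divide_distrib[symmetric] main by simp
  qed
  have "cmod (mtrace R / of_nat n - mtrace Q / of_nat n) \<le>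
      cmod ((\<Sum>i<L. \<theta> i * (y i - T / of_nat n)) / of_nat n) + cmod ((\<Sum>i<L. \<theta> i * (of_real (\<tau> i) * (m - q i) * x i)) / of_nat n)
      + cmod (((\<Sum>i<L. \<theta> i) / of_nat n - h) * (T / of_nat n))"
    by (subst dec) (rule order_trans[OF norm_triangle_ineq add_right_mono[OF norm_triangle_ineq]])
  also have "cmod ((\<Sum>i<L. \<theta> i * (y i - T / of_nat n)) / of_nat n) \<le> (2 * \<Lambda> / real n) * (\<Sum>i<L. f i + \<Lambda> * \<eta> i / real n)"
  proof -
    have "cmod (\<theta> i * (y i - T / of_nat n)) \<le> 2 * \<Lambda> * (f i + \<Lambda> * \<eta> i / real n)" if "i < L" for i
    proof -
      have eq: "y i - T / of_nat n = (y i - mtrace (Qi i * R) / of_nat n) + (mtrace (Qi i * R) - T) / of_nat n"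
        by (simp add: diff_divide_distrib)
      have "cmod (y i - T / of_nat n) \<le> cmod (y i - mtrace (Qi i * R) / of_nat n) + cmod ((mtrace (Qi i * R) - T) / of_nat n)"
        by (subst eq) (rule norm_triangle_ineq)
      also have "cmod (y i - mtrace (Qi i * R) / of_nat n) = f i" by (simp only: f_def y_def)
      also have "cmod ((mtrace (Qi i * R) - T) / of_nat n) \<le> \<Lambda> * \<eta> i / real n"
        unfolding norm_divide norm_of_nat by (intro divide_right_mono trb that) simp
      finally have "cmod (y i - T / of_nat n) \<le> f i + \<Lambda> * \<eta> i / real n" by simp
      thus ?thesis unfolding norm_mult using \<theta>b[OF that] \<Lambda>(2) by (intro mult_mono) auto
    qed
    hence "cmod (\<Sum>i<L. \<theta> i * (y i - T / of_nat n)) \<le> (\<Sum>i<L. 2 * \<Lambda> * (f i + \<Lambda> * \<eta> i / real n))"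
      by (intro sum_norm_le) auto
    also have "\<dots> = 2 * \<Lambda> * (\<Sum>i<L. f i + \<Lambda> * \<eta> i / real n)" by (simp only: sum_distrib_left)
    finally have "cmod (\<Sum>i<L. \<theta> i * (y i - T / of_nat n)) / real n \<le> 2 * \<Lambda> * (\<Sum>i<L. f i + \<Lambda> * \<eta> i / real n) / real n"
      by (intro divide_right_mono) auto
    thus ?thesis by (simp only: norm_divide norm_of_nat times_divide_eq_left)
  qed
  also have "cmod ((\<Sum>i<L. \<theta> i * (of_real (\<tau> i) * (m - q i) * x i)) / of_nat n) \<le>
      (2 * \<Lambda>\<^sup>2 / real n) * (\<Sum>i<L. (cmod (m - M) + \<Lambda> * \<eta> i / real n + e i) * (2 / v\<^sup>2 * \<eta> i))"
  proof -
    have "cmod (\<theta> i * (of_real (\<tau> i) * (m - q i) * x i)) \<le> 2 * \<Lambda> * (\<Lambda> * (cmod (m - M) + \<Lambda> * \<eta> i / real n + e i) * (2 / v\<^sup>2 * \<eta> i))"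
      if "i < L" for i
    proof -
      \<comment> \<open>The first difference is the unknown to be absorbed later, the second the
        price of restoring row \<open>i\<close> in the trace, the third the fluctuation
        \<open>e i\<close>.\<close>
      have eq: "m - q i = (m - M) + ((mtrace Q - mtrace (Qi i)) / of_nat n + (mtrace (Qi i) / of_nat n - q i))"
        by (simp add: M_def diff_divide_distrib)
      have "cmod (m - q i) \<le> cmod (m - M) + (cmod ((mtrace Q - mtrace (Qi i)) / of_nat n) + cmod (mtrace (Qi i) / of_nat n - q i))"
        by (subst eq) (rule order_trans[OF norm_triangle_ineq add_left_mono[OF norm_triangle_ineq]])
      also have "cmod ((mtrace Q - mtrace (Qi i)) / of_nat n) \<le> \<Lambda> * \<eta> i / real n"
        unfolding norm_divide norm_of_nat norm_minus_commute[of "mtrace Q"] by (intro divide_right_mono tr that) simp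
      also have "cmod (mtrace (Qi i) / of_nat n - q i) = e i"
        unfolding e_def q_def by (rule norm_minus_commute)
      finally have mq: "cmod (m - q i) \<le> cmod (m - M) + \<Lambda> * \<eta> i / real n + e i" by simp
      have "cmod (of_real (\<tau> i) * (m - q i) * x i) \<le> \<Lambda> * (cmod (m - M) + \<Lambda> * \<eta> i / real n + e i) * (2 / v\<^sup>2 * \<eta> i)"
        unfolding norm_mult using \<Lambda>(1)[OF that] \<Lambda>(2) mq xb[of i] \<eta>0[of i]
        by (intro mult_mono mult_nonneg_nonneg add_nonneg_nonneg divide_nonneg_nonneg) (auto simp: e_def)
      thus ?thesis unfolding norm_mult[of "\<theta> i"] using \<theta>b[OF that] \<Lambda>(2) by (intro mult_mono) auto
    qed
    hence "cmod (\<Sum>i<L. \<theta> i * (of_real (\<tau> i) * (m - q i) * x i)) \<le>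
        (\<Sum>i<L. 2 * \<Lambda> * (\<Lambda> * (cmod (m - M) + \<Lambda> * \<eta> i / real n + e i) * (2 / v\<^sup>2 * \<eta> i)))"
      by (intro sum_norm_le) auto
    also have "\<dots> = 2 * \<Lambda>\<^sup>2 * (\<Sum>i<L. (cmod (m - M) + \<Lambda> * \<eta> i / real n + e i) * (2 / v\<^sup>2 * \<eta> i))"
      by (simp only: sum_distrib_left power2_eq_square mult.assoc)
    finally have "cmod (\<Sum>i<L. \<theta> i * (of_real (\<tau> i) * (m - q i) * x i)) / real n \<le>
        2 * \<Lambda>\<^sup>2 * (\<Sum>i<L. (cmod (m - M) + \<Lambda> * \<eta> i / real n + e i) * (2 / v\<^sup>2 * \<eta> i)) / real n"
      by (intro divide_right_mono) auto
    thus ?thesis by (simp only: norm_divide norm_of_nat times_divide_eq_left)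
  qed
  also have "cmod (((\<Sum>i<L. \<theta> i) / of_nat n - h) * (T / of_nat n)) \<le> cmod ((\<Sum>i<L. \<theta> i) / of_nat n - h) * 1"
  proof -
    have "cmod T \<le> real n * (1 / v * (2 / v))" unfolding T_def by (rule mtrace_bound[OF QR])
    hence "cmod (T / of_nat n) \<le> 2 / v\<^sup>2"
      using n by (simp add: norm_divide divide_le_eq power2_eq_square mult.commute)
    thus ?thesis unfolding norm_mult using v1(2) by (intro mult_left_mono) auto
  qed
  finally show ?thesis unfolding M_def v_def by (simp only: mult_1_right)
qed

section \<open>Eigenvalues and resolvent traces through triangularization\<close>

lemma upper_triangular_right_inverse_diag:
  fixes U V :: "complex mat"
  assumes c: "U \<in> carrier_mat n n" "V \<in> carrier_mat n n" and ut: "upper_triangular U"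
    and nz: "\<And>i. i < n \<Longrightarrow> U $$ (i, i) \<noteq> 0" and UV: "U * V = 1\<^sub>m n" and i: "i < n"
  shows "V $$ (i, i) = 1 / U $$ (i, i)"
proof -
  have row: "U $$ (i, i) * V $$ (i, j) + (\<Sum>k\<in>{i<..<n}. U $$ (i, k) * V $$ (k, j)) = (if i = j then 1 else 0)"
    if "i < n" "j < n" for i j
  proof -
    have "(if i = j then 1 else 0) = (\<Sum>k<n. U $$ (i, k) * V $$ (k, j))"
      using mult_mat_entry[OF c that] UV that by simp
    also have "\<dots> = (\<Sum>k\<in>insert i {i<..<n}. U $$ (i, k) * V $$ (k, j))"
      using that ut c by (intro sum.mono_neutral_right) (auto simp: upper_triangular_def)
    finally show ?thesis by simp
  qed
  \<comment> \<open>Back substitution: the rows are treated from the last one upwards, hence the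
    induction on \<open>n - i\<close>.\<close>
  have low: "V $$ (i, j) = 0" if "j < i" "i < n" for i j
    using that
  proof (induction "n - i" arbitrary: i rule: less_induct)
    case less
    have "(\<Sum>k\<in>{i<..<n}. U $$ (i, k) * V $$ (k, j)) = 0"
      using less by (intro sum.neutral) (auto intro!: disjI2 diff_less_mono2)
    thus ?case using row[of i j] less.prems nz[of i] by simp
  qed
  have "(\<Sum>k\<in>{i<..<n}. U $$ (i, k) * V $$ (k, i)) = 0"
    using low by (intro sum.neutral) auto
  thus ?thesis using row[OF i i] nz[OF i] by (simp add: field_simps)
qed

lemma proots_prod_linear_factors:
  "proots (\<Prod>a\<leftarrow>as. [:- a, 1:]) = mset (as :: complex list)"
proof (induction as)
  case (Cons a as)
  have "(\<Prod>a\<leftarrow>as. [:- a, 1:]) \<noteq> (0 :: complex poly)" by (auto simp: prod_list_zero_iff)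
  thus ?case using Cons by (simp add: proots_mult del: mult_pCons_left)
qed simp

lemma size_filter_mset_mset_map_upt:
  "size (filter_mset P (mset (map f [0..<n]))) = card {i. i < n \<and> P (f i)}"
proof -
  have "size (filter_mset P (mset (map f [0..<n]))) = length (filter P (map f [0..<n]))"
    by (metis mset_filter size_mset)
  also have "\<dots> = card {i. i < n \<and> P (f i)}"
    by (subst length_filter_conv_card) (auto intro!: arg_cong[of _ _ card])
  finally show ?thesis .
qed

text \<open>Schur's triangular form suffices: its diagonal lists the eigenvalues with multiplicity,
  and the inverse of \<open>U - z\<close> has the reciprocal diagonal entries. A single family
  \<open>es\<close> serves both claims, so that the distribution function and the trace refer to the
  same eigenvalues.\<close>

lemma hermitian_spectrum:
  assumes X: "hermitian_mat n X"
  obtains es :: "nat \<Rightarrow> real" where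
    "\<And>x. spectral_cdf X x = real (card {i. i < n \<and> es i \<le> x}) / real n"
    "\<And>z. Im z > 0 \<Longrightarrow> mtrace (resolvent X z) = (\<Sum>i<n. 1 / (of_real (es i) - z))"
proof -
  note XD = hermitian_matD[OF X]
  obtain as where "char_poly X = (\<Prod>a\<leftarrow>as. [:- a, 1:])" using char_poly_factorized[OF XD(1)] by blast
  from schur_decomposition_exists[OF XD(1) this]
  obtain U where U: "U \<in> carrier_mat n n" "upper_triangular U" "similar_mat X U" by blast
  have cp: "char_poly X = (\<Prod>a\<leftarrow>diag_mat U. [:- a, 1:])"
    using char_poly_similar[OF U(3)] char_poly_upper_triangular[OF U(1,2)] by simp
  have dU: "diag_mat U = map (\<lambda>i. U $$ (i, i)) [0..<n]" using U by (simp add: diag_mat_def)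
  define es where "es i = Re (U $$ (i, i))" for i
  \<comment> \<open>A diagonal entry is a root of the characteristic polynomial, so the determinant
    of the matrix shifted by it vanishes, which cannot happen off the real axis.\<close>
  have re: "U $$ (i, i) = of_real (es i)" if "i < n" for i
  proof -
    have "poly (char_poly X) (U $$ (i, i)) = 0"
      unfolding cp dU using that by (auto simp: poly_prod_list prod_list_zero_iff)
    hence "Determinant.det (char_matrix X (U $$ (i, i))) = 0"
      using eigenvalue_root_char_poly[OF XD(1)] eigenvalue_det[OF XD(1)] by blast
    moreover have "char_matrix X (U $$ (i, i)) = X - U $$ (i, i) \<cdot>\<^sub>m 1\<^sub>m n"
      using XD(1) by (intro eq_matI) (auto simp: char_matrix_def)
    ultimately have "Im (U $$ (i, i)) = 0"
      using hermitian_det_nonzero[OF XD(1,2), of "U $$ (i, i)"] by auto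
    thus ?thesis by (simp add: es_def complex_eq_iff)
  qed
  show ?thesis
  proof (rule that)
    fix x
    have "proots (char_poly X) = mset (map (\<lambda>i. U $$ (i, i)) [0..<n])"
      unfolding cp proots_prod_linear_factors dU ..
    thus "spectral_cdf X x = real (card {i. i < n \<and> es i \<le> x}) / real n"
      using XD(1) unfolding spectral_cdf_def es_def
      by (simp only: size_filter_mset_mset_map_upt) simp
  next
    fix z :: complex assume z: "Im z > 0"
    obtain P P' where "similar_mat_wit X U P P'" using U(3) by (auto simp: similar_mat_def)
    hence P: "P \<in> carrier_mat n n" "P' \<in> carrier_mat n n" "P * P' = 1\<^sub>m n" "P' * P = 1\<^sub>m n" "X = P * U * P'"
      using XD(1) by (auto simp: similar_mat_wit_def Let_def)
    let ?Q = "resolvent X z" and ?U = "U - z \<cdot>\<^sub>m 1\<^sub>m n" and ?X = "X - z \<cdot>\<^sub>m 1\<^sub>m n"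
    define V where "V = P' * ?Q * P"
    have cQ: "?Q \<in> carrier_mat n n" using XD(1) by simp
    have cs: "?U \<in> carrier_mat n n" "?X \<in> carrier_mat n n" "P' * ?Q \<in> carrier_mat n n" "V \<in> carrier_mat n n"
      "P * ?U \<in> carrier_mat n n" "?X * P \<in> carrier_mat n n"
      using U(1) XD(1) P(1,2) cQ by (auto simp: V_def)
    have PUX: "P * ?U = ?X * P"
    proof -
      have "P * ?U = P * U - z \<cdot>\<^sub>m P"
        using P U mult_minus_distrib_mat[of P n n U n "z \<cdot>\<^sub>m 1\<^sub>m n"] mult_smult_distrib[OF P(1) one_carrier_mat, of z] by simp
      also have "P * U = P * U * (P' * P)" using P U by simp
      also have "\<dots> = X * P" unfolding P(5) using P(1,2) U(1) by (subst assoc_mult_mat[of _ n n P' n P n]) auto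
      also have "X * P - z \<cdot>\<^sub>m P = ?X * P"
        using P XD(1) minus_mult_distrib_mat[of X n n "z \<cdot>\<^sub>m 1\<^sub>m n" P n] mult_smult_assoc_mat[OF one_carrier_mat P(1), of z] by simp
      finally show ?thesis .
    qed
    \<comment> \<open>The resolvent, conjugated by the change of basis, is a right inverse of the
      triangular matrix; conjugation does not change its trace.\<close>
    have "?U * V = P' * P * (?U * V)" using cs P by simp
    also have "\<dots> = P' * (P * (?U * V))" using cs P by (intro assoc_mult_mat[of _ n n _ n _ n]) auto
    also have "P * (?U * V) = P * ?U * V" using cs P by (intro assoc_mult_mat[symmetric, of _ n n _ n _ n]) auto
    also have "\<dots> = ?X * P * V" unfolding PUX ..
    also have "\<dots> = ?X * (P * V)" using cs P by (intro assoc_mult_mat[of _ n n _ n _ n]) auto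
    also have "P * V = P * (P' * (?Q * P))"
      unfolding V_def using cQ P by (subst assoc_mult_mat[of P' n n ?Q n P n]) auto
    also have "\<dots> = P * P' * (?Q * P)" using cQ P by (intro assoc_mult_mat[symmetric, of _ n n _ n _ n]) auto
    also have "\<dots> = ?Q * P" using P cQ by simp
    also have "?X * (?Q * P) = ?X * ?Q * P" using cs cQ P by (intro assoc_mult_mat[symmetric, of _ n n _ n _ n]) auto
    also have "\<dots> = P" using resolvent_inverse(1)[OF XD(1,2), of z] z P by simp
    finally have UV: "?U * V = 1\<^sub>m n" using P by simp
    have "V $$ (i, i) = 1 / (of_real (es i) - z)" if "i < n" for i
    proof -
      have d: "?U $$ (i, i) = of_real (es i) - z" if "i < n" for i using that U(1) re by simp
      have "complex_of_real (es i) - z \<noteq> 0" for i using z by (auto simp: complex_eq_iff)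
      hence "V $$ (i, i) = 1 / ?U $$ (i, i)"
        using U(1,2) cs UV that d
        by (intro upper_triangular_right_inverse_diag[of _ n]) (auto simp: upper_triangular_def)
      thus ?thesis using d[OF that] by simp
    qed
    hence "(\<Sum>i<n. 1 / (of_real (es i) - z)) = mtrace V" using cs by (simp add: mtrace_def)
    also have "\<dots> = mtrace (P * (P' * ?Q))" unfolding V_def by (rule mtrace_mult_comm[OF cs(3) P(1)])
    also have "P * (P' * ?Q) = ?Q" using P cQ assoc_mult_mat[OF P(1,2) cQ] by simp
    finally show "mtrace ?Q = (\<Sum>i<n. 1 / (of_real (es i) - z))" ..
  qed
qed

section \<open>Fourth moments of quadratic forms\<close>

lemma borel_measurable_cnj [measurable (raw)]:
  "f \<in> borel_measurable M \<Longrightarrow> (\<lambda>x. cnj (f x)) \<in> borel_measurable M"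
  by (rule borel_measurable_continuous_on[of cnj]) (auto intro: continuous_intros)

text \<open>Crude domination through the maximum; it only serves the integrability of mixed
  terms.\<close>

lemma mixed_power4_bounds:
  fixes x y :: real
  assumes "x \<ge> 0" "y \<ge> 0"
  shows "x\<^sup>2 * y\<^sup>2 \<le> x ^ 4 + y ^ 4" "x ^ 3 * y \<le> x ^ 4 + y ^ 4"
proof -
  have m: "max x y ^ 4 \<le> x ^ 4 + y ^ 4" using assms by (auto simp: max_def)
  have "x\<^sup>2 * y\<^sup>2 \<le> max x y ^ 2 * max x y ^ 2" using assms by (intro mult_mono power_mono) auto
  thus "x\<^sup>2 * y\<^sup>2 \<le> x ^ 4 + y ^ 4" using m by (simp add: eval_nat_numeral mult_ac)
  have "x ^ 3 * y \<le> max x y ^ 3 * max x y" using assms by (intro mult_mono power_mono) auto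
  thus "x ^ 3 * y \<le> x ^ 4 + y ^ 4" using m by (simp add: eval_nat_numeral mult_ac)
qed

context prob_space
begin

lemma integrable_norm_power_bound:
  fixes X D :: "'a \<Rightarrow> complex"
  assumes "X \<in> borel_measurable M" "D \<in> borel_measurable M"
    and "integrable M (\<lambda>\<omega>. cmod (X \<omega>) ^ 4)" "integrable M (\<lambda>\<omega>. cmod (D \<omega>) ^ 4)"
    and "F \<in> borel_measurable M" "\<And>\<omega>. norm (F \<omega> :: 'b :: {banach, second_countable_topology}) \<le> cmod (X \<omega>) ^ 4 + cmod (D \<omega>) ^ 4"
  shows "integrable M F"
proof (rule Bochner_Integration.integrable_bound)
  show "integrable M (\<lambda>\<omega>. cmod (X \<omega>) ^ 4 + cmod (D \<omega>) ^ 4)" using assms by auto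
qed (use assms in auto)

text \<open>Cauchy-Schwarz for \<open>|X|^2\<close> and \<open>|D|^2\<close>, obtained by
  integrating \<open>x^2 y^2 \<le> (t x^4 + y^4 / t) / 2\<close> with a nearly optimal
  \<open>t\<close>.\<close>

lemma integral_sq_sq_le:
  fixes X D :: "'a \<Rightarrow> complex"
  assumes [measurable]: "X \<in> borel_measurable M" "D \<in> borel_measurable M"
    and X: "integrable M (\<lambda>\<omega>. cmod (X \<omega>) ^ 4)" "(LINT \<omega>|M. cmod (X \<omega>) ^ 4) \<le> a\<^sup>2"
    and D: "integrable M (\<lambda>\<omega>. cmod (D \<omega>) ^ 4)" "(LINT \<omega>|M. cmod (D \<omega>) ^ 4) \<le> b\<^sup>2"
    and ab: "a \<ge> 0" "b \<ge> 0"
  shows "(LINT \<omega>|M. (cmod (X \<omega>))\<^sup>2 * (cmod (D \<omega>))\<^sup>2) \<le> a * b"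
proof (rule field_le_epsilon)
  fix e :: real assume e: "e > 0"
  define \<epsilon> where "\<epsilon> = e / (a + b + 1)"
  have \<epsilon>: "\<epsilon> > 0" using e ab by (simp add: \<epsilon>_def)
  \<comment> \<open>The optimal weight is \<open>b / a\<close>; adding \<open>\<epsilon>\<close>
    keeps it positive and finite when \<open>a\<close> or \<open>b\<close> vanishes.\<close>
  define t where "t = (b + \<epsilon>) / (a + \<epsilon>)"
  have t: "t > 0" using \<epsilon> ab by (simp add: t_def)
  have *: "x\<^sup>2 * y\<^sup>2 \<le> (t * x ^ 4 + y ^ 4 / t) / 2" for x y :: real
  proof -
    have "0 \<le> (t * x\<^sup>2 - y\<^sup>2)\<^sup>2 / t" using t by simp
    also have "\<dots> = t * x ^ 4 + y ^ 4 / t - 2 * (x\<^sup>2 * y\<^sup>2)"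
      using t by (simp add: field_simps power2_eq_square eval_nat_numeral)
    finally show ?thesis by simp
  qed
  have int: "integrable M (\<lambda>\<omega>. (cmod (X \<omega>))\<^sup>2 * (cmod (D \<omega>))\<^sup>2)"
  proof (rule integrable_norm_power_bound[of X D])
    show "norm ((cmod (X \<omega>))\<^sup>2 * (cmod (D \<omega>))\<^sup>2) \<le> cmod (X \<omega>) ^ 4 + cmod (D \<omega>) ^ 4" for \<omega>
      using mixed_power4_bounds(1)[of "cmod (X \<omega>)" "cmod (D \<omega>)"] by simp
  qed (use X(1) D(1) in simp_all)
  have "(LINT \<omega>|M. (cmod (X \<omega>))\<^sup>2 * (cmod (D \<omega>))\<^sup>2) \<le> (LINT \<omega>|M. (t * cmod (X \<omega>) ^ 4 + cmod (D \<omega>) ^ 4 / t) / 2)"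
    by (rule integral_mono[OF int _ *])
       (intro integrable_divide Bochner_Integration.integrable_add integrable_mult_right X D)
  also have "\<dots> = (t * (LINT \<omega>|M. cmod (X \<omega>) ^ 4) + (LINT \<omega>|M. cmod (D \<omega>) ^ 4) / t) / 2"
    using X(1) D(1) by simp
  also have "\<dots> \<le> (t * a\<^sup>2 + b\<^sup>2 / t) / 2"
    by (intro divide_right_mono add_mono mult_left_mono X D) (use t in simp_all)
  also have "\<dots> \<le> ((b + \<epsilon>) * a + b * (a + \<epsilon>)) / 2"
  proof -
    have "t * a\<^sup>2 = (b + \<epsilon>) * (a * (a / (a + \<epsilon>)))" by (simp add: t_def power2_eq_square)
    also have "\<dots> \<le> (b + \<epsilon>) * (a * 1)" using ab \<epsilon> by (intro mult_left_mono) auto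
    finally have 1: "t * a\<^sup>2 \<le> (b + \<epsilon>) * a" by simp
    have "b\<^sup>2 / t = b * ((b / (b + \<epsilon>)) * (a + \<epsilon>))" by (simp add: t_def power2_eq_square)
    also have "\<dots> \<le> b * (1 * (a + \<epsilon>))" using ab \<epsilon> by (intro mult_left_mono mult_right_mono) auto
    finally have 2: "b\<^sup>2 / t \<le> b * (a + \<epsilon>)" by simp
    show ?thesis by (intro divide_right_mono add_mono 1 2) simp
  qed
  also have "\<dots> = a * b + \<epsilon> * (a + b) / 2" by (simp add: field_simps)
  also have "\<dots> \<le> a * b + e"
  proof -
    have "\<epsilon> * (a + b) \<le> \<epsilon> * (a + b + 1)" using \<epsilon> by (intro mult_left_mono) auto
    also have "\<dots> = e" using ab by (simp add: \<epsilon>_def)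
    finally show ?thesis using e by simp
  qed
  finally show "(LINT \<omega>|M. (cmod (X \<omega>))\<^sup>2 * (cmod (D \<omega>))\<^sup>2) \<le> a * b + e" .
qed

text \<open>In terms of the \<open>L\<^sup>4\<close> norm, an orthogonality condition, as satisfied by a martingale
  difference \<open>D\<close>, makes the squared norms subadditive up to a constant.\<close>

lemma moment4_add:
  fixes X D :: "'a \<Rightarrow> complex"
  assumes [measurable]: "X \<in> borel_measurable M" "D \<in> borel_measurable M"
    and X: "integrable M (\<lambda>\<omega>. cmod (X \<omega>) ^ 4)" "(LINT \<omega>|M. cmod (X \<omega>) ^ 4) \<le> a\<^sup>2"
    and D: "integrable M (\<lambda>\<omega>. cmod (D \<omega>) ^ 4)" "(LINT \<omega>|M. cmod (D \<omega>) ^ 4) \<le> b\<^sup>2"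
    and ab: "a \<ge> 0" "b \<ge> 0"
    and orth: "(LINT \<omega>|M. Re (of_real ((cmod (X \<omega>))\<^sup>2) * cnj (X \<omega>) * D \<omega>)) = 0"
  shows "integrable M (\<lambda>\<omega>. cmod (X \<omega> + D \<omega>) ^ 4)"
    and "(LINT \<omega>|M. cmod (X \<omega> + D \<omega>) ^ 4) \<le> (a + 4 * b)\<^sup>2"
proof -
  \<comment> \<open>Only \<open>4 |x|^2 Re (cnj x d)\<close> is of first order in \<open>d\<close>,
    and its integral will vanish. The remaining
    \<open>4 r^2 + 2 |x|^2 |d|^2 + 4 r |d|^2 + |d|^4\<close> is estimated by
    \<open>|r| \<le> |x| |d|\<close> and \<open>2 |x| |d|^3 \<le> |x|^2 |d|^2 + |d|^4\<close>, which
    yields the constants 8 and 3.\<close>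
  have pw: "cmod (x + d) ^ 4 \<le> cmod x ^ 4 + 4 * Re (of_real ((cmod x)\<^sup>2) * cnj x * d)
      + 8 * ((cmod x)\<^sup>2 * (cmod d)\<^sup>2) + 3 * cmod d ^ 4" for x d
  proof -
    define r where "r = Re (cnj x * d)"
    have r: "\<bar>r\<bar> \<le> cmod x * cmod d" unfolding r_def
      using abs_Re_le_cmod[of "cnj x * d"] by (simp add: norm_mult)
    have sq: "(cmod (x + d))\<^sup>2 = (cmod x)\<^sup>2 + 2 * r + (cmod d)\<^sup>2"
      unfolding r_def cmod_power2 by (simp add: power2_eq_square algebra_simps)
    have "cmod (x + d) ^ 4 = ((cmod (x + d))\<^sup>2)\<^sup>2" by simp
    also have "\<dots> = cmod x ^ 4 + 4 * r\<^sup>2 + cmod d ^ 4 + 4 * (cmod x)\<^sup>2 * r + 2 * (cmod x)\<^sup>2 * (cmod d)\<^sup>2 + 4 * r * (cmod d)\<^sup>2"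
      unfolding sq by (simp add: power2_eq_square algebra_simps eval_nat_numeral)
    finally have e: "cmod (x + d) ^ 4 = cmod x ^ 4 + 4 * r\<^sup>2 + cmod d ^ 4 + 4 * (cmod x)\<^sup>2 * r + 2 * (cmod x)\<^sup>2 * (cmod d)\<^sup>2 + 4 * r * (cmod d)\<^sup>2" .
    have "r\<^sup>2 \<le> (cmod x * cmod d)\<^sup>2" using r by (metis abs_ge_zero power2_abs power_mono)
    hence r2: "r\<^sup>2 \<le> (cmod x)\<^sup>2 * (cmod d)\<^sup>2" by (simp add: power_mult_distrib)
    have "r * (cmod d)\<^sup>2 \<le> (cmod x * cmod d) * (cmod d)\<^sup>2" using r by (intro mult_right_mono) auto
    moreover have "0 \<le> (cmod x * cmod d - (cmod d)\<^sup>2)\<^sup>2" by simp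
    hence "2 * ((cmod x * cmod d) * (cmod d)\<^sup>2) \<le> (cmod x)\<^sup>2 * (cmod d)\<^sup>2 + cmod d ^ 4"
      by (simp add: power2_eq_square algebra_simps eval_nat_numeral)
    ultimately have r3: "4 * r * (cmod d)\<^sup>2 \<le> 2 * ((cmod x)\<^sup>2 * (cmod d)\<^sup>2) + 2 * cmod d ^ 4" by simp
    have re: "Re (of_real ((cmod x)\<^sup>2) * cnj x * d) = (cmod x)\<^sup>2 * r"
      by (simp add: r_def mult.assoc algebra_simps)
    show ?thesis unfolding re e using r2 r3 by linarith
  qed
  have i2: "integrable M (\<lambda>\<omega>. (cmod (X \<omega>))\<^sup>2 * (cmod (D \<omega>))\<^sup>2)"
  proof (rule integrable_norm_power_bound[of X D])
    show "norm ((cmod (X \<omega>))\<^sup>2 * (cmod (D \<omega>))\<^sup>2) \<le> cmod (X \<omega>) ^ 4 + cmod (D \<omega>) ^ 4" for \<omega>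
      using mixed_power4_bounds(1)[of "cmod (X \<omega>)" "cmod (D \<omega>)"] by simp
  qed (auto simp: X D)
  have i1: "integrable M (\<lambda>\<omega>. Re (of_real ((cmod (X \<omega>))\<^sup>2) * cnj (X \<omega>) * D \<omega>))"
  proof (rule integrable_norm_power_bound[of X D])
    fix \<omega>
    have "norm (Re (of_real ((cmod (X \<omega>))\<^sup>2) * cnj (X \<omega>) * D \<omega>)) \<le> cmod (of_real ((cmod (X \<omega>))\<^sup>2) * cnj (X \<omega>) * D \<omega>)"
      unfolding real_norm_def by (rule abs_Re_le_cmod)
    also have "\<dots> = cmod (X \<omega>) ^ 3 * cmod (D \<omega>)" by (simp add: norm_mult norm_power eval_nat_numeral)
    also have "\<dots> \<le> cmod (X \<omega>) ^ 4 + cmod (D \<omega>) ^ 4" by (rule mixed_power4_bounds) auto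
    finally show "norm (Re (of_real ((cmod (X \<omega>))\<^sup>2) * cnj (X \<omega>) * D \<omega>)) \<le> cmod (X \<omega>) ^ 4 + cmod (D \<omega>) ^ 4" .
  qed (auto simp: X D)
  let ?R = "\<lambda>\<omega>. cmod (X \<omega>) ^ 4 + 4 * Re (of_real ((cmod (X \<omega>))\<^sup>2) * cnj (X \<omega>) * D \<omega>)
      + 8 * ((cmod (X \<omega>))\<^sup>2 * (cmod (D \<omega>))\<^sup>2) + 3 * cmod (D \<omega>) ^ 4"
  have iR: "integrable M ?R"
    by (intro Bochner_Integration.integrable_add integrable_mult_right X D i1 i2)
  show int: "integrable M (\<lambda>\<omega>. cmod (X \<omega> + D \<omega>) ^ 4)"
  proof (rule Bochner_Integration.integrable_bound[OF iR])
    show "AE \<omega> in M. norm (cmod (X \<omega> + D \<omega>) ^ 4) \<le> norm (?R \<omega>)"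
    proof (rule AE_I2)
      fix \<omega>
      have "norm (cmod (X \<omega> + D \<omega>) ^ 4) = cmod (X \<omega> + D \<omega>) ^ 4" by simp
      also have "\<dots> \<le> ?R \<omega>" by (rule pw)
      also have "\<dots> \<le> norm (?R \<omega>)" unfolding real_norm_def by (rule abs_ge_self)
      finally show "norm (cmod (X \<omega> + D \<omega>) ^ 4) \<le> norm (?R \<omega>)" .
    qed
  qed measurable
  have "(LINT \<omega>|M. cmod (X \<omega> + D \<omega>) ^ 4) \<le> integral\<^sup>L M ?R"
    by (intro integral_mono int iR pw)
  also have "\<dots> = (LINT \<omega>|M. cmod (X \<omega>) ^ 4) + 4 * (LINT \<omega>|M. Re (of_real ((cmod (X \<omega>))\<^sup>2) * cnj (X \<omega>) * D \<omega>))
      + 8 * (LINT \<omega>|M. (cmod (X \<omega>))\<^sup>2 * (cmod (D \<omega>))\<^sup>2) + 3 * (LINT \<omega>|M. cmod (D \<omega>) ^ 4)"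
    using i1 i2 X(1) D(1) by (simp del: times_complex.sel)
  also have "\<dots> \<le> a\<^sup>2 + 8 * (a * b) + 3 * b\<^sup>2"
    using X D orth integral_sq_sq_le[OF assms(1,2) X D ab] by linarith
  \<comment> \<open>The 4 in the conclusion makes \<open>2 a (4 b)\<close> equal to the mixed term
    \<open>8 a b\<close>.\<close>
  also have "\<dots> \<le> (a + 4 * b)\<^sup>2" by (simp add: power2_eq_square algebra_simps)
  finally show "(LINT \<omega>|M. cmod (X \<omega> + D \<omega>) ^ 4) \<le> (a + 4 * b)\<^sup>2" .
qed

section \<open>Orthogonality from independence\<close>

lemma indep_past:
  assumes ind: "indep_vars (\<lambda>_. borel) Y I" and J: "J \<subseteq> I" "n \<in> I" "n \<notin> J"
    and F: "F \<in> borel_measurable (PiM J (\<lambda>_. borel))" and \<phi>: "\<phi> \<in> borel_measurable borel"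
  shows "indep_var borel (\<lambda>\<omega>. F (restrict (\<lambda>j. Y j \<omega>) J)) borel (\<lambda>\<omega>. \<phi> (Y n \<omega>))"
proof -
  have "indep_var (PiM J (\<lambda>_. borel)) (\<lambda>\<omega>. restrict (\<lambda>j. Y j \<omega>) J) (PiM {n} (\<lambda>_. borel)) (\<lambda>\<omega>. restrict (\<lambda>j. Y j \<omega>) {n})"
    using J by (intro indep_var_restrict[OF ind]) auto
  from indep_var_compose[OF this F, of "\<lambda>h. \<phi> (h n)" borel]
  show ?thesis using \<phi> by (simp add: comp_def)
qed

lemma moment4_mult:
  fixes F :: "_ \<Rightarrow> complex" and \<phi> :: "complex \<Rightarrow> complex"
  assumes ind: "indep_vars (\<lambda>_. borel) Y I" and J: "J \<subseteq> I" "n \<in> I" "n \<notin> J"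
    and F: "F \<in> borel_measurable (PiM J (\<lambda>_. borel))" and \<phi>: "\<phi> \<in> borel_measurable borel"
    and iF: "integrable M (\<lambda>\<omega>. cmod (F (restrict (\<lambda>j. Y j \<omega>) J)) ^ 4)"
    and i\<phi>: "integrable M (\<lambda>\<omega>. cmod (\<phi> (Y n \<omega>)) ^ 4)"
  shows "integrable M (\<lambda>\<omega>. cmod (\<phi> (Y n \<omega>) * F (restrict (\<lambda>j. Y j \<omega>) J)) ^ 4)"
    "(LINT \<omega>|M. cmod (\<phi> (Y n \<omega>) * F (restrict (\<lambda>j. Y j \<omega>) J)) ^ 4) =
      (LINT \<omega>|M. cmod (\<phi> (Y n \<omega>)) ^ 4) * (LINT \<omega>|M. cmod (F (restrict (\<lambda>j. Y j \<omega>) J)) ^ 4)"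
proof -
  have "indep_var borel (\<lambda>\<omega>. cmod (F (restrict (\<lambda>j. Y j \<omega>) J)) ^ 4) borel (\<lambda>\<omega>. cmod (\<phi> (Y n \<omega>)) ^ 4)"
    using F \<phi> by (intro indep_past[OF ind J, of "\<lambda>h. cmod (F h) ^ 4" "\<lambda>y. cmod (\<phi> y) ^ 4"]) auto
  from indep_var_integrable[OF this iF i\<phi>] indep_var_lebesgue_integral[OF this iF i\<phi>]
  show "integrable M (\<lambda>\<omega>. cmod (\<phi> (Y n \<omega>) * F (restrict (\<lambda>j. Y j \<omega>) J)) ^ 4)"
    "(LINT \<omega>|M. cmod (\<phi> (Y n \<omega>) * F (restrict (\<lambda>j. Y j \<omega>) J)) ^ 4) =
      (LINT \<omega>|M. cmod (\<phi> (Y n \<omega>)) ^ 4) * (LINT \<omega>|M. cmod (F (restrict (\<lambda>j. Y j \<omega>) J)) ^ 4)"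
    by (simp_all add: norm_mult power_mult_distrib mult.commute)
qed

text \<open>\<open>J\<close> holds the indices already used and \<open>n\<close> is a new one. The
  factor \<open>|W|^2 cnj W F\<close> depends on \<open>J\<close> only, so the expectation splits
  off the mean of \<open>\<phi> (Y n)\<close>, which is zero. Independence of blocks takes the place
  of conditional expectations.\<close>

lemma centered_orthogonal:
  fixes W F :: "_ \<Rightarrow> complex" and \<phi> :: "complex \<Rightarrow> complex"
  assumes ind: "indep_vars (\<lambda>_. borel) Y I" and J: "J \<subseteq> I" "n \<in> I" "n \<notin> J"
    and [measurable]: "W \<in> borel_measurable (PiM J (\<lambda>_. borel))" "F \<in> borel_measurable (PiM J (\<lambda>_. borel))"
      "\<phi> \<in> borel_measurable borel"
    and iW: "integrable M (\<lambda>\<omega>. cmod (W (restrict (\<lambda>j. Y j \<omega>) J)) ^ 4)"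
    and iF: "integrable M (\<lambda>\<omega>. cmod (F (restrict (\<lambda>j. Y j \<omega>) J)) ^ 4)"
    and i\<phi>: "integrable M (\<lambda>\<omega>. \<phi> (Y n \<omega>))" "(LINT \<omega>|M. \<phi> (Y n \<omega>)) = 0"
  defines "P \<equiv> \<lambda>\<omega>. restrict (\<lambda>j. Y j \<omega>) J"
  shows "integrable M (\<lambda>\<omega>. of_real ((cmod (W (P \<omega>)))\<^sup>2) * cnj (W (P \<omega>)) * (\<phi> (Y n \<omega>) * F (P \<omega>)))"
    "(LINT \<omega>|M. of_real ((cmod (W (P \<omega>)))\<^sup>2) * cnj (W (P \<omega>)) * (\<phi> (Y n \<omega>) * F (P \<omega>))) = 0"
proof -
  have Y: "Y j \<in> borel_measurable M" if "j \<in> I" for j using ind that by (auto simp: indep_vars_def)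
  have [measurable]: "P \<in> measurable M (PiM J (\<lambda>_. borel))"
    unfolding P_def using Y J by (intro measurable_restrict) auto
  define V where "V h = of_real ((cmod (W h))\<^sup>2) * cnj (W h) * F h" for h
  have V[measurable]: "V \<in> borel_measurable (PiM J (\<lambda>_. borel))" unfolding V_def by measurable
  have iW': "integrable M (\<lambda>\<omega>. cmod (W (P \<omega>)) ^ 4)" and iF': "integrable M (\<lambda>\<omega>. cmod (F (P \<omega>)) ^ 4)"
    using iW iF by (simp_all only: P_def)
  have iV: "integrable M (\<lambda>\<omega>. V (P \<omega>))"
  proof (rule integrable_norm_power_bound[of "\<lambda>\<omega>. W (P \<omega>)" "\<lambda>\<omega>. F (P \<omega>)"])
    fix \<omega>
    let ?x = "cmod (W (P \<omega>))" and ?y = "cmod (F (P \<omega>))"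
    have "cmod (V (P \<omega>)) = ?x ^ 3 * ?y" by (simp add: V_def norm_mult norm_power eval_nat_numeral)
    also have "\<dots> \<le> ?x ^ 4 + ?y ^ 4" by (rule mixed_power4_bounds) auto
    finally show "cmod (V (P \<omega>)) \<le> ?x ^ 4 + ?y ^ 4" .
  qed (use iW' iF' in auto)
  have ip: "indep_var borel (\<lambda>\<omega>. V (P \<omega>)) borel (\<lambda>\<omega>. \<phi> (Y n \<omega>))"
    unfolding P_def by (intro indep_past[OF ind J]) measurable
  have eq: "of_real ((cmod (W (P \<omega>)))\<^sup>2) * cnj (W (P \<omega>)) * (\<phi> (Y n \<omega>) * F (P \<omega>)) = V (P \<omega>) * \<phi> (Y n \<omega>)" for \<omega>
    by (simp add: V_def mult_ac)
  show "integrable M (\<lambda>\<omega>. of_real ((cmod (W (P \<omega>)))\<^sup>2) * cnj (W (P \<omega>)) * (\<phi> (Y n \<omega>) * F (P \<omega>)))"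
    "(LINT \<omega>|M. of_real ((cmod (W (P \<omega>)))\<^sup>2) * cnj (W (P \<omega>)) * (\<phi> (Y n \<omega>) * F (P \<omega>))) = 0"
    unfolding eq using indep_var_integrable[OF ip iV i\<phi>(1)] indep_var_lebesgue_integral[OF ip iV i\<phi>(1)] i\<phi>(2)
    by simp_all
qed

text \<open>One summand is added at a time, as a martingale difference. In terms of squared
  \<open>L^4\<close> norms each step adds at most \<open>4 sqrt \<kappa> |c k|^2\<close>, the 4
  being that of \<open>moment4_add\<close>.\<close>

lemma linear_moment4:
  assumes ind: "indep_vars (\<lambda>_. borel) Y ({i :: nat} \<times> {..<n :: nat})" and \<kappa>: "\<kappa> \<ge> 0"
    and Y: "\<And>b. b < n \<Longrightarrow> integrable M (Y (i, b))" "\<And>b. b < n \<Longrightarrow> (LINT \<omega>|M. Y (i, b) \<omega>) = 0"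
    and Y4: "\<And>b. b < n \<Longrightarrow> integrable M (\<lambda>\<omega>. cmod (Y (i, b) \<omega>) ^ 4)"
      "\<And>b. b < n \<Longrightarrow> (LINT \<omega>|M. cmod (Y (i, b) \<omega>) ^ 4) \<le> \<kappa>"
  shows "k \<le> n \<Longrightarrow> integrable M (\<lambda>\<omega>. cmod (\<Sum>b<k. c b * Y (i, b) \<omega>) ^ 4) \<and>
    (LINT \<omega>|M. cmod (\<Sum>b<k. c b * Y (i, b) \<omega>) ^ 4) \<le> (4 * sqrt \<kappa> * (\<Sum>b<k. (cmod (c b))\<^sup>2))\<^sup>2"
proof (induction k)
  case (Suc k)
  hence k: "k < n" by simp
  have Ym[measurable]: "Y (i, b) \<in> borel_measurable M" if "b < n" for b
    using ind that by (auto simp: indep_vars_def)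
  define J where "J = {i} \<times> {..<k}"
  have J: "J \<subseteq> {i} \<times> {..<n}" "(i, k) \<in> {i} \<times> {..<n}" "(i, k) \<notin> J" using k by (auto simp: J_def)
  define W where "W h = (\<Sum>b<k. c b * h (i, b))" for h :: "nat \<times> nat \<Rightarrow> complex"
  have W: "W \<in> borel_measurable (PiM J (\<lambda>_. borel))"
    unfolding W_def by (intro borel_measurable_sum borel_measurable_times) (auto simp: J_def intro!: measurable_component_singleton)
  have WP: "W (restrict (\<lambda>j. Y j \<omega>) J) = (\<Sum>b<k. c b * Y (i, b) \<omega>)" for \<omega>
    unfolding W_def by (intro sum.cong) (auto simp: J_def)
  note co = centered_orthogonal[OF ind J W, of "\<lambda>_. c k" "\<lambda>y. y", unfolded WP]
  have iW: "integrable M (\<lambda>\<omega>. cmod (\<Sum>b<k. c b * Y (i, b) \<omega>) ^ 4)" using Suc by simp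
  have orth: "(LINT \<omega>|M. of_real ((cmod (\<Sum>b<k. c b * Y (i, b) \<omega>))\<^sup>2) * cnj (\<Sum>b<k. c b * Y (i, b) \<omega>) * (Y (i, k) \<omega> * c k)) = 0"
    by (rule co(2)) (use Y[OF k] iW in simp_all)
  have orthi: "integrable M (\<lambda>\<omega>. of_real ((cmod (\<Sum>b<k. c b * Y (i, b) \<omega>))\<^sup>2) * cnj (\<Sum>b<k. c b * Y (i, b) \<omega>) * (Y (i, k) \<omega> * c k))"
    by (rule co(1)) (use Y[OF k] iW in simp_all)
  have D: "integrable M (\<lambda>\<omega>. cmod (c k * Y (i, k) \<omega>) ^ 4)"
    using Y4[OF k] by (simp add: norm_mult power_mult_distrib)
  have "(LINT \<omega>|M. cmod (c k * Y (i, k) \<omega>) ^ 4) = cmod (c k) ^ 4 * (LINT \<omega>|M. cmod (Y (i, k) \<omega>) ^ 4)"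
    by (simp add: norm_mult power_mult_distrib)
  also have "\<dots> \<le> cmod (c k) ^ 4 * \<kappa>" using Y4[OF k] by (intro mult_left_mono) auto
  also have "\<dots> = (sqrt \<kappa> * (cmod (c k))\<^sup>2)\<^sup>2" using \<kappa> by (simp add: power_mult_distrib)
  finally have D2: "(LINT \<omega>|M. cmod (c k * Y (i, k) \<omega>) ^ 4) \<le> (sqrt \<kappa> * (cmod (c k))\<^sup>2)\<^sup>2" .
  have m: "(\<lambda>\<omega>. \<Sum>b<k. c b * Y (i, b) \<omega>) \<in> borel_measurable M" "(\<lambda>\<omega>. c k * Y (i, k) \<omega>) \<in> borel_measurable M"
    using k by (auto intro!: borel_measurable_sum borel_measurable_times Ym)
  have orth': "(LINT \<omega>|M. Re (of_real ((cmod (\<Sum>b<k. c b * Y (i, b) \<omega>))\<^sup>2) * cnj (\<Sum>b<k. c b * Y (i, b) \<omega>) * (c k * Y (i, k) \<omega>))) = 0"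
    unfolding mult.commute[of "c k" "Y (i, k) _"] integral_Re[OF orthi] orth by (rule zero_complex.sel)
  have nn: "0 \<le> 4 * sqrt \<kappa> * (\<Sum>b<k. (cmod (c b))\<^sup>2)" "0 \<le> sqrt \<kappa> * (cmod (c k))\<^sup>2"
    using \<kappa> by (auto intro!: mult_nonneg_nonneg sum_nonneg)
  from moment4_add[OF m _ _ D D2 nn orth'] Suc
  show ?case by (simp add: algebra_simps)
qed simp

text \<open>Two applications of \<open>(x + y + z)^2 \<le> 3 (x^2 + y^2 + z^2)\<close>, the first of
  them squared, whence \<open>27 = 9 * 3\<close>.\<close>

lemma cmod_add3_power4: "cmod (a + b + c) ^ 4 \<le> 27 * (cmod a ^ 4 + cmod b ^ 4 + cmod c ^ 4)"
proof -
  have sq3: "(x + y + z)\<^sup>2 \<le> 3 * (x\<^sup>2 + y\<^sup>2 + z\<^sup>2)" for x y z :: real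
  proof -
    have "0 \<le> (x - y)\<^sup>2 + (y - z)\<^sup>2 + (x - z)\<^sup>2" by simp
    thus ?thesis by (simp add: power2_eq_square algebra_simps)
  qed
  have "cmod (a + b + c) \<le> cmod a + cmod b + cmod c"
    by (rule order_trans[OF norm_triangle_ineq add_right_mono[OF norm_triangle_ineq]])
  hence "(cmod (a + b + c))\<^sup>2 \<le> (cmod a + cmod b + cmod c)\<^sup>2" by (intro power_mono) auto
  also have "\<dots> \<le> 3 * ((cmod a)\<^sup>2 + (cmod b)\<^sup>2 + (cmod c)\<^sup>2)" by (rule sq3)
  finally have "((cmod (a + b + c))\<^sup>2)\<^sup>2 \<le> (3 * ((cmod a)\<^sup>2 + (cmod b)\<^sup>2 + (cmod c)\<^sup>2))\<^sup>2"
    by (intro power_mono) auto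
  also have "\<dots> = 9 * ((cmod a)\<^sup>2 + (cmod b)\<^sup>2 + (cmod c)\<^sup>2)\<^sup>2" by (subst power_mult_distrib) simp
  also have "\<dots> \<le> 9 * (3 * (((cmod a)\<^sup>2)\<^sup>2 + ((cmod b)\<^sup>2)\<^sup>2 + ((cmod c)\<^sup>2)\<^sup>2))"
    by (intro mult_left_mono sq3) auto
  finally show ?thesis by simp
qed

text \<open>Passing from \<open>k\<close> to \<open>k + 1\<close> adds \<open>D1 + D2 + D3\<close>:
  the centred diagonal term and the two mixed sums. Each is a centred function of the new entry
  times a constant or a linear form in the earlier entries, so \<open>D\<close> is orthogonal to the
  past and \<open>moment4_add\<close> applies. The matrix \<open>x\<close> is arbitrary, because a
  product of two resolvents is in general not Hermitian.\<close>

lemma quadratic_moment4: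
  fixes x :: "nat \<Rightarrow> nat \<Rightarrow> complex"
  assumes ind: "indep_vars (\<lambda>_. borel) Y ({i :: nat} \<times> {..<n :: nat})" and \<kappa>: "\<kappa> \<ge> 0"
    and Y: "\<And>b. b < n \<Longrightarrow> integrable M (Y (i, b))" "\<And>b. b < n \<Longrightarrow> (LINT \<omega>|M. Y (i, b) \<omega>) = 0"
    and Y4: "\<And>b. b < n \<Longrightarrow> integrable M (\<lambda>\<omega>. cmod (Y (i, b) \<omega>) ^ 4)"
      "\<And>b. b < n \<Longrightarrow> (LINT \<omega>|M. cmod (Y (i, b) \<omega>) ^ 4) \<le> \<kappa>"
    and Z: "\<And>b. b < n \<Longrightarrow> integrable M (\<lambda>\<omega>. complex_of_real ((cmod (Y (i, b) \<omega>))\<^sup>2) - 1)"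
      "\<And>b. b < n \<Longrightarrow> (LINT \<omega>|M. complex_of_real ((cmod (Y (i, b) \<omega>))\<^sup>2) - 1) = 0"
    and Z4: "\<And>b. b < n \<Longrightarrow> integrable M (\<lambda>\<omega>. cmod (complex_of_real ((cmod (Y (i, b) \<omega>))\<^sup>2) - 1) ^ 4)"
      "\<And>b. b < n \<Longrightarrow> (LINT \<omega>|M. cmod (complex_of_real ((cmod (Y (i, b) \<omega>))\<^sup>2) - 1) ^ 4) \<le> \<kappa>"
  defines "W \<equiv> \<lambda>k h. (\<Sum>a<k. \<Sum>b<k. h (i, a) * x a b * cnj (h (i, b))) - (\<Sum>a<k. x a a)"
  shows "k \<le> n \<Longrightarrow> integrable M (\<lambda>\<omega>. cmod (W k (\<lambda>j. Y j \<omega>)) ^ 4) \<and>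
    (LINT \<omega>|M. cmod (W k (\<lambda>j. Y j \<omega>)) ^ 4) \<le> (4 * sqrt (27 * \<kappa> * (1 + 16 * \<kappa>)) * (\<Sum>a<k. \<Sum>b<k. (cmod (x a b))\<^sup>2))\<^sup>2"
proof (induction k)
  case 0
  show ?case by (simp add: W_def)
next
  case (Suc k)
  hence k: "k < n" "k \<le> n" by simp_all
  \<comment> \<open>27 comes from splitting \<open>D\<close> into three parts,
    \<open>\<kappa>\<close> from the new entry in each of them, the 1 from \<open>D1\<close>, and
    \<open>16 \<kappa>\<close> from the squared constant \<open>4 sqrt \<kappa>\<close> of the
    linear forms in \<open>D2\<close> and \<open>D3\<close>.\<close>
  define C where "C = 27 * \<kappa> * (1 + 16 * \<kappa>)"
  have C: "C \<ge> 0" using \<kappa> by (simp add: C_def)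
  have Ym: "Y (i, b) \<in> borel_measurable M" if "b < n" for b
    using ind that by (auto simp: indep_vars_def)
  define J where "J = {i} \<times> {..<k}"
  have J: "J \<subseteq> {i} \<times> {..<n}" "(i, k) \<in> {i} \<times> {..<n}" "(i, k) \<notin> J" using k by (auto simp: J_def)
  have comp: "(\<lambda>h. h (i, b)) \<in> borel_measurable (PiM J (\<lambda>_. borel :: complex measure))" if "b < k" for b
    using that by (intro measurable_component_singleton) (simp add: J_def)
  define F2 where "F2 h = (\<Sum>b<k. x k b * cnj (h (i, b)))" for h :: "nat \<times> nat \<Rightarrow> complex"
  define F3 where "F3 h = (\<Sum>b<k. x b k * h (i, b))" for h :: "nat \<times> nat \<Rightarrow> complex"
  have m: "W k \<in> borel_measurable (PiM J (\<lambda>_. borel))" "F2 \<in> borel_measurable (PiM J (\<lambda>_. borel))"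
    "F3 \<in> borel_measurable (PiM J (\<lambda>_. borel))"
    unfolding W_def F2_def F3_def
    by (auto intro!: borel_measurable_sum borel_measurable_times borel_measurable_diff borel_measurable_cnj comp)
  define P where "P \<omega> = restrict (\<lambda>j. Y j \<omega>) J" for \<omega>
  have P: "P \<omega> (i, b) = Y (i, b) \<omega>" if "b < k" for b \<omega> using that by (simp add: P_def J_def)
  have WP: "W k (P \<omega>) = W k (\<lambda>j. Y j \<omega>)" for \<omega> by (simp add: W_def P)
  have F2P: "F2 (P \<omega>) = cnj (\<Sum>b<k. cnj (x k b) * Y (i, b) \<omega>)" for \<omega> by (simp add: F2_def P)
  have F3P: "F3 (P \<omega>) = (\<Sum>b<k. x b k * Y (i, b) \<omega>)" for \<omega> by (simp add: F3_def P)
  let ?s2 = "\<Sum>b<k. (cmod (x k b))\<^sup>2" and ?s3 = "\<Sum>b<k. (cmod (x b k))\<^sup>2"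
  have iW: "integrable M (\<lambda>\<omega>. cmod (W k (P \<omega>)) ^ 4)" using Suc k unfolding WP by simp
  have i2: "integrable M (\<lambda>\<omega>. cmod (F2 (P \<omega>)) ^ 4)" "(LINT \<omega>|M. cmod (F2 (P \<omega>)) ^ 4) \<le> (4 * sqrt \<kappa> * ?s2)\<^sup>2"
    using linear_moment4[OF ind \<kappa> Y Y4 k(2), of "\<lambda>b. cnj (x k b)"] unfolding F2P complex_mod_cnj by simp_all
  have i3: "integrable M (\<lambda>\<omega>. cmod (F3 (P \<omega>)) ^ 4)" "(LINT \<omega>|M. cmod (F3 (P \<omega>)) ^ 4) \<le> (4 * sqrt \<kappa> * ?s3)\<^sup>2"
    using linear_moment4[OF ind \<kappa> Y Y4 k(2), of "\<lambda>b. x b k"] unfolding F3P by simp_all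
  define \<phi> where "\<phi> y = complex_of_real ((cmod y)\<^sup>2) - 1" for y
  have m\<phi>: "\<phi> \<in> borel_measurable borel" "cnj \<in> borel_measurable borel" unfolding \<phi>_def by measurable
  have Yc: "integrable M (\<lambda>\<omega>. cnj (Y (i, k) \<omega>))" "(LINT \<omega>|M. cnj (Y (i, k) \<omega>)) = 0"
    using Y[OF k(1)] by simp_all
  have Y\<phi>: "integrable M (\<lambda>\<omega>. \<phi> (Y (i, k) \<omega>))" "(LINT \<omega>|M. \<phi> (Y (i, k) \<omega>)) = 0"
    "integrable M (\<lambda>\<omega>. cmod (\<phi> (Y (i, k) \<omega>)) ^ 4)" "(LINT \<omega>|M. cmod (\<phi> (Y (i, k) \<omega>)) ^ 4) \<le> \<kappa>"
    using Z[OF k(1)] Z4[OF k(1)] unfolding \<phi>_def by simp_all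
  define D1 where "D1 \<omega> = \<phi> (Y (i, k) \<omega>) * x k k" for \<omega>
  define D2 where "D2 \<omega> = Y (i, k) \<omega> * F2 (P \<omega>)" for \<omega>
  define D3 where "D3 \<omega> = cnj (Y (i, k) \<omega>) * F3 (P \<omega>)" for \<omega>
  define D where "D \<omega> = D1 \<omega> + D2 \<omega> + D3 \<omega>" for \<omega>
  define V where "V \<omega> = complex_of_real ((cmod (W k (P \<omega>)))\<^sup>2) * cnj (W k (P \<omega>))" for \<omega>
  have o1: "integrable M (\<lambda>\<omega>. V \<omega> * D1 \<omega>)" "(LINT \<omega>|M. V \<omega> * D1 \<omega>) = 0"
    using centered_orthogonal[OF ind J m(1), of "\<lambda>_. x k k" \<phi>] iW m\<phi> Y\<phi> unfolding V_def D1_def P_def by simp_all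
  have o2: "integrable M (\<lambda>\<omega>. V \<omega> * D2 \<omega>)" "(LINT \<omega>|M. V \<omega> * D2 \<omega>) = 0"
    using centered_orthogonal[OF ind J m(1,2), of "\<lambda>y. y"] iW i2(1) Y[OF k(1)] unfolding V_def D2_def P_def by simp_all
  have o3: "integrable M (\<lambda>\<omega>. V \<omega> * D3 \<omega>)" "(LINT \<omega>|M. V \<omega> * D3 \<omega>) = 0"
    using centered_orthogonal[OF ind J m(1,3), of cnj] iW i3(1) m\<phi> Yc unfolding V_def D3_def P_def by simp_all
  have "(LINT \<omega>|M. Re (V \<omega> * D \<omega>)) = Re (LINT \<omega>|M. V \<omega> * D1 \<omega> + V \<omega> * D2 \<omega> + V \<omega> * D3 \<omega>)"
    unfolding D_def distrib_left using o1 o2 o3 by (intro integral_Re Bochner_Integration.integrable_add)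
  also have "\<dots> = 0"
    using o1 o2 o3 by simp
  finally have orth: "(LINT \<omega>|M. Re (complex_of_real ((cmod (W k (P \<omega>)))\<^sup>2) * cnj (W k (P \<omega>)) * D \<omega>)) = 0"
    by (simp only: V_def)
  have d1: "integrable M (\<lambda>\<omega>. cmod (D1 \<omega>) ^ 4)" "(LINT \<omega>|M. cmod (D1 \<omega>) ^ 4) \<le> \<kappa> * cmod (x k k) ^ 4"
    using Y\<phi>(3,4) unfolding D1_def by (auto simp: norm_mult power_mult_distrib intro!: mult_right_mono)
  have d2: "integrable M (\<lambda>\<omega>. cmod (D2 \<omega>) ^ 4)" "(LINT \<omega>|M. cmod (D2 \<omega>) ^ 4) \<le> \<kappa> * (4 * sqrt \<kappa> * ?s2)\<^sup>2"
  proof -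
    note mm = moment4_mult[OF ind J m(2), of "\<lambda>y. y", folded P_def, OF _ i2(1) Y4(1)[OF k(1)]]
    show "integrable M (\<lambda>\<omega>. cmod (D2 \<omega>) ^ 4)" unfolding D2_def by (rule mm) simp
    have "(LINT \<omega>|M. cmod (D2 \<omega>) ^ 4) = (LINT \<omega>|M. cmod (Y (i, k) \<omega>) ^ 4) * (LINT \<omega>|M. cmod (F2 (P \<omega>)) ^ 4)"
      unfolding D2_def by (rule mm) simp
    also have "\<dots> \<le> \<kappa> * (4 * sqrt \<kappa> * ?s2)\<^sup>2"
      using \<kappa> Y4(2)[OF k(1)] i2(2) by (intro mult_mono) auto
    finally show "(LINT \<omega>|M. cmod (D2 \<omega>) ^ 4) \<le> \<kappa> * (4 * sqrt \<kappa> * ?s2)\<^sup>2" .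
  qed
  have d3: "integrable M (\<lambda>\<omega>. cmod (D3 \<omega>) ^ 4)" "(LINT \<omega>|M. cmod (D3 \<omega>) ^ 4) \<le> \<kappa> * (4 * sqrt \<kappa> * ?s3)\<^sup>2"
  proof -
    have "integrable M (\<lambda>\<omega>. cmod (cnj (Y (i, k) \<omega>)) ^ 4)" using Y4(1)[OF k(1)] by simp
    note mm = moment4_mult[OF ind J m(3) m\<phi>(2), folded P_def, OF i3(1) this]
    show "integrable M (\<lambda>\<omega>. cmod (D3 \<omega>) ^ 4)" unfolding D3_def by (rule mm)
    have "(LINT \<omega>|M. cmod (D3 \<omega>) ^ 4) = (LINT \<omega>|M. cmod (cnj (Y (i, k) \<omega>)) ^ 4) * (LINT \<omega>|M. cmod (F3 (P \<omega>)) ^ 4)"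
      unfolding D3_def by (rule mm)
    also have "\<dots> \<le> \<kappa> * (4 * sqrt \<kappa> * ?s3)\<^sup>2"
      using \<kappa> Y4(2)[OF k(1)] i3(2) by (intro mult_mono) auto
    finally show "(LINT \<omega>|M. cmod (D3 \<omega>) ^ 4) \<le> \<kappa> * (4 * sqrt \<kappa> * ?s3)\<^sup>2" .
  qed
  have mP: "P \<in> measurable M (PiM J (\<lambda>_. borel))"
    unfolding P_def using Ym k by (intro measurable_restrict) (auto simp: J_def)
  have mD: "D \<in> borel_measurable M"
    unfolding D_def D1_def D2_def D3_def
    using Ym[OF k(1)] measurable_compose[OF mP m(2)] measurable_compose[OF mP m(3)] measurable_compose[OF Ym[OF k(1)] m\<phi>(1)]
    by (intro borel_measurable_add borel_measurable_times borel_measurable_cnj borel_measurable_const) auto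
  have iR: "integrable M (\<lambda>\<omega>. 27 * (cmod (D1 \<omega>) ^ 4 + cmod (D2 \<omega>) ^ 4 + cmod (D3 \<omega>) ^ 4))"
    using d1 d2 d3 by simp
  have iD: "integrable M (\<lambda>\<omega>. cmod (D \<omega>) ^ 4)"
  proof (rule Bochner_Integration.integrable_bound[OF iR])
    show "(\<lambda>\<omega>. cmod (D \<omega>) ^ 4) \<in> borel_measurable M" using mD by measurable
  qed (use cmod_add3_power4 in \<open>auto simp: D_def\<close>)
  let ?s1 = "(cmod (x k k))\<^sup>2"
  have sn: "0 \<le> ?s1" "0 \<le> ?s2" "0 \<le> ?s3" by (auto intro: sum_nonneg)
  have "(LINT \<omega>|M. cmod (D \<omega>) ^ 4) \<le> (LINT \<omega>|M. 27 * (cmod (D1 \<omega>) ^ 4 + cmod (D2 \<omega>) ^ 4 + cmod (D3 \<omega>) ^ 4))"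
    unfolding D_def by (intro integral_mono iR iD[unfolded D_def] cmod_add3_power4)
  also have "\<dots> \<le> 27 * (\<kappa> * cmod (x k k) ^ 4 + \<kappa> * (4 * sqrt \<kappa> * ?s2)\<^sup>2 + \<kappa> * (4 * sqrt \<kappa> * ?s3)\<^sup>2)"
    using d1 d2 d3 by simp
  also have "\<dots> = 27 * \<kappa> * (?s1\<^sup>2 + 16 * \<kappa> * ?s2\<^sup>2 + 16 * \<kappa> * ?s3\<^sup>2)"
    using \<kappa> by (simp add: power_mult_distrib algebra_simps)
  also have "\<dots> \<le> 27 * \<kappa> * ((1 + 16 * \<kappa>) * (?s1 + ?s2 + ?s3)\<^sup>2)"
  proof (intro mult_left_mono)
    have "16 * \<kappa> * ?s2\<^sup>2 \<le> (1 + 16 * \<kappa>) * ?s2\<^sup>2" "16 * \<kappa> * ?s3\<^sup>2 \<le> (1 + 16 * \<kappa>) * ?s3\<^sup>2"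
      "1 * ?s1\<^sup>2 \<le> (1 + 16 * \<kappa>) * ?s1\<^sup>2"
      using \<kappa> by (intro mult_right_mono; simp)+
    hence "?s1\<^sup>2 + 16 * \<kappa> * ?s2\<^sup>2 + 16 * \<kappa> * ?s3\<^sup>2 \<le> (1 + 16 * \<kappa>) * (?s1\<^sup>2 + ?s2\<^sup>2 + ?s3\<^sup>2)"
      unfolding distrib_left by linarith
    also have "?s1\<^sup>2 + ?s2\<^sup>2 + ?s3\<^sup>2 \<le> (?s1 + ?s2 + ?s3)\<^sup>2"
    proof -
      have "a\<^sup>2 + b\<^sup>2 + c\<^sup>2 \<le> (a + b + c)\<^sup>2" if "0 \<le> a" "0 \<le> b" "0 \<le> c" for a b c :: real
        using that mult_nonneg_nonneg[of a b] mult_nonneg_nonneg[of a c] mult_nonneg_nonneg[of b c]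
        by (simp add: power2_eq_square algebra_simps)
      from this[OF sn] show ?thesis .
    qed
    finally show "?s1\<^sup>2 + 16 * \<kappa> * ?s2\<^sup>2 + 16 * \<kappa> * ?s3\<^sup>2 \<le> (1 + 16 * \<kappa>) * (?s1 + ?s2 + ?s3)\<^sup>2"
      using \<kappa> by (simp add: mult_left_mono)
  qed (use \<kappa> in auto)
  also have "\<dots> = (sqrt C * (?s1 + ?s2 + ?s3))\<^sup>2"
    using C by (simp add: power_mult_distrib C_def)
  finally have D4: "(LINT \<omega>|M. cmod (D \<omega>) ^ 4) \<le> (sqrt C * (?s1 + ?s2 + ?s3))\<^sup>2" .
  have W4: "(LINT \<omega>|M. cmod (W k (P \<omega>)) ^ 4) \<le> (4 * sqrt C * (\<Sum>a<k. \<Sum>b<k. (cmod (x a b))\<^sup>2))\<^sup>2"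
    using Suc k unfolding WP C_def by simp
  have nn: "0 \<le> 4 * sqrt C * (\<Sum>a<k. \<Sum>b<k. (cmod (x a b))\<^sup>2)" "0 \<le> sqrt C * (?s1 + ?s2 + ?s3)"
    using C sn by (auto intro!: mult_nonneg_nonneg sum_nonneg add_nonneg_nonneg)
  note res = moment4_add[OF measurable_compose[OF mP m(1)] mD iW W4 iD D4 nn orth]
  have WS: "W (Suc k) (\<lambda>j. Y j \<omega>) = W k (P \<omega>) + D \<omega>" for \<omega>
  proof -
    have "Y (i, k) \<omega> * x k k * cnj (Y (i, k) \<omega>) = (\<phi> (Y (i, k) \<omega>) + 1) * x k k"
      unfolding \<phi>_def complex_norm_square by (simp add: mult_ac)
    moreover have "(\<Sum>b<k. Y (i, k) \<omega> * x k b * cnj (Y (i, b) \<omega>)) = D2 \<omega>"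
      unfolding D2_def F2_def by (simp add: P sum_distrib_left mult.assoc)
    moreover have "(\<Sum>a<k. Y (i, a) \<omega> * x a k * cnj (Y (i, k) \<omega>)) = D3 \<omega>"
      unfolding D3_def F3_def by (simp add: P sum_distrib_left mult_ac)
    ultimately show ?thesis
      unfolding WP unfolding W_def D_def D1_def by (simp add: sum.distrib algebra_simps)
  qed
  have SS: "(\<Sum>a<Suc k. \<Sum>b<Suc k. (cmod (x a b))\<^sup>2) = (\<Sum>a<k. \<Sum>b<k. (cmod (x a b))\<^sup>2) + (?s1 + ?s2 + ?s3)"
    by (simp add: sum.distrib)
  show ?case
    unfolding WS SS C_def[symmetric] using res by (simp add: algebra_simps)
qed

end

section \<open>Stieltjes transforms\<close>

lemma resolvent_denominator:
  assumes "Im z > 0"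
  shows "complex_of_real x - z \<noteq> 0" "Im z \<le> cmod (complex_of_real x - z)"
    "cmod (1 / (complex_of_real x - z)) \<le> 1 / Im z"
proof -
  show 1: "Im z \<le> cmod (complex_of_real x - z)"
    using abs_Im_le_cmod[of "complex_of_real x - z"] by simp
  show "complex_of_real x - z \<noteq> 0" using 1 assms by auto
  show "cmod (1 / (complex_of_real x - z)) \<le> 1 / Im z"
    unfolding norm_divide using 1 assms by (intro frac_le) auto
qed

lemma resolvent_diff:
  assumes "Im z > 0" "Im w > 0"
  shows "1 / (complex_of_real x - w) - 1 / (complex_of_real x - z) =
    (w - z) * (1 / (complex_of_real x - z) * (1 / (complex_of_real x - w)))"
  using resolvent_denominator(1)[OF assms(1), of x] resolvent_denominator(1)[OF assms(2), of x]
  by (simp add: divide_simps)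

lemma isCont_resolvent:
  assumes "Im z > 0"
  shows "isCont (\<lambda>x. 1 / (complex_of_real x - z)) x"
  using resolvent_denominator(1)[OF assms] by (intro continuous_intros) auto

context real_distribution
begin

lemma integrable_bounded_measurable:
  fixes f :: "real \<Rightarrow> 'b :: {banach, second_countable_topology}"
  assumes "f \<in> borel_measurable borel" "\<And>x. norm (f x) \<le> B"
  shows "integrable M f"
  using assms by (intro integrable_const_bound[where B = B]) auto

lemma integral_bound:
  fixes f :: "real \<Rightarrow> 'b :: {banach, second_countable_topology}"
  assumes "f \<in> borel_measurable borel" "\<And>x. norm (f x) \<le> B"
  shows "norm (integral\<^sup>L M f) \<le> B"
proof -
  have "norm (integral\<^sup>L M f) \<le> (LINT x|M. norm (f x))" by (rule integral_norm_bound)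
  also have "\<dots> \<le> (LINT x|M. B)"
    using assms integrable_bounded_measurable[OF assms] by (intro integral_mono) auto
  finally show ?thesis using prob_space by simp
qed

lemma measurable_resolvent [measurable]: "(\<lambda>x. 1 / (complex_of_real x - z)) \<in> borel_measurable borel"
  by measurable

lemma integrable_resolvent: "Im z > 0 \<Longrightarrow> integrable M (\<lambda>x. 1 / (complex_of_real x - z))"
  using resolvent_denominator(3) by (intro integrable_bounded_measurable[where B = "1 / Im z"]) auto

lemma stieltjes_bound: "Im z > 0 \<Longrightarrow> cmod (stieltjes_transform M z) \<le> 1 / Im z"
  unfolding stieltjes_transform_def using resolvent_denominator(3) by (intro integral_bound) auto

lemma stieltjes_diff:
  assumes "Im z > 0" "Im w > 0"
  shows "stieltjes_transform M w - stieltjes_transform M z =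
    (w - z) * (LINT x|M. 1 / (complex_of_real x - z) * (1 / (complex_of_real x - w)))"
proof -
  have "stieltjes_transform M w - stieltjes_transform M z =
      (LINT x|M. 1 / (complex_of_real x - w) - 1 / (complex_of_real x - z))"
    unfolding stieltjes_transform_def using integrable_resolvent assms by simp
  also have "\<dots> = (LINT x|M. (w - z) * (1 / (complex_of_real x - z) * (1 / (complex_of_real x - w))))"
  proof (rule Bochner_Integration.integral_cong[OF refl])
    fix x
    show "1 / (complex_of_real x - w) - 1 / (complex_of_real x - z) =
        (w - z) * (1 / (complex_of_real x - z) * (1 / (complex_of_real x - w)))"
      by (rule resolvent_diff[OF assms])
  qed
  finally show ?thesis by (simp only: integral_mult_right_zero)
qed

text \<open>The kernel of the difference formula is bounded by the product of the reciprocal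
  heights. The explicit constant is what the contraction argument needs.\<close>

lemma stieltjes_lipschitz:
  assumes "Im z > 0" "Im w > 0"
  shows "cmod (stieltjes_transform M w - stieltjes_transform M z) \<le> cmod (w - z) / (Im z * Im w)"
proof -
  have "cmod (1 / (complex_of_real x - z) * (1 / (complex_of_real x - w))) \<le> 1 / Im z * (1 / Im w)" for x
    unfolding norm_mult using resolvent_denominator(3) assms by (intro mult_mono) auto
  hence "cmod (LINT x|M. 1 / (complex_of_real x - z) * (1 / (complex_of_real x - w))) \<le> 1 / Im z * (1 / Im w)"
    by (intro integral_bound) auto
  hence "cmod (w - z) * cmod (LINT x|M. 1 / (complex_of_real x - z) * (1 / (complex_of_real x - w))) \<le> cmod (w - z) * (1 / Im z * (1 / Im w))"
    by (intro mult_left_mono) auto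
  thus ?thesis unfolding stieltjes_diff[OF assms] norm_mult by simp
qed

text \<open>By \<open>stieltjes_diff\<close> the difference quotient is exactly the integral
  \<open>K w\<close>, so differentiability reduces to continuity of \<open>K\<close> at
  \<open>z\<close>; the kernel bounds are uniform once \<open>Im w > Im z / 2\<close>.\<close>

lemma stieltjes_has_derivative:
  assumes z: "Im z > 0"
  shows "(stieltjes_transform M has_field_derivative (LINT x|M. (1 / (complex_of_real x - z))\<^sup>2)) (at z)"
proof -
  define K where "K w = (LINT x|M. 1 / (complex_of_real x - z) * (1 / (complex_of_real x - w)))" for w
  have ev: "eventually (\<lambda>w. Im w > Im z / 2) (at z)"
    using eventually_at_in_open'[OF open_halfspace_Im_gt[of "Im z / 2"], of z] z by simp
  have iK: "integrable M (\<lambda>x. 1 / (complex_of_real x - z) * (1 / (complex_of_real x - w)))" if "Im w > 0" for w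
  proof (rule integrable_bounded_measurable)
    show "norm (1 / (complex_of_real x - z) * (1 / (complex_of_real x - w))) \<le> 1 / Im z * (1 / Im w)" for x
      unfolding norm_mult using resolvent_denominator(3) z that by (intro mult_mono) auto
  qed measurable
  have bd: "cmod (K w - K z) \<le> cmod (w - z) * (1 / Im z * (1 / Im z * (2 / Im z)))" if w: "Im w > Im z / 2" for w
  proof -
    have w0: "Im w > 0" using w z by simp
    have "K w - K z = (LINT x|M. 1 / (complex_of_real x - z) * (1 / (complex_of_real x - w)) - 1 / (complex_of_real x - z) * (1 / (complex_of_real x - z)))"
      unfolding K_def using iK w0 z by simp
    also have "\<dots> = (LINT x|M. (w - z) * (1 / (complex_of_real x - z) * (1 / (complex_of_real x - z) * (1 / (complex_of_real x - w)))))"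
    proof (rule Bochner_Integration.integral_cong[OF refl])
      fix x
      show "1 / (complex_of_real x - z) * (1 / (complex_of_real x - w)) - 1 / (complex_of_real x - z) * (1 / (complex_of_real x - z)) =
          (w - z) * (1 / (complex_of_real x - z) * (1 / (complex_of_real x - z) * (1 / (complex_of_real x - w))))"
        unfolding right_diff_distrib[symmetric] resolvent_diff[OF z w0] by (simp only: mult.left_commute)
    qed
    also have "cmod \<dots> \<le> cmod (w - z) * (1 / Im z * (1 / Im z * (2 / Im z)))"
    proof (rule integral_bound)
      fix x
      have "cmod (1 / (complex_of_real x - w)) \<le> 2 / Im z"
      proof -
        have "1 / Im w \<le> 1 / (Im z / 2)" using w z by (intro divide_left_mono) auto
        thus ?thesis using resolvent_denominator(3)[OF w0, of x] by simp
      qed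
      thus "cmod ((w - z) * (1 / (complex_of_real x - z) * (1 / (complex_of_real x - z) * (1 / (complex_of_real x - w)))))
          \<le> cmod (w - z) * (1 / Im z * (1 / Im z * (2 / Im z)))"
        unfolding norm_mult using resolvent_denominator(3)[OF z, of x] z by (intro mult_mono) auto
    qed measurable
    finally show ?thesis .
  qed
  have "((\<lambda>w. K w - K z) \<longlongrightarrow> 0) (at z)"
  proof (rule Lim_null_comparison)
    show "eventually (\<lambda>w. norm (K w - K z) \<le> cmod (w - z) * (1 / Im z * (1 / Im z * (2 / Im z)))) (at z)"
      using ev by eventually_elim (rule bd)
    have "((\<lambda>w. cmod (w - z) * (1 / Im z * (1 / Im z * (2 / Im z)))) \<longlongrightarrow> cmod (z - z) * (1 / Im z * (1 / Im z * (2 / Im z)))) (at z)"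
      by (intro tendsto_intros)
    thus "((\<lambda>w. cmod (w - z) * (1 / Im z * (1 / Im z * (2 / Im z)))) \<longlongrightarrow> 0) (at z)" by simp
  qed
  hence "(K \<longlongrightarrow> K z) (at z)" by (rule LIM_zero_cancel)
  moreover have "eventually (\<lambda>w. K w = (stieltjes_transform M w - stieltjes_transform M z) / (w - z)) (at z)"
    using ev eventually_neq_at_within[of z z UNIV]
  proof eventually_elim
    case (elim w)
    thus ?case using stieltjes_diff[OF z, of w] z by (simp add: K_def)
  qed
  ultimately have "((\<lambda>w. (stieltjes_transform M w - stieltjes_transform M z) / (w - z)) \<longlongrightarrow> K z) (at z)"
    by (rule Lim_transform_eventually)
  moreover have "K z = (LINT x|M. (1 / (complex_of_real x - z))\<^sup>2)" unfolding K_def by (simp only: power2_eq_square)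
  ultimately show ?thesis unfolding has_field_derivative_iff by simp
qed

lemma stieltjes_holomorphic: "stieltjes_transform M holomorphic_on {z. Im z > 0}"
  by (rule holomorphic_onI)
     (use stieltjes_has_derivative in \<open>auto simp: field_differentiable_def intro: has_field_derivative_at_within\<close>)

section \<open>Tails, asymptotics and inversion\<close>

lemma Im_stieltjes:
  assumes "v > 0"
  shows "Im (stieltjes_transform M (Complex u v)) = (LINT x|M. v / ((x - u)\<^sup>2 + v\<^sup>2))"
proof -
  have "Im (stieltjes_transform M (Complex u v)) = (LINT x|M. Im (1 / (complex_of_real x - Complex u v)))"
    unfolding stieltjes_transform_def using assms by (intro integral_Im[symmetric] integrable_resolvent) auto
  also have "\<dots> = (LINT x|M. v / ((x - u)\<^sup>2 + v\<^sup>2))"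
    by (intro Bochner_Integration.integral_cong refl) (simp add: Im_divide power2_eq_square)
  finally show ?thesis .
qed

text \<open>On the imaginary axis \<open>y\<close> times the imaginary part of the transform is the
  integral of \<open>y^2 / (x^2 + y^2)\<close>. This integrand is at most 1 everywhere and at most
  1/2 for \<open>|x| \<ge> y\<close>, so twice the integrand minus 1 lies below the indicator of the
  interval.\<close>

lemma tail_bound:
  assumes y: "y > 0"
  shows "measure M {-y<..y} \<ge> 1 - 2 * (1 - y * Im (stieltjes_transform M (Complex 0 y)))"
proof -
  have int: "integrable M (\<lambda>x. y / (x\<^sup>2 + y\<^sup>2))"
  proof (rule integrable_bounded_measurable)
    fix x
    have "y / (x\<^sup>2 + y\<^sup>2) \<le> y / y\<^sup>2" using y by (intro divide_left_mono) (auto intro!: add_nonneg_pos mult_pos_pos)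
    thus "norm (y / (x\<^sup>2 + y\<^sup>2)) \<le> y / y\<^sup>2" using y by simp
  qed measurable
  have "(LINT x|M. 2 * y * (y / (x\<^sup>2 + y\<^sup>2)) - 1) = (LINT x|M. 2 * y * (y / (x\<^sup>2 + y\<^sup>2))) - (LINT x|M. 1)"
    by (intro Bochner_Integration.integral_diff integrable_mult_right int) simp
  also have "(LINT x|M. 2 * y * (y / (x\<^sup>2 + y\<^sup>2))) = 2 * y * Im (stieltjes_transform M (Complex 0 y))"
    using Im_stieltjes[OF y, of 0] by (simp only: integral_mult_right_zero diff_zero)
  also have "(LINT x|M. 1) = (1 :: real)" using prob_space by simp
  finally have "1 - 2 * (1 - y * Im (stieltjes_transform M (Complex 0 y))) = (LINT x|M. 2 * y * (y / (x\<^sup>2 + y\<^sup>2)) - 1)"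
    by (simp only: right_diff_distrib)
  also have "\<dots> \<le> (LINT x|M. indicator {-y<..y} x)"
  proof (rule integral_mono)
    fix x
    show "2 * y * (y / (x\<^sup>2 + y\<^sup>2)) - 1 \<le> indicator {-y<..y} x"
    proof (cases "x \<in> {-y<..y}")
      case True
      have "2 * y * y \<le> 2 * (x\<^sup>2 + y\<^sup>2)" by (simp add: power2_eq_square)
      hence "2 * y * (y / (x\<^sup>2 + y\<^sup>2)) \<le> 2" using y by (simp add: divide_le_eq add_nonneg_pos)
      thus ?thesis using True by simp
    next
      case False
      hence "y \<le> \<bar>x\<bar>" by auto
      hence "y\<^sup>2 \<le> x\<^sup>2" using y by (metis abs_le_square_iff abs_of_pos)
      hence "2 * y * y \<le> 1 * (x\<^sup>2 + y\<^sup>2)" by (simp add: power2_eq_square)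
      hence "2 * y * (y / (x\<^sup>2 + y\<^sup>2)) \<le> 1" using y by (simp add: divide_le_eq add_nonneg_pos)
      thus ?thesis using False by simp
    qed
  next
    show "integrable M (\<lambda>x. 2 * y * (y / (x\<^sup>2 + y\<^sup>2)) - 1)"
      by (intro Bochner_Integration.integrable_diff integrable_mult_right int integrable_const)
    show "integrable M (indicator {-y<..y} :: real \<Rightarrow> real)"
      by (rule integrable_bounded_measurable[where B = 1]) (auto simp: indicator_def)
  qed
  also have "\<dots> = measure M {-y<..y}" by simp
  finally show ?thesis .
qed

text \<open>The shift \<open>h n\<close> is the perturbation of the spectral parameter in the fixed point equation.\<close>

lemma stieltjes_asymptotics:
  fixes h :: "nat \<Rightarrow> complex"
  assumes H: "\<And>n. cmod (h n) \<le> H"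
  shows "(\<lambda>n. Complex 0 (real n) * stieltjes_transform M (Complex 0 (real n) - h n)) \<longlonglongrightarrow> - 1"
proof -
  have H0: "H \<ge> 0" using H[of 0] norm_ge_zero order_trans by blast
  define z where "z n = Complex 0 (real n) - h n" for n
  \<comment> \<open>From this index on \<open>z n\<close> lies in the upper half plane, at a height
    of at least \<open>n / 2\<close>; the sequence is shifted by \<open>N\<close> so that every term
    is legitimate.\<close>
  define N where "N = nat \<lceil>2 * H + 1\<rceil>"
  have zN: "Im (z n) \<ge> real n / 2" "Im (z n) > 0" if "n \<ge> N" for n
  proof -
    have "real n \<ge> 2 * H + 1" using that unfolding N_def by linarith
    moreover have "Im (h n) \<le> H" using abs_Im_le_cmod[of "h n"] H[of n] by linarith
    ultimately show "Im (z n) \<ge> real n / 2" "Im (z n) > 0" using H0 by (auto simp: z_def)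
  qed
  \<comment> \<open>This equals \<open>(x + h) / (x - z)\<close>, which tends to 0 for fixed
    \<open>x\<close> and is bounded uniformly. The 1 integrates to the total mass, which becomes the
    limit \<open>- 1\<close>.\<close>
  define f where "f n x = 1 + Complex 0 (real (n + N)) * (1 / (complex_of_real x - z (n + N)))" for n x
  have feq: "f n x = (complex_of_real x + h (n + N)) / (complex_of_real x - z (n + N))" for n x
  proof -
    have "complex_of_real x - z (n + N) \<noteq> 0" by (rule resolvent_denominator(1)) (use zN in auto)
    hence "f n x = (complex_of_real x - z (n + N) + Complex 0 (real (n + N))) / (complex_of_real x - z (n + N))"
      by (simp add: f_def field_simps)
    thus ?thesis by (simp add: z_def)
  qed
  have "(\<lambda>n. integral\<^sup>L M (f n)) \<longlonglongrightarrow> (LINT x|M. 0)"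
  proof (rule integral_dominated_convergence[where w = "\<lambda>_. 10"])
    show "AE x in M. (\<lambda>n. f n x) \<longlonglongrightarrow> 0"
    proof (rule AE_I2)
      fix x
      show "(\<lambda>n. f n x) \<longlonglongrightarrow> 0"
      proof (rule Lim_null_comparison)
        show "eventually (\<lambda>n. norm (f n x) \<le> (\<bar>x\<bar> + H) * 2 / real (n + N)) sequentially"
          using eventually_gt_at_top[of 0]
        proof eventually_elim
          case (elim n)
          have p: "Im (z (n + N)) > 0" "real (n + N) / 2 \<le> Im (z (n + N))" using zN[of "n + N"] by auto
          have "norm (f n x) = cmod (complex_of_real x + h (n + N)) / cmod (complex_of_real x - z (n + N))"
            unfolding feq norm_divide ..
          also have "\<dots> \<le> (\<bar>x\<bar> + H) / (real (n + N) / 2)"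
          proof (rule frac_le)
            show "cmod (complex_of_real x + h (n + N)) \<le> \<bar>x\<bar> + H"
              using norm_triangle_ineq[of "complex_of_real x" "h (n + N)"] H[of "n + N"] by simp
            show "real (n + N) / 2 \<le> cmod (complex_of_real x - z (n + N))"
              using resolvent_denominator(2)[OF p(1), of x] p(2) by linarith
          qed (use H0 elim in auto)
          finally show ?case by simp
        qed
        show "(\<lambda>n. (\<bar>x\<bar> + H) * 2 / real (n + N)) \<longlonglongrightarrow> 0"
          by (rule LIMSEQ_ignore_initial_segment[OF lim_const_over_n])
      qed
    qed
    show "AE x in M. norm (f n x) \<le> 10" for n
    proof (rule AE_I2)
      fix x
      have p: "Im (z (n + N)) > 0" "real (n + N) / 2 \<le> Im (z (n + N))" using zN[of "n + N"] by auto
      have "cmod (complex_of_real x - z (n + N)) > 0" using resolvent_denominator(1)[OF p(1), of x] by simp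
      moreover have "real (n + N) \<le> 2 * cmod (complex_of_real x - z (n + N))"
        using resolvent_denominator(2)[OF p(1), of x] p(2) by argo
      moreover have "cmod (Complex 0 (real (n + N))) = real (n + N)" by (simp add: cmod_def)
      ultimately have "cmod (Complex 0 (real (n + N)) * (1 / (complex_of_real x - z (n + N)))) \<le> 2"
        by (simp add: norm_mult norm_divide divide_le_eq)
      hence "norm (f n x) \<le> norm (1 :: complex) + 2"
        unfolding f_def by (intro order_trans[OF norm_triangle_ineq] add_left_mono)
      thus "norm (f n x) \<le> 10" by simp
    qed
  qed (auto simp: f_def[abs_def])
  moreover have "integral\<^sup>L M (f n) = 1 + Complex 0 (real (n + N)) * stieltjes_transform M (z (n + N))" for n
  proof -
    have "integrable M (\<lambda>x. 1 / (complex_of_real x - z (n + N)))" by (rule integrable_resolvent) (use zN in auto)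
    hence "integral\<^sup>L M (f n) = (LINT x|M. 1) + (LINT x|M. Complex 0 (real (n + N)) * (1 / (complex_of_real x - z (n + N))))"
      unfolding f_def[abs_def] by (intro Bochner_Integration.integral_add integrable_mult_right) auto
    also have "(LINT x|M. 1) = (1 :: complex)" using prob_space by simp
    finally show ?thesis by (simp only: integral_mult_right_zero stieltjes_transform_def)
  qed
  ultimately have "(\<lambda>n. (1 + Complex 0 (real (n + N)) * stieltjes_transform M (z (n + N))) - 1) \<longlonglongrightarrow> 0 - 1"
    by (intro tendsto_diff tendsto_const) simp
  hence "(\<lambda>n. Complex 0 (real (n + N)) * stieltjes_transform M (z (n + N))) \<longlonglongrightarrow> - 1" by simp
  thus ?thesis unfolding z_def by (rule LIMSEQ_offset)
qed

text \<open>The order of integration is exchanged for the Poisson kernel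
  \<open>v / ((x - u)^2 + v^2)\<close>, whose primitive in \<open>u\<close> is an arctangent. As the
  kernel is nonnegative, extended integrals allow this without an integrability argument.\<close>

lemma nn_integral_Im_stieltjes:
  assumes v: "v > 0" and ab: "a \<le> b"
  shows "(\<integral>\<^sup>+u. ennreal (Im (stieltjes_transform M (Complex u v))) * indicator {a..b} u \<partial>lborel) =
    ennreal (LINT x|M. arctan ((b - x) / v) - arctan ((a - x) / v))"
proof -
  interpret ps: pair_sigma_finite lborel M ..
  define k where "k u x = v / ((x - u)\<^sup>2 + v\<^sup>2)" for u x :: real
  have k0: "0 \<le> k u x" for u x using v by (simp add: k_def)
  have kb: "k u x \<le> v / v\<^sup>2" for u x
    unfolding k_def using v by (intro divide_left_mono) (auto intro!: add_nonneg_pos mult_pos_pos)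
  have [measurable]: "(\<lambda>x. k u x) \<in> borel_measurable borel" for u unfolding k_def by measurable
  have "(\<integral>\<^sup>+u. ennreal (Im (stieltjes_transform M (Complex u v))) * indicator {a..b} u \<partial>lborel) =
      (\<integral>\<^sup>+u. (\<integral>\<^sup>+x. ennreal (k u x) * indicator {a..b} u \<partial>M) \<partial>lborel)"
  proof (intro nn_integral_cong)
    fix u
    have "integrable M (k u)"
      using k0 kb by (intro integrable_bounded_measurable[where B = "v / v\<^sup>2"]) auto
    hence "(\<integral>\<^sup>+x. ennreal (k u x) \<partial>M) = ennreal (Im (stieltjes_transform M (Complex u v)))"
      unfolding Im_stieltjes[OF v] k_def[symmetric] using k0 by (intro nn_integral_eq_integral) auto
    thus "ennreal (Im (stieltjes_transform M (Complex u v))) * indicator {a..b} u =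
        (\<integral>\<^sup>+x. ennreal (k u x) * indicator {a..b} u \<partial>M)"
      by (simp add: nn_integral_multc)
  qed
  also have "\<dots> = (\<integral>\<^sup>+x. (\<integral>\<^sup>+u. ennreal (k u x) * indicator {a..b} u \<partial>lborel) \<partial>M)"
    by (rule ps.Fubini'[symmetric]) (simp add: k_def)
  also have "\<dots> = (\<integral>\<^sup>+x. ennreal (arctan ((b - x) / v) - arctan ((a - x) / v)) \<partial>M)"
  proof (intro nn_integral_cong nn_integral_FTC_Icc)
    fix x u
    have nz: "(x - u)\<^sup>2 + v\<^sup>2 \<noteq> 0" using v zero_less_power[of v 2] zero_le_power2[of "x - u"] by linarith
    have "((\<lambda>u. arctan ((u - x) / v)) has_real_derivative inverse (1 + ((u - x) / v)\<^sup>2) * (1 / v)) (at u)"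
      using v by (auto intro!: derivative_eq_intros simp: field_simps)
    also have "inverse (1 + ((u - x) / v)\<^sup>2) * (1 / v) = k u x"
    proof -
      have "(u - x)\<^sup>2 = (x - u)\<^sup>2" by (simp add: power2_commute)
      hence "1 + ((u - x) / v)\<^sup>2 = ((x - u)\<^sup>2 + v\<^sup>2) / v\<^sup>2" using v by (simp add: power_divide field_simps)
      thus ?thesis using v nz by (simp add: k_def power2_eq_square field_simps)
    qed
    finally show "((\<lambda>u. arctan ((u - x) / v)) has_real_derivative k u x) (at u)" .
  qed (use k0 ab in \<open>auto simp: k_def\<close>)
  also have "\<dots> = ennreal (LINT x|M. arctan ((b - x) / v) - arctan ((a - x) / v))"
  proof (intro nn_integral_eq_integral integrable_bounded_measurable)
    fix x
    show "norm (arctan ((b - x) / v) - arctan ((a - x) / v)) \<le> pi"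
      using arctan_bounded[of "(b - x) / v"] arctan_bounded[of "(a - x) / v"] by (simp add: abs_le_iff)
  next
    show "AE x in M. 0 \<le> arctan ((b - x) / v) - arctan ((a - x) / v)"
      using ab v by (auto intro!: AE_I2 arctan_monotone' divide_right_mono)
  qed measurable
  finally show ?thesis .
qed

text \<open>Approximating the right end point from above makes the mass at \<open>t\<close> count fully.\<close>

lemma stieltjes_inversion:
  "(\<lambda>n. LINT x|M. arctan ((t + 1 / real (Suc n) - x) / (1 / (real (Suc n))\<^sup>2))
      - arctan ((- real (Suc n) - x) / (1 / (real (Suc n))\<^sup>2))) \<longlonglongrightarrow> pi * cdf M t"
proof -
  let ?f = "\<lambda>n x. arctan ((t + 1 / real (Suc n) - x) / (1 / (real (Suc n))\<^sup>2))
      - arctan ((- real (Suc n) - x) / (1 / (real (Suc n))\<^sup>2))"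
  have "(\<lambda>n. integral\<^sup>L M (?f n)) \<longlonglongrightarrow> (LINT x|M. pi * indicator {..t} x)"
  proof (rule integral_dominated_convergence[where w = "\<lambda>_. pi"])
    show "AE x in M. norm (?f n x) \<le> pi" for n
    proof (rule AE_I2)
      fix x
      show "norm (?f n x) \<le> pi"
        using arctan_bounded[of "(t + 1 / real (Suc n) - x) / (1 / (real (Suc n))\<^sup>2)"]
          arctan_bounded[of "(- real (Suc n) - x) / (1 / (real (Suc n))\<^sup>2)"] by (simp add: abs_le_iff del: of_nat_Suc)
    qed
    show "AE x in M. (\<lambda>n. ?f n x) \<longlonglongrightarrow> pi * indicator {..t} x"
    proof (rule AE_I2)
      fix x
      have lo: "filterlim (\<lambda>n. (- real (Suc n) - x) / (1 / (real (Suc n))\<^sup>2)) at_bot sequentially"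
        by real_asymp
      have lo': "(\<lambda>n. arctan ((- real (Suc n) - x) / (1 / (real (Suc n))\<^sup>2))) \<longlonglongrightarrow> - (pi / 2)"
        by (rule filterlim_compose[OF tendsto_arctan_at_bot lo])
      show "(\<lambda>n. ?f n x) \<longlonglongrightarrow> pi * indicator {..t} x"
      proof (cases "x \<le> t")
        case True
        define d where "d = t - x"
        have d: "d \<ge> 0" using True by (simp add: d_def)
        \<comment> \<open>The height \<open>1 / (n + 1)^2\<close> is small against the offset
          \<open>1 / (n + 1)\<close>, so even for \<open>d = 0\<close>, that is
          \<open>x = t\<close>, the argument tends to infinity.\<close>
        have "filterlim (\<lambda>n. (d + 1 / real (Suc n)) / (1 / (real (Suc n))\<^sup>2)) at_top sequentially"
        proof (rule filterlim_at_top_mono[OF filterlim_Suc[THEN filterlim_compose[OF filterlim_real_sequentially]]])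
          show "eventually (\<lambda>n. real (Suc n) \<le> (d + 1 / real (Suc n)) / (1 / (real (Suc n))\<^sup>2)) sequentially"
          proof (rule always_eventually, rule allI)
            fix n
            have "(d + 1 / real (Suc n)) / (1 / (real (Suc n))\<^sup>2) = d * (real (Suc n))\<^sup>2 + real (Suc n)"
              by (simp add: field_simps power2_eq_square)
            thus "real (Suc n) \<le> (d + 1 / real (Suc n)) / (1 / (real (Suc n))\<^sup>2)" using d by simp
          qed
        qed
        hence "filterlim (\<lambda>n. (t + 1 / real (Suc n) - x) / (1 / (real (Suc n))\<^sup>2)) at_top sequentially"
          by (simp add: d_def algebra_simps)
        from filterlim_compose[OF tendsto_arctan_at_top this] lo'
        have "(\<lambda>n. ?f n x) \<longlonglongrightarrow> pi / 2 - - (pi / 2)" by (rule tendsto_diff)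
        thus ?thesis using True by simp
      next
        case False
        define d where "d = x - t"
        have d: "d > 0" using False by (simp add: d_def)
        have "filterlim (\<lambda>n. (- d + 1 / real (Suc n)) / (1 / (real (Suc n))\<^sup>2)) at_bot sequentially"
          using d by real_asymp
        hence "filterlim (\<lambda>n. (t + 1 / real (Suc n) - x) / (1 / (real (Suc n))\<^sup>2)) at_bot sequentially"
          by (simp add: d_def algebra_simps)
        from filterlim_compose[OF tendsto_arctan_at_bot this] lo'
        have "(\<lambda>n. ?f n x) \<longlonglongrightarrow> - (pi / 2) - - (pi / 2)" by (rule tendsto_diff)
        thus ?thesis using False by simp
      qed
    qed
  qed auto
  thus ?thesis by (simp add: cdf_def)
qed

end

lemma stieltjes_unique:
  assumes \<mu>: "real_distribution \<mu>" and \<nu>: "real_distribution \<nu>"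
    and eq: "\<And>z. Im z > 0 \<Longrightarrow> stieltjes_transform \<mu> z = stieltjes_transform \<nu> z"
  shows "\<mu> = \<nu>"
proof (rule cdf_unique[OF \<mu> \<nu>], rule ext)
  fix t :: real
  interpret m: real_distribution \<mu> by fact
  interpret n: real_distribution \<nu> by fact
  have nn: "0 \<le> (LINT x|\<rho>. arctan ((b - x) / v) - arctan ((a - x) / v))" if "a \<le> b" "v > 0" for a b v and \<rho> :: "real measure"
    using that by (intro Bochner_Integration.integral_nonneg) (auto intro!: arctan_monotone' divide_right_mono)
  have *: "(LINT x|\<mu>. arctan ((b - x) / v) - arctan ((a - x) / v)) = (LINT x|\<nu>. arctan ((b - x) / v) - arctan ((a - x) / v))"
    if "a \<le> b" "v > 0" for a b v
  proof -
    have "ennreal (LINT x|\<mu>. arctan ((b - x) / v) - arctan ((a - x) / v)) = ennreal (LINT x|\<nu>. arctan ((b - x) / v) - arctan ((a - x) / v))"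
      unfolding m.nn_integral_Im_stieltjes[OF that(2,1), symmetric] n.nn_integral_Im_stieltjes[OF that(2,1), symmetric]
      using eq that by simp
    thus ?thesis using nn[OF that] by simp
  qed
  \<comment> \<open>Makes the left end point at most the right one, as the arctangent formula
    requires.\<close>
  define N where "N = nat \<lceil>\<bar>t\<bar>\<rceil>"
  let ?f = "\<lambda>\<rho> n. LINT x|\<rho>. arctan ((t + 1 / real (Suc n) - x) / (1 / (real (Suc n))\<^sup>2))
      - arctan ((- real (Suc n) - x) / (1 / (real (Suc n))\<^sup>2))"
  have "?f \<mu> n = ?f \<nu> n" if "n \<ge> N" for n
  proof (rule *)
    have "\<bar>t\<bar> \<le> real n" using that unfolding N_def by linarith
    moreover have "0 \<le> 1 / real (Suc n)" by simp
    ultimately show "- real (Suc n) \<le> t + 1 / real (Suc n)" by linarith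
  qed simp
  hence "eventually (\<lambda>n. ?f \<mu> n = ?f \<nu> n) sequentially" by (auto simp: eventually_sequentially)
  from Lim_transform_eventually[OF m.stieltjes_inversion this]
  have "pi * cdf \<mu> t = pi * cdf \<nu> t" by (rule LIMSEQ_unique) (rule n.stieltjes_inversion)
  thus "cdf \<mu> t = cdf \<nu> t" by simp
qed

section \<open>Uniqueness and convergence of distributions\<close>

lemma upper_half_plane_connected: "connected {z. Im z > 0}" and upper_half_plane_open: "open {z. Im z > 0}"
  by (simp_all add: convex_connected convex_halfspace_Im_gt open_halfspace_Im_gt)

lemma stieltjes_unique_limpt:
  assumes \<mu>: "real_distribution \<mu>" and \<nu>: "real_distribution \<nu>"
    and D: "D \<subseteq> {z. Im z > 0}" "\<xi> islimpt D" "Im \<xi> > 0"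
    and eq: "\<And>z. z \<in> D \<Longrightarrow> stieltjes_transform \<mu> z = stieltjes_transform \<nu> z"
  shows "\<mu> = \<nu>"
proof (rule stieltjes_unique[OF \<mu> \<nu>])
  fix z :: complex assume z: "Im z > 0"
  have "stieltjes_transform \<mu> z - stieltjes_transform \<nu> z = 0"
  proof (rule analytic_continuation[of "\<lambda>z. stieltjes_transform \<mu> z - stieltjes_transform \<nu> z" "{z. Im z > 0}" D \<xi>])
    show "(\<lambda>z. stieltjes_transform \<mu> z - stieltjes_transform \<nu> z) holomorphic_on {z. Im z > 0}"
      by (intro holomorphic_on_diff real_distribution.stieltjes_holomorphic \<mu> \<nu>)
  qed (use D z eq upper_half_plane_connected upper_half_plane_open in auto)
  thus "stieltjes_transform \<mu> z = stieltjes_transform \<nu> z" by simp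
qed

lemma weak_conv_stieltjes:
  assumes "\<And>n. real_distribution (\<mu> n)" "real_distribution \<nu>" "weak_conv_m \<mu> \<nu>" "Im z > 0"
  shows "(\<lambda>n. stieltjes_transform (\<mu> n) z) \<longlonglongrightarrow> stieltjes_transform \<nu> z"
  unfolding stieltjes_transform_def
  by (rule weak_conv_imp_integral_bdd_continuous_conv[OF assms(1-3), where B = "1 / Im z"])
     (use assms(4) resolvent_denominator(3) isCont_resolvent in auto)

text \<open>\<open>\<psi>\<close> is not known in advance to be a Stieltjes transform. The
  hypothesis \<open>mass\<close> rules out that mass escapes to infinity and gives tightness through
  \<open>tail_bound\<close>; a subsequential limit then exists, and all such limits have the
  transform \<open>\<psi>\<close> on \<open>D\<close>, hence coincide.\<close>

lemma stieltjes_convergence: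
  assumes \<mu>: "\<And>n. real_distribution (\<mu> n)"
    and D: "D \<subseteq> {z. Im z > 0}" "\<xi> islimpt D" "Im \<xi> > 0"
    and conv: "\<And>z. z \<in> D \<Longrightarrow> (\<lambda>n. stieltjes_transform (\<mu> n) z) \<longlonglongrightarrow> \<psi> z"
    and mass: "\<And>\<epsilon>. \<epsilon> > 0 \<Longrightarrow> \<exists>y>0. Complex 0 y \<in> D \<and> 1 - y * Im (\<psi> (Complex 0 y)) < \<epsilon>"
  shows "\<exists>\<nu>. real_distribution \<nu> \<and> weak_conv_m \<mu> \<nu> \<and> (\<forall>z\<in>D. stieltjes_transform \<nu> z = \<psi> z)"
proof -
  have tight: "tight \<mu>"
    unfolding tight_def
  proof (intro conjI allI impI \<mu>)
    fix \<epsilon> :: real assume \<epsilon>: "\<epsilon> > 0"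
    obtain y where y: "y > 0" "Complex 0 y \<in> D" "1 - y * Im (\<psi> (Complex 0 y)) < \<epsilon> / 2"
      using mass[of "\<epsilon> / 2"] \<epsilon> by auto
    have "(\<lambda>n. 1 - y * Im (stieltjes_transform (\<mu> n) (Complex 0 y))) \<longlonglongrightarrow> 1 - y * Im (\<psi> (Complex 0 y))"
      by (intro tendsto_intros conv y)
    from order_tendstoD(2)[OF this y(3)] obtain n0 where
      n0: "\<And>n. n \<ge> n0 \<Longrightarrow> 1 - y * Im (stieltjes_transform (\<mu> n) (Complex 0 y)) < \<epsilon> / 2"
      by (auto simp: eventually_sequentially)
    \<comment> \<open>The finitely many distributions before \<open>n0\<close> are not covered by
      the limit; each gets its own height from the asymptotics of its transform, and the interval is
      enlarged to the maximum.\<close>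
    have "\<exists>w>0. 1 - w * Im (stieltjes_transform (\<mu> n) (Complex 0 w)) < \<epsilon> / 2" for n
    proof -
      interpret real_distribution "\<mu> n" by (rule \<mu>)
      have "(\<lambda>k. Complex 0 (real k) * stieltjes_transform (\<mu> n) (Complex 0 (real k))) \<longlonglongrightarrow> - 1"
        using stieltjes_asymptotics[of "\<lambda>_. 0" 0] by simp
      from tendsto_Re[OF this]
      have "(\<lambda>k. 1 - real k * Im (stieltjes_transform (\<mu> n) (Complex 0 (real k)))) \<longlonglongrightarrow> 1 - 1"
        by (intro tendsto_diff tendsto_const) (auto dest: tendsto_minus)
      hence "eventually (\<lambda>k. 1 - real k * Im (stieltjes_transform (\<mu> n) (Complex 0 (real k))) < \<epsilon> / 2) sequentially"
        using \<epsilon> by (intro order_tendstoD(2)) auto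
      hence "eventually (\<lambda>k. k > 0 \<and> 1 - real k * Im (stieltjes_transform (\<mu> n) (Complex 0 (real k))) < \<epsilon> / 2) sequentially"
        using eventually_gt_at_top[of 0] by eventually_elim auto
      then obtain k where "k > 0" "1 - real k * Im (stieltjes_transform (\<mu> n) (Complex 0 (real k))) < \<epsilon> / 2"
        by (auto simp: eventually_sequentially)
      thus ?thesis by (intro exI[of _ "real k"]) auto
    qed
    then obtain w where w: "\<And>n. w n > 0" "\<And>n. 1 - w n * Im (stieltjes_transform (\<mu> n) (Complex 0 (w n))) < \<epsilon> / 2"
      by metis
    define b where "b = Max (insert y (w ` {..<n0}))"
    have bb: "y \<le> b" "\<And>n. n < n0 \<Longrightarrow> w n \<le> b" by (auto simp: b_def)
    have "measure (\<mu> n) {-b<..b} > 1 - \<epsilon>" for n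
    proof -
      interpret real_distribution "\<mu> n" by (rule \<mu>)
      obtain t where t: "t > 0" "t \<le> b" "1 - t * Im (stieltjes_transform (\<mu> n) (Complex 0 t)) < \<epsilon> / 2"
        using n0[of n] bb(1) bb(2)[of n] w[of n] y(1) by (cases "n < n0") auto
      have "1 - \<epsilon> < measure (\<mu> n) {-t<..t}" using tail_bound[OF t(1)] t(3) by argo
      also have "\<dots> \<le> measure (\<mu> n) {-b<..b}" using t by (intro finite_measure_mono) auto
      finally show ?thesis .
    qed
    moreover have "- b < b" using bb(1) y(1) by linarith
    ultimately show "\<exists>a b. a < b \<and> (\<forall>n. 1 - \<epsilon> < measure (\<mu> n) {a<..b})" by blast
  qed
  have lim: "stieltjes_transform \<nu> z = \<psi> z"
    if "strict_mono s" "real_distribution \<nu>" "weak_conv_m (\<mu> \<circ> s) \<nu>" "z \<in> D" for s \<nu> z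
  proof (rule LIMSEQ_unique)
    show "(\<lambda>n. stieltjes_transform ((\<mu> \<circ> s) n) z) \<longlonglongrightarrow> stieltjes_transform \<nu> z"
      using that \<mu> D by (intro weak_conv_stieltjes[of "\<mu> \<circ> s"]) auto
    show "(\<lambda>n. stieltjes_transform ((\<mu> \<circ> s) n) z) \<longlonglongrightarrow> \<psi> z"
      using LIMSEQ_subseq_LIMSEQ[OF conv[OF that(4)] that(1)] by (simp add: comp_def)
  qed
  obtain r \<nu> where r: "strict_mono (r :: nat \<Rightarrow> nat)" "real_distribution \<nu>" "weak_conv_m (\<mu> \<circ> id \<circ> r) \<nu>"
    using tight_imp_convergent_subsubsequence[OF tight strict_mono_id] by (auto simp: id_def)
  have \<nu>: "stieltjes_transform \<nu> z = \<psi> z" if "z \<in> D" for z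
    using lim[OF r(1,2) _ that] r(3) by simp
  have "weak_conv_m \<mu> \<nu>"
  proof (rule tight_subseq_weak_converge[OF \<mu> r(2) tight])
    fix s \<rho> assume s: "strict_mono s" "real_distribution \<rho>" "weak_conv_m (\<mu> \<circ> s) \<rho>"
    have "\<rho> = \<nu>" using lim[OF s] \<nu> by (intro stieltjes_unique_limpt[OF s(2) r(2) D]) auto
    thus "weak_conv_m (\<mu> \<circ> s) \<nu>" using s(3) by simp
  qed
  thus ?thesis using r(2) \<nu> by blast
qed

section \<open>Random resolvents\<close>

lemma mat_borel_carrier: "X \<in> measurable M (mat_borel p q) \<Longrightarrow> \<omega> \<in> space M \<Longrightarrow> X \<omega> \<in> carrier_mat p q"
  unfolding measurable_mat_borel_iff by auto

lemma mat_borel_entry: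
  "X \<in> measurable M (mat_borel p q) \<Longrightarrow> i < p \<Longrightarrow> j < q \<Longrightarrow> (\<lambda>\<omega>. X \<omega> $$ (i, j)) \<in> borel_measurable M"
  unfolding measurable_mat_borel_iff by auto

lemma mat_borelI:
  assumes "\<And>\<omega>. \<omega> \<in> space M \<Longrightarrow> X \<omega> \<in> carrier_mat p q"
    and "\<And>i j. i < p \<Longrightarrow> j < q \<Longrightarrow> (\<lambda>\<omega>. X \<omega> $$ (i, j)) \<in> borel_measurable M"
  shows "X \<in> measurable M (mat_borel p q)"
  unfolding measurable_mat_borel_iff using assms by auto

lemma mat_borel_mat:
  assumes "\<And>i j. i < p \<Longrightarrow> j < q \<Longrightarrow> (\<lambda>\<omega>. f \<omega> (i, j)) \<in> borel_measurable M"
  shows "(\<lambda>\<omega>. mat p q (f \<omega>)) \<in> measurable M (mat_borel p q)"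
  using assms by (intro mat_borelI) auto

lemma mat_borel_const: "X \<in> carrier_mat p q \<Longrightarrow> (\<lambda>_. X) \<in> measurable M (mat_borel p q)"
  by (intro mat_borelI) auto

text \<open>By the Leibniz formula the determinant is a polynomial in the entries.\<close>

lemma mat_borel_det:
  assumes X: "X \<in> measurable M (mat_borel n n)"
  shows "(\<lambda>\<omega>. Determinant.det (X \<omega>)) \<in> borel_measurable M"
proof -
  have "(\<lambda>\<omega>. \<Sum>p \<in> {p. p permutes {0..<n}}. signof p * (\<Prod>i = 0..<n. X \<omega> $$ (i, p i))) \<in> borel_measurable M"
    by (intro borel_measurable_sum borel_measurable_times borel_measurable_const borel_measurable_prod mat_borel_entry[OF X])
       (auto dest: permutes_in_image)
  thus ?thesis
    by (subst measurable_cong[OF det_def'[OF mat_borel_carrier[OF X]]])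
qed

lemma mat_borel_adj_mat:
  assumes X: "X \<in> measurable M (mat_borel n n)"
  shows "(\<lambda>\<omega>. adj_mat (X \<omega>)) \<in> measurable M (mat_borel n n)"
proof (rule mat_borelI)
  note c = mat_borel_carrier[OF X]
  show "adj_mat (X \<omega>) \<in> carrier_mat n n" if "\<omega> \<in> space M" for \<omega>
    by (rule adj_mat(1)[OF c[OF that]])
  fix i j assume ij: "i < n" "j < n"
  have m: "(\<lambda>\<omega>. mat_delete (X \<omega>) j i) \<in> measurable M (mat_borel (n - 1) (n - 1))"
  proof (rule mat_borelI)
    show "mat_delete (X \<omega>) j i \<in> carrier_mat (n - 1) (n - 1)" if "\<omega> \<in> space M" for \<omega>
      using c[OF that] by (simp add: mat_delete_def)
    fix k l assume kl: "k < n - 1" "l < n - 1"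
    have "(\<lambda>\<omega>. X \<omega> $$ (if k < j then k else Suc k, if l < i then l else Suc l)) \<in> borel_measurable M"
      using kl by (intro mat_borel_entry[OF X]) auto
    moreover have "mat_delete (X \<omega>) j i $$ (k, l) = X \<omega> $$ (if k < j then k else Suc k, if l < i then l else Suc l)"
      if "\<omega> \<in> space M" for \<omega>
      using c[OF that] kl by (simp add: mat_delete_def)
    ultimately show "(\<lambda>\<omega>. mat_delete (X \<omega>) j i $$ (k, l)) \<in> borel_measurable M"
      by (subst measurable_cong) auto
  qed
  have "(\<lambda>\<omega>. (- 1) ^ (j + i) * Determinant.det (mat_delete (X \<omega>) j i)) \<in> borel_measurable M"
    by (intro borel_measurable_times borel_measurable_const mat_borel_det[OF m])
  moreover have "adj_mat (X \<omega>) $$ (i, j) = (- 1) ^ (j + i) * Determinant.det (mat_delete (X \<omega>) j i)"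
    if "\<omega> \<in> space M" for \<omega>
    using c[OF that] ij by (simp add: adj_mat_def cofactor_def)
  ultimately show "(\<lambda>\<omega>. adj_mat (X \<omega>) $$ (i, j)) \<in> borel_measurable M"
    by (subst measurable_cong) auto
qed

lemma mat_borel_resolvent:
  assumes X: "X \<in> measurable M (mat_borel n n)"
  shows "(\<lambda>\<omega>. resolvent (X \<omega>) z) \<in> measurable M (mat_borel n n)"
proof -
  note c = mat_borel_carrier[OF X]
  have m: "(\<lambda>\<omega>. X \<omega> - z \<cdot>\<^sub>m 1\<^sub>m n) \<in> measurable M (mat_borel n n)"
  proof (rule mat_borelI)
    fix i j assume ij: "i < n" "j < n"
    have "(\<lambda>\<omega>. X \<omega> $$ (i, j) - (z \<cdot>\<^sub>m 1\<^sub>m n) $$ (i, j)) \<in> borel_measurable M"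
      using ij by (intro borel_measurable_diff mat_borel_entry[OF X] borel_measurable_const)
    thus "(\<lambda>\<omega>. (X \<omega> - z \<cdot>\<^sub>m 1\<^sub>m n) $$ (i, j)) \<in> borel_measurable M"
      using ij by (subst measurable_cong) auto
  qed auto
  note ma = mat_borel_adj_mat[OF m]
  show ?thesis
  proof (rule mat_borelI)
    fix i j assume ij: "i < n" "j < n"
    have "(\<lambda>\<omega>. (1 / Determinant.det (X \<omega> - z \<cdot>\<^sub>m 1\<^sub>m n)) * adj_mat (X \<omega> - z \<cdot>\<^sub>m 1\<^sub>m n) $$ (i, j)) \<in> borel_measurable M"
      using ij by (intro borel_measurable_times borel_measurable_divide borel_measurable_const mat_borel_det[OF m] mat_borel_entry[OF ma])
    moreover have "resolvent (X \<omega>) z $$ (i, j) = (1 / Determinant.det (X \<omega> - z \<cdot>\<^sub>m 1\<^sub>m n)) * adj_mat (X \<omega> - z \<cdot>\<^sub>m 1\<^sub>m n) $$ (i, j)"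
      if "\<omega> \<in> space M" for \<omega>
      using c[OF that] mat_borel_carrier[OF ma that] ij by (simp add: resolvent_def)
    ultimately show "(\<lambda>\<omega>. resolvent (X \<omega>) z $$ (i, j)) \<in> borel_measurable M"
      by (subst measurable_cong) auto
  qed (use c in auto)
qed

lemma mat_borel_mult:
  assumes X: "X \<in> measurable M (mat_borel p k)" and Y: "Y \<in> measurable M (mat_borel k q)"
  shows "(\<lambda>\<omega>. X \<omega> * Y \<omega>) \<in> measurable M (mat_borel p q)"
proof (rule mat_borelI)
  note c = mat_borel_carrier[OF X] mat_borel_carrier[OF Y]
  show "X \<omega> * Y \<omega> \<in> carrier_mat p q" if "\<omega> \<in> space M" for \<omega> using c[OF that] by auto
  fix i j assume ij: "i < p" "j < q"
  have "(\<lambda>\<omega>. \<Sum>a<k. X \<omega> $$ (i, a) * Y \<omega> $$ (a, j)) \<in> borel_measurable M"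
    using ij by (intro borel_measurable_sum borel_measurable_times mat_borel_entry[OF X] mat_borel_entry[OF Y]) auto
  thus "(\<lambda>\<omega>. (X \<omega> * Y \<omega>) $$ (i, j)) \<in> borel_measurable M"
    using mult_mat_entry[OF c ij] by (subst measurable_cong) auto
qed

lemma mat_borel_add_covar:
  assumes A: "A \<in> measurable M (mat_borel n n)" and G: "G \<in> measurable M (mat_borel L n)"
    and \<tau>: "\<And>i. i < L \<Longrightarrow> (\<lambda>\<omega>. \<tau> \<omega> i) \<in> borel_measurable M"
  shows "(\<lambda>\<omega>. A \<omega> + covar n L (\<tau> \<omega>) (G \<omega>)) \<in> measurable M (mat_borel n n)"
proof (rule mat_borelI)
  note c = mat_borel_carrier[OF A]
  show "A \<omega> + covar n L (\<tau> \<omega>) (G \<omega>) \<in> carrier_mat n n" if "\<omega> \<in> space M" for \<omega> using c[OF that] by auto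
  have \<tau>c: "(\<lambda>\<omega>. complex_of_real (\<tau> \<omega> i)) \<in> borel_measurable M" if "i < L" for i
    by (rule borel_measurable_continuous_on[of complex_of_real]) (auto intro!: continuous_intros \<tau>[OF that])
  fix a b assume ab: "a < n" "b < n"
  have "(\<lambda>\<omega>. A \<omega> $$ (a, b) + (\<Sum>i<L. of_real (\<tau> \<omega> i) * (cnj (G \<omega> $$ (i, a)) * G \<omega> $$ (i, b)))) \<in> borel_measurable M"
    using ab by (intro borel_measurable_add borel_measurable_sum borel_measurable_times borel_measurable_cnj
       mat_borel_entry[OF A] mat_borel_entry[OF G] \<tau>c) auto
  thus "(\<lambda>\<omega>. (A \<omega> + covar n L (\<tau> \<omega>) (G \<omega>)) $$ (a, b)) \<in> borel_measurable M"
    using c ab by (subst measurable_cong) (auto simp: covar_def)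
qed

text \<open>For fixed \<open>X\<close> the number \<open>mtrace X / n\<close> is the mean of the
  form when the entries of \<open>f\<close> are independent and centred with variance
  \<open>1 / n\<close>, as in a row of \<open>G\<close>.\<close>

definition qdev :: "nat \<Rightarrow> complex mat \<Rightarrow> (nat \<Rightarrow> complex) \<Rightarrow> real" where
  "qdev n X f = cmod (qform n X f - mtrace X / of_nat n)"

lemma borel_measurable_qdev:
  assumes X: "X \<in> measurable M (mat_borel n n)" and f: "\<And>b. b < n \<Longrightarrow> (\<lambda>\<omega>. f \<omega> b) \<in> borel_measurable M"
  shows "(\<lambda>\<omega>. qdev n (X \<omega>) (f \<omega>)) \<in> borel_measurable M"
proof -
  have [measurable]: "(\<lambda>\<omega>. (\<Sum>a<n. \<Sum>b<n. f \<omega> a * X \<omega> $$ (a, b) * cnj (f \<omega> b)) - (\<Sum>i<n. X \<omega> $$ (i, i)) / of_nat n) \<in> borel_measurable M"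
    by (intro borel_measurable_diff borel_measurable_sum borel_measurable_times borel_measurable_cnj
      borel_measurable_divide borel_measurable_const mat_borel_entry[OF X] f) auto
  have "(\<lambda>\<omega>. cmod ((\<Sum>a<n. \<Sum>b<n. f \<omega> a * X \<omega> $$ (a, b) * cnj (f \<omega> b)) - (\<Sum>i<n. X \<omega> $$ (i, i)) / of_nat n)) \<in> borel_measurable M"
    by measurable
  moreover have "qdev n (X \<omega>) (f \<omega>) = cmod ((\<Sum>a<n. \<Sum>b<n. f \<omega> a * X \<omega> $$ (a, b) * cnj (f \<omega> b)) - (\<Sum>i<n. X \<omega> $$ (i, i)) / of_nat n)"
    if "\<omega> \<in> space M" for \<omega>
    using carrier_matD(1)[OF mat_borel_carrier[OF X that]] by (simp add: qdev_def qform_def mtrace_def)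
  ultimately show ?thesis by (subst measurable_cong) auto
qed

section \<open>Expected deviations of quadratic forms\<close>

context prob_space
begin

text \<open>The joint law of independent \<open>P\<close> and \<open>R\<close> is a product, so a
  bound valid for every frozen value of \<open>P\<close> survives integration over
  \<open>P\<close>.\<close>

lemma nn_integral_indep_bound:
  assumes ind: "indep_var S P T R" and F: "F \<in> borel_measurable (S \<Otimes>\<^sub>M T)"
    and le: "\<And>\<omega>\<^sub>1. \<omega>\<^sub>1 \<in> space M \<Longrightarrow> (\<integral>\<^sup>+\<omega>. F (P \<omega>\<^sub>1, R \<omega>) \<partial>M) \<le> c"
  shows "(\<integral>\<^sup>+\<omega>. F (P \<omega>, R \<omega>) \<partial>M) \<le> c"
proof -
  have P: "P \<in> measurable M S" and R: "R \<in> measurable M T"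
    and eq: "distr M S P \<Otimes>\<^sub>M distr M T R = distr M (S \<Otimes>\<^sub>M T) (\<lambda>x. (P x, R x))"
    using ind unfolding indep_var_distribution_eq by auto
  interpret R: prob_space "distr M T R" by (rule prob_space_distr[OF R])
  have F': "F \<in> borel_measurable (distr M S P \<Otimes>\<^sub>M distr M T R)"
    using F by (simp cong: measurable_cong_sets)
  have Fx: "(\<lambda>y. F (x, y)) \<in> borel_measurable T" if "x \<in> space S" for x
    using F that by measurable
  have meas: "(\<lambda>x. \<integral>\<^sup>+y. F (x, y) \<partial>distr M T R) \<in> borel_measurable S"
    using R.borel_measurable_nn_integral_fst[OF F'] by simp
  have "(\<integral>\<^sup>+\<omega>. F (P \<omega>, R \<omega>) \<partial>M) = (\<integral>\<^sup>+x. F x \<partial>distr M (S \<Otimes>\<^sub>M T) (\<lambda>x. (P x, R x)))"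
    using F P R by (subst nn_integral_distr) auto
  also have "\<dots> = (\<integral>\<^sup>+x. \<integral>\<^sup>+y. F (x, y) \<partial>distr M T R \<partial>distr M S P)"
    unfolding eq[symmetric] by (rule R.nn_integral_fst[OF F', symmetric])
  also have "\<dots> = (\<integral>\<^sup>+\<omega>\<^sub>1. \<integral>\<^sup>+y. F (P \<omega>\<^sub>1, y) \<partial>distr M T R \<partial>M)"
    by (rule nn_integral_distr[OF P]) (use meas in simp)
  also have "\<dots> \<le> (\<integral>\<^sup>+\<omega>\<^sub>1. c \<partial>M)"
  proof (rule nn_integral_mono)
    fix \<omega>\<^sub>1 assume \<omega>: "\<omega>\<^sub>1 \<in> space M"
    have "(\<integral>\<^sup>+y. F (P \<omega>\<^sub>1, y) \<partial>distr M T R) = (\<integral>\<^sup>+\<omega>. F (P \<omega>\<^sub>1, R \<omega>) \<partial>M)"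
      by (rule nn_integral_distr[OF R]) (use Fx[OF measurable_space[OF P \<omega>]] in simp)
    thus "(\<integral>\<^sup>+y. F (P \<omega>\<^sub>1, y) \<partial>distr M T R) \<le> c" using le[OF \<omega>] by simp
  qed
  also have "\<dots> = c" by (simp add: emeasure_space_1)
  finally show ?thesis .
qed

text \<open>What the fourth moment estimate asks of an entry: the first half concerns
  \<open>Y\<close> itself, the second the centred square \<open>|Y|^2 - 1\<close>, which occurs on
  the diagonal of the form.\<close>

definition moment_bound :: "real \<Rightarrow> ('a \<Rightarrow> complex) \<Rightarrow> bool" where
  "moment_bound \<kappa> Y \<longleftrightarrow> integrable M Y \<and> (LINT \<omega>|M. Y \<omega>) = 0
    \<and> integrable M (\<lambda>\<omega>. cmod (Y \<omega>) ^ 4) \<and> (LINT \<omega>|M. cmod (Y \<omega>) ^ 4) \<le> \<kappa>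
    \<and> integrable M (\<lambda>\<omega>. complex_of_real ((cmod (Y \<omega>))\<^sup>2) - 1) \<and> (LINT \<omega>|M. complex_of_real ((cmod (Y \<omega>))\<^sup>2) - 1) = 0
    \<and> integrable M (\<lambda>\<omega>. cmod (complex_of_real ((cmod (Y \<omega>))\<^sup>2) - 1) ^ 4)
    \<and> (LINT \<omega>|M. cmod (complex_of_real ((cmod (Y \<omega>))\<^sup>2) - 1) ^ 4) \<le> \<kappa>"

text \<open>The squared Frobenius norm of \<open>X\<close> is at most \<open>n\<close>, so the
  unnormalized form has a fourth moment of order \<open>n^2\<close>; the scaling of both arguments
  by \<open>1 / sqrt n\<close> divides this by \<open>n^4\<close>.\<close>

lemma qdev_fixed_bound:
  assumes ind: "indep_vars (\<lambda>_. borel) Y ({i :: nat} \<times> {..<n :: nat})" and \<kappa>: "\<kappa> \<ge> 0" and n: "n > 0"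
    and Y: "\<And>b. b < n \<Longrightarrow> moment_bound \<kappa> (Y (i, b))"
    and X: "X \<in> carrier_mat n n" "opbound n X 1"
  shows "(\<integral>\<^sup>+\<omega>. ennreal (qdev n X (\<lambda>b. complex_of_real (1 / sqrt (real n)) * Y (i, b) \<omega>) ^ 4) \<partial>M)
    \<le> ennreal ((4 * sqrt (27 * \<kappa> * (1 + 16 * \<kappa>)))\<^sup>2 / (real n)\<^sup>2)"
proof -
  define W where "W \<omega> = (\<Sum>a<n. \<Sum>b<n. Y (i, a) \<omega> * X $$ (a, b) * cnj (Y (i, b) \<omega>)) - (\<Sum>a<n. X $$ (a, a))" for \<omega>
  define F where "F = (\<Sum>a<n. \<Sum>b<n. (cmod (X $$ (a, b)))\<^sup>2)"
  let ?C = "4 * sqrt (27 * \<kappa> * (1 + 16 * \<kappa>))"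
  have F: "0 \<le> F" "F \<le> real n" using frobenius_bound[OF X(2)] by (auto simp: F_def sum_nonneg)
  have W: "integrable M (\<lambda>\<omega>. cmod (W \<omega>) ^ 4)" "(LINT \<omega>|M. cmod (W \<omega>) ^ 4) \<le> (?C * F)\<^sup>2"
    using quadratic_moment4[OF ind \<kappa>, of n "\<lambda>a b. X $$ (a, b)"] Y
    unfolding moment_bound_def W_def F_def by auto
  have q: "qdev n X (\<lambda>b. complex_of_real (1 / sqrt (real n)) * Y (i, b) \<omega>) = cmod (W \<omega>) / real n" for \<omega>
  proof -
    have s: "complex_of_real (1 / sqrt (real n)) * complex_of_real (1 / sqrt (real n)) = 1 / of_nat n"
      unfolding of_real_mult[symmetric] by (simp add: field_simps)
    have "qform n X (\<lambda>b. complex_of_real (1 / sqrt (real n)) * Y (i, b) \<omega>) =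
        (\<Sum>a<n. \<Sum>b<n. (complex_of_real (1 / sqrt (real n)) * complex_of_real (1 / sqrt (real n))) * (Y (i, a) \<omega> * X $$ (a, b) * cnj (Y (i, b) \<omega>)))"
      unfolding qform_def by (intro sum.cong refl) (simp add: mult_ac)
    also have "\<dots> = (\<Sum>a<n. \<Sum>b<n. Y (i, a) \<omega> * X $$ (a, b) * cnj (Y (i, b) \<omega>)) / of_nat n"
      unfolding s sum_distrib_left[symmetric] by simp
    finally have "qform n X (\<lambda>b. complex_of_real (1 / sqrt (real n)) * Y (i, b) \<omega>) - mtrace X / of_nat n = W \<omega> / of_nat n"
      using X(1) by (simp add: W_def mtrace_def diff_divide_distrib)
    thus ?thesis by (simp add: qdev_def norm_divide)
  qed
  have "(\<integral>\<^sup>+\<omega>. ennreal ((cmod (W \<omega>) / real n) ^ 4) \<partial>M) = ennreal (LINT \<omega>|M. (cmod (W \<omega>) / real n) ^ 4)"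
    using W(1) by (intro nn_integral_eq_integral) (auto simp: power_divide)
  also have "(LINT \<omega>|M. (cmod (W \<omega>) / real n) ^ 4) = (LINT \<omega>|M. cmod (W \<omega>) ^ 4) / real n ^ 4"
    by (simp add: power_divide)
  also have "\<dots> \<le> (?C * real n)\<^sup>2 / real n ^ 4"
  proof (rule divide_right_mono)
    have "(?C * F)\<^sup>2 \<le> (?C * real n)\<^sup>2" using F \<kappa> by (intro power_mono mult_left_mono mult_nonneg_nonneg) auto
    thus "(LINT \<omega>|M. cmod (W \<omega>) ^ 4) \<le> (?C * real n)\<^sup>2" using W(2) by linarith
  qed simp
  also have "(?C * real n)\<^sup>2 / real n ^ 4 = ?C\<^sup>2 / (real n)\<^sup>2"
    unfolding power_mult_distrib[of ?C "real n"] using n by (simp add: power2_eq_square eval_nat_numeral)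
  finally show ?thesis unfolding q by (simp add: ennreal_leI)
qed

text \<open>\<open>X\<close> is a function of the rows other than \<open>i\<close>. Once these are
  frozen it is a fixed matrix, and the bound does not depend on which one.\<close>

lemma qdev_row_bound:
  assumes ind: "indep_vars (\<lambda>_. borel) Y ({..<L :: nat} \<times> {..<n :: nat})" and \<kappa>: "\<kappa> \<ge> 0" and n: "n > 0"
    and Y: "\<And>b. b < n \<Longrightarrow> moment_bound \<kappa> (Y (i, b))" and i: "i < L"
  defines "J \<equiv> ({..<L} - {i}) \<times> {..<n}"
  assumes X: "X \<in> measurable (PiM J (\<lambda>_. borel)) (mat_borel n n)" "\<And>h. opbound n (X h) 1"
  shows "(\<integral>\<^sup>+\<omega>. ennreal (qdev n (X (restrict (\<lambda>j. Y j \<omega>) J)) (\<lambda>b. complex_of_real (1 / sqrt (real n)) * Y (i, b) \<omega>) ^ 4) \<partial>M)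
    \<le> ennreal ((4 * sqrt (27 * \<kappa> * (1 + 16 * \<kappa>)))\<^sup>2 / (real n)\<^sup>2)"
proof -
  let ?I = "{i} \<times> {..<n}"
  define F where "F = (\<lambda>(h, k). ennreal (qdev n (X h) (\<lambda>b. complex_of_real (1 / sqrt (real n)) * k (i, b)) ^ 4))"
  have iv: "indep_var (PiM J (\<lambda>_. borel)) (\<lambda>\<omega>. restrict (\<lambda>j. Y j \<omega>) J) (PiM ?I (\<lambda>_. borel)) (\<lambda>\<omega>. restrict (\<lambda>j. Y j \<omega>) ?I)"
    using i by (intro indep_var_restrict[OF ind]) (auto simp: J_def)
  have P: "(\<lambda>\<omega>. restrict (\<lambda>j. Y j \<omega>) J) \<in> measurable M (PiM J (\<lambda>_. borel))" using iv unfolding indep_var_distribution_eq by simp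
  have mF: "F \<in> borel_measurable (PiM J (\<lambda>_. borel) \<Otimes>\<^sub>M PiM ?I (\<lambda>_. borel))"
  proof -
    have "(\<lambda>p. qdev n (X (fst p)) (\<lambda>b. complex_of_real (1 / sqrt (real n)) * snd p (i, b))) \<in> borel_measurable (PiM J (\<lambda>_. borel) \<Otimes>\<^sub>M PiM ?I (\<lambda>_. borel))"
    proof (rule borel_measurable_qdev)
      show "(\<lambda>p. X (fst p)) \<in> measurable (PiM J (\<lambda>_. borel) \<Otimes>\<^sub>M PiM ?I (\<lambda>_. borel)) (mat_borel n n)"
        by (rule measurable_compose[OF measurable_fst X(1)])
      fix b assume "b < n"
      hence "(\<lambda>k. k (i, b)) \<in> borel_measurable (PiM ?I (\<lambda>_. borel :: complex measure))"
        by (intro measurable_component_singleton) simp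
      from measurable_compose[OF measurable_snd this]
      show "(\<lambda>p. complex_of_real (1 / sqrt (real n)) * snd p (i, b)) \<in> borel_measurable (PiM J (\<lambda>_. borel :: complex measure) \<Otimes>\<^sub>M PiM ?I (\<lambda>_. borel))"
        by (intro borel_measurable_times borel_measurable_const)
    qed
    thus ?thesis unfolding F_def case_prod_beta by measurable
  qed
  have "(\<integral>\<^sup>+\<omega>. F (restrict (\<lambda>j. Y j \<omega>) J, restrict (\<lambda>j. Y j \<omega>) ?I) \<partial>M) \<le> ennreal ((4 * sqrt (27 * \<kappa> * (1 + 16 * \<kappa>)))\<^sup>2 / (real n)\<^sup>2)"
  proof (rule nn_integral_indep_bound[OF iv mF])
    fix \<omega>\<^sub>1 assume \<omega>: "\<omega>\<^sub>1 \<in> space M"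
    let ?h = "restrict (\<lambda>j. Y j \<omega>\<^sub>1) J"
    have c: "X ?h \<in> carrier_mat n n" by (rule mat_borel_carrier[OF X(1) measurable_space[OF P \<omega>]])
    have "F (?h, restrict (\<lambda>j. Y j \<omega>) ?I) = ennreal (qdev n (X ?h) (\<lambda>b. complex_of_real (1 / sqrt (real n)) * Y (i, b) \<omega>) ^ 4)" for \<omega>
      unfolding F_def qdev_def qform_def by simp
    moreover have "indep_vars (\<lambda>_. borel) Y ?I" using i by (intro indep_vars_subset[OF ind]) auto
    ultimately show "(\<integral>\<^sup>+\<omega>. F (?h, restrict (\<lambda>j. Y j \<omega>) ?I) \<partial>M) \<le> ennreal ((4 * sqrt (27 * \<kappa> * (1 + 16 * \<kappa>)))\<^sup>2 / (real n)\<^sup>2)"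
      using qdev_fixed_bound[of Y i n \<kappa> "X ?h"] \<kappa> n Y c X(2) by simp
  qed
  moreover have "F (restrict (\<lambda>j. Y j \<omega>) J, restrict (\<lambda>j. Y j \<omega>) ?I) =
      ennreal (qdev n (X (restrict (\<lambda>j. Y j \<omega>) J)) (\<lambda>b. complex_of_real (1 / sqrt (real n)) * Y (i, b) \<omega>) ^ 4)" for \<omega>
    unfolding F_def qdev_def qform_def by simp
  ultimately show ?thesis by simp
qed

end

definition clip :: "real \<Rightarrow> real \<Rightarrow> real" where
  "clip \<Lambda> x = max (- \<Lambda>) (min \<Lambda> x)"

text \<open>Collects all fluctuations of the comparison: those for the resolvent without row
  \<open>i\<close>, for its product with the resolvent of \<open>A\<close>, and for the identity
  matrix, which measures how far the squared norm of the row is from 1.\<close>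

definition qdev_sum :: "nat \<Rightarrow> nat \<Rightarrow> complex \<Rightarrow> complex \<Rightarrow> complex mat \<Rightarrow> (nat \<Rightarrow> real) \<Rightarrow> complex mat \<Rightarrow> real" where
  "qdev_sum n L z w A \<tau> G = (\<Sum>i<L.
     qdev n (resolvent (A + covar n L (\<tau>(i := 0)) G) z) (\<lambda>b. G $$ (i, b)) ^ 4
   + qdev n (resolvent (A + covar n L (\<tau>(i := 0)) G) z * resolvent A w) (\<lambda>b. G $$ (i, b)) ^ 4
   + qdev n (1\<^sub>m n) (\<lambda>b. G $$ (i, b)) ^ 4)"

lemma qdev_nonneg [simp]: "0 \<le> qdev n X f"
  by (simp add: qdev_def)

lemma qdev_sum_nonneg: "0 \<le> qdev_sum n L z w A \<tau> G"
  unfolding qdev_sum_def by (intro sum_nonneg add_nonneg_nonneg zero_le_power qdev_nonneg)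

lemma borel_measurable_qdev_sum:
  assumes A: "A \<in> measurable M (mat_borel n n)" and G: "G \<in> measurable M (mat_borel L n)"
    and \<tau>: "\<And>i. i < L \<Longrightarrow> (\<lambda>\<omega>. \<tau> \<omega> i) \<in> borel_measurable M"
  shows "(\<lambda>\<omega>. qdev_sum n L z w (A \<omega>) (\<tau> \<omega>) (G \<omega>)) \<in> borel_measurable M"
proof -
  have \<tau>': "(\<lambda>\<omega>. ((\<tau> \<omega>)(i := 0)) j) \<in> borel_measurable M" if "j < L" for i j
    using \<tau>[OF that] by (cases "j = i") auto
  have c: "(\<lambda>_. 1\<^sub>m n) \<in> measurable M (mat_borel n n)" by (intro mat_borel_const) simp
  show ?thesis
    unfolding qdev_sum_def
    by (intro borel_measurable_sum borel_measurable_add borel_measurable_power borel_measurable_qdev mat_borel_mult[where k = n]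
        mat_borel_resolvent mat_borel_add_covar A G \<tau>' c mat_borel_entry[OF G]) auto
qed

lemma (in prob_space) qdev_sum_bound:
  assumes ind: "indep_vars (\<lambda>_. borel) (\<lambda>ij \<omega>. Y \<omega> $$ ij) ({..<L :: nat} \<times> {..<n :: nat})" and \<kappa>: "\<kappa> \<ge> 0" and n: "n > 0"
    and Y: "\<And>i b. i < L \<Longrightarrow> b < n \<Longrightarrow> moment_bound \<kappa> (\<lambda>\<omega>. Y \<omega> $$ (i, b))"
    and Yc: "\<And>\<omega>. \<omega> \<in> space M \<Longrightarrow> Y \<omega> \<in> carrier_mat L n"
    and G: "\<And>\<omega>. \<omega> \<in> space M \<Longrightarrow> G \<omega> = complex_of_real (1 / sqrt (real n)) \<cdot>\<^sub>m Y \<omega>"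
    and A: "hermitian_mat n A" and z: "Im z \<ge> 1" and w: "Im w \<ge> 1"
  shows "(\<integral>\<^sup>+\<omega>. ennreal (qdev_sum n L z w A \<tau> (G \<omega>)) \<partial>M)
    \<le> ennreal (real L * (3 * ((4 * sqrt (27 * \<kappa> * (1 + 16 * \<kappa>)))\<^sup>2 / (real n)\<^sup>2)))"
proof -
  let ?K = "(4 * sqrt (27 * \<kappa> * (1 + 16 * \<kappa>)))\<^sup>2 / (real n)\<^sup>2"
  let ?s = "complex_of_real (1 / sqrt (real n))"
  note AD = hermitian_matD[OF A]
  define J where "J i = ({..<L} - {i}) \<times> {..<n}" for i
  define P where "P i \<omega> = restrict (\<lambda>ij. Y \<omega> $$ ij) (J i)" for i \<omega>
  \<comment> \<open>Rebuilds \<open>G\<close> from the rows other than \<open>i\<close>, with zeros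
    in row \<open>i\<close>. That row has weight 0 in the covariance, so the resolvent is unchanged,
    and \<open>X i\<close> is visibly a function of the other rows alone.\<close>
  define gm where "gm i h = mat L n (\<lambda>(k, b). if k = i then 0 else ?s * h (k, b))" for i and h :: "nat \<times> nat \<Rightarrow> complex"
  define X where "X i h = resolvent (A + covar n L (\<tau>(i := 0)) (gm i h)) z" for i h
  have oX: "opbound n (X i h) 1" for i h
    unfolding X_def using z hermitian_matD(1,2)[OF hermitian_mat_add_covar[OF A]]
    by (intro opbound_mono[OF resolvent_opbound]) auto
  have oR: "opbound n (resolvent A w) 1"
    using w AD by (intro opbound_mono[OF resolvent_opbound]) auto
  have cR: "resolvent A w \<in> carrier_mat n n" using AD by simp
  have cX: "X i h \<in> carrier_mat n n" for i h unfolding X_def using hermitian_matD(1)[OF hermitian_mat_add_covar[OF A]] by simp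
  have mX: "X i \<in> measurable (PiM (J i) (\<lambda>_. borel)) (mat_borel n n)" for i
  proof -
    have "gm i \<in> measurable (PiM (J i) (\<lambda>_. borel)) (mat_borel L n)"
      unfolding gm_def
    proof (rule mat_borel_mat)
      fix k b assume kb: "k < L" "b < n"
      show "(\<lambda>h. case (k, b) of (k, b) \<Rightarrow> if k = i then 0 else ?s * h (k, b)) \<in> borel_measurable (PiM (J i) (\<lambda>_. borel))"
      proof (cases "k = i")
        case False
        hence "(\<lambda>h. h (k, b)) \<in> borel_measurable (PiM (J i) (\<lambda>_. borel :: complex measure))"
          using kb by (intro measurable_component_singleton) (simp add: J_def)
        thus ?thesis using False by simp
      qed simp
    qed
    thus ?thesis unfolding X_def
      by (intro mat_borel_resolvent mat_borel_add_covar mat_borel_const AD) auto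
  qed
  have Xeq: "resolvent (A + covar n L (\<tau>(i := 0)) (G \<omega>)) z = X i (P i \<omega>)" if "\<omega> \<in> space M" for i \<omega>
  proof -
    have "covar n L (\<tau>(i := 0)) (G \<omega>) = covar n L (\<tau>(i := 0)) (gm i (P i \<omega>))"
      unfolding covar_def
    proof (intro cong_mat refl, unfold case_prod_conv, intro sum.cong refl)
      fix a b k assume "a < n" "b < n" "k \<in> {..<L}"
      thus "complex_of_real ((\<tau>(i := 0)) k) * (cnj (G \<omega> $$ (k, a)) * G \<omega> $$ (k, b)) =
          complex_of_real ((\<tau>(i := 0)) k) * (cnj (gm i (P i \<omega>) $$ (k, a)) * gm i (P i \<omega>) $$ (k, b))"
        using Yc[OF that] by (cases "k = i") (auto simp: G[OF that] gm_def P_def J_def)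
    qed
    thus ?thesis by (simp add: X_def)
  qed
  have row: "(\<lambda>b. G \<omega> $$ (i, b)) b = ?s * Y \<omega> $$ (i, b)" if "\<omega> \<in> space M" "i < L" "b < n" for \<omega> i b
    using Yc[OF that(1)] that by (simp add: G[OF that(1)])
  have qrow: "qdev n Z (\<lambda>b. G \<omega> $$ (i, b)) = qdev n Z (\<lambda>b. ?s * Y \<omega> $$ (i, b))" if "\<omega> \<in> space M" "i < L" for Z \<omega> i
    unfolding qdev_def qform_def using row[OF that] by simp
  have Ym: "(\<lambda>\<omega>. Y \<omega> $$ (i, b)) \<in> borel_measurable M" if "i < L" "b < n" for i b
    using ind that by (auto simp: indep_vars_def)
  define q1 where "q1 i \<omega> = qdev n (X i (P i \<omega>)) (\<lambda>b. ?s * Y \<omega> $$ (i, b)) ^ 4" for i \<omega>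
  define q2 where "q2 i \<omega> = qdev n (X i (P i \<omega>) * resolvent A w) (\<lambda>b. ?s * Y \<omega> $$ (i, b)) ^ 4" for i \<omega>
  define q3 where "q3 i \<omega> = qdev n (1\<^sub>m n) (\<lambda>b. ?s * Y \<omega> $$ (i, b)) ^ 4" for i \<omega>
  have mP: "P i \<in> measurable M (PiM (J i) (\<lambda>_. borel))" for i
    unfolding P_def using Ym by (intro measurable_restrict) (auto simp: J_def)
  have mXR: "(\<lambda>h. X i h * resolvent A w) \<in> measurable (PiM (J i) (\<lambda>_. borel)) (mat_borel n n)" for i
    by (intro mat_borel_mult[where k = n] mX mat_borel_const cR)
  have m1: "(\<lambda>_. 1\<^sub>m n) \<in> measurable N (mat_borel n n)" for N :: "'z measure" by (intro mat_borel_const) simp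
  have mq: "q1 i \<in> borel_measurable M" "q2 i \<in> borel_measurable M" "q3 i \<in> borel_measurable M" if "i < L" for i
    unfolding q1_def q2_def q3_def
    by (intro borel_measurable_power borel_measurable_qdev borel_measurable_times borel_measurable_const Ym m1
      measurable_compose[OF mP mX] measurable_compose[OF mP mXR] that; assumption?)+
  have b1: "(\<integral>\<^sup>+\<omega>. ennreal (q1 i \<omega>) \<partial>M) \<le> ennreal ?K" if "i < L" for i
    unfolding q1_def P_def J_def
    by (rule qdev_row_bound[OF ind \<kappa> n Y[OF that] that mX[unfolded J_def] oX])
  have b2: "(\<integral>\<^sup>+\<omega>. ennreal (q2 i \<omega>) \<partial>M) \<le> ennreal ?K" if "i < L" for i
    unfolding q2_def P_def J_def
    by (rule qdev_row_bound[OF ind \<kappa> n Y[OF that] that mXR[unfolded J_def] opbound_mult[OF cX cR oX oR, unfolded mult_1]])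
  have b3: "(\<integral>\<^sup>+\<omega>. ennreal (q3 i \<omega>) \<partial>M) \<le> ennreal ?K" if "i < L" for i
    unfolding q3_def
    by (rule qdev_row_bound[OF ind \<kappa> n Y[OF that] that m1 opbound_one])
  have "(\<integral>\<^sup>+\<omega>. ennreal (qdev_sum n L z w A \<tau> (G \<omega>)) \<partial>M) = (\<integral>\<^sup>+\<omega>. (\<Sum>i<L. ennreal (q1 i \<omega>) + ennreal (q2 i \<omega>) + ennreal (q3 i \<omega>)) \<partial>M)"
  proof (rule nn_integral_cong)
    fix \<omega> assume \<omega>: "\<omega> \<in> space M"
    have "qdev_sum n L z w A \<tau> (G \<omega>) = (\<Sum>i<L. q1 i \<omega> + q2 i \<omega> + q3 i \<omega>)"
      unfolding qdev_sum_def q1_def q2_def q3_def by (intro sum.cong refl) (simp add: qrow[OF \<omega>] Xeq[OF \<omega>])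
    thus "ennreal (qdev_sum n L z w A \<tau> (G \<omega>)) = (\<Sum>i<L. ennreal (q1 i \<omega>) + ennreal (q2 i \<omega>) + ennreal (q3 i \<omega>))"
      by (simp add: sum_ennreal[symmetric] ennreal_plus[symmetric] q1_def q2_def q3_def del: ennreal_plus)
  qed
  also have "\<dots> = (\<Sum>i<L. (\<integral>\<^sup>+\<omega>. ennreal (q1 i \<omega>) \<partial>M) + (\<integral>\<^sup>+\<omega>. ennreal (q2 i \<omega>) \<partial>M) + (\<integral>\<^sup>+\<omega>. ennreal (q3 i \<omega>) \<partial>M))"
    using mq by (subst nn_integral_sum) (auto simp: nn_integral_add intro!: sum.cong)
  also have "\<dots> \<le> (\<Sum>i<L. ennreal (3 * ?K))"
  proof (rule sum_mono)
    fix i assume "i \<in> {..<L}"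
    hence "(\<integral>\<^sup>+\<omega>. ennreal (q1 i \<omega>) \<partial>M) + (\<integral>\<^sup>+\<omega>. ennreal (q2 i \<omega>) \<partial>M) + (\<integral>\<^sup>+\<omega>. ennreal (q3 i \<omega>) \<partial>M) \<le> ennreal ?K + ennreal ?K + ennreal ?K"
      by (intro add_mono b1 b2 b3) auto
    also have "\<dots> = ennreal (?K + ?K + ?K)" by (simp add: ennreal_plus[symmetric] del: ennreal_plus)
    finally show "(\<integral>\<^sup>+\<omega>. ennreal (q1 i \<omega>) \<partial>M) + (\<integral>\<^sup>+\<omega>. ennreal (q2 i \<omega>) \<partial>M) + (\<integral>\<^sup>+\<omega>. ennreal (q3 i \<omega>) \<partial>M) \<le> ennreal (3 * ?K)"
      by simp
  qed
  also have "\<dots> = ennreal (real L * (3 * ?K))"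
    by (simp only: sum_constant card_lessThan ennreal_of_nat_eq_real_of_nat) (subst ennreal_mult[symmetric], auto)
  finally show ?thesis .
qed

text \<open>The sum of the functions has finite expectation, so the series converges almost surely
  and its terms tend to 0; the joint law for different \<open>n\<close> does not enter. The bounds
  begin at \<open>Suc n\<close> because the matrix size 0 is excluded from all hypotheses.\<close>

lemma (in prob_space) AE_LIMSEQ_0_of_summable_expectation:
  assumes f: "\<And>n. f (Suc n) \<in> borel_measurable M" "\<And>n \<omega>. 0 \<le> f n \<omega>"
    and le: "\<And>n. (\<integral>\<^sup>+\<omega>. ennreal (f (Suc n) \<omega>) \<partial>M) \<le> ennreal (c n)" and c: "summable c" "\<And>n. 0 \<le> c n"
  shows "AE \<omega> in M. (\<lambda>n. f n \<omega>) \<longlonglongrightarrow> 0"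
proof -
  have "(\<integral>\<^sup>+\<omega>. (\<Sum>n. ennreal (f (Suc n) \<omega>)) \<partial>M) = (\<Sum>n. \<integral>\<^sup>+\<omega>. ennreal (f (Suc n) \<omega>) \<partial>M)"
    using f by (intro nn_integral_suminf) auto
  also have "\<dots> \<le> (\<Sum>n. ennreal (c n))" by (intro suminf_le le summableI)
  also have "\<dots> = ennreal (suminf c)" by (rule suminf_ennreal2[OF c(2,1)])
  finally have "(\<integral>\<^sup>+\<omega>. (\<Sum>n. ennreal (f (Suc n) \<omega>)) \<partial>M) \<noteq> \<infinity>" by (auto simp: top_unique)
  hence "AE \<omega> in M. (\<Sum>n. ennreal (f (Suc n) \<omega>)) \<noteq> \<infinity>"
    using f by (intro nn_integral_PInf_AE) auto
  thus ?thesis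
  proof eventually_elim
    case (elim \<omega>)
    have "summable (\<lambda>n. f (Suc n) \<omega>)"
      using elim f(2) by (intro summable_suminf_not_top) auto
    hence "(\<lambda>n. f (Suc n) \<omega>) \<longlonglongrightarrow> 0" by (rule summable_LIMSEQ_zero)
    thus ?case by (rule LIMSEQ_imp_Suc)
  qed
qed

section \<open>Algebraicity\<close>

abbreviation cpoly :: "real poly \<Rightarrow> complex \<Rightarrow> complex" where
  "cpoly p \<equiv> poly (map_poly complex_of_real p)"

lemma cpoly_pCons: "cpoly (pCons a p) z = of_real a + z * cpoly p z"
  by (simp add: Polynomial.map_poly_pCons)

lemma cpoly_add: "cpoly (p + q) z = cpoly p z + cpoly q z"
  by (induction p q rule: poly_induct2) (simp_all add: cpoly_pCons algebra_simps)

lemma cpoly_smult: "cpoly (Polynomial.smult a p) z = of_real a * cpoly p z"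
  by (induction p) (simp_all add: cpoly_pCons algebra_simps)

lemma cpoly_mult: "cpoly (p * q) z = cpoly p z * cpoly q z"
  by (induction p) (simp_all add: cpoly_pCons cpoly_add cpoly_smult algebra_simps)

lemma cpoly_const: "cpoly [:a:] z = of_real a"
  by (simp add: cpoly_pCons)

lemma cpoly_sum: "cpoly (sum f A) z = (\<Sum>i\<in>A. cpoly (f i) z)"
  by (induction A rule: infinite_finite_induct) (simp_all add: cpoly_add)

lemma cpoly_1: "cpoly 1 z = 1"
  using cpoly_const[of 1 z] by (simp add: one_pCons)

lemma cpoly_prod: "cpoly (prod f A) z = (\<Prod>i\<in>A. cpoly (f i) z)"
  by (induction A rule: infinite_finite_induct) (simp_all add: cpoly_mult cpoly_1)

lemma cpoly_monom: "cpoly (monom a j) z = of_real a * z ^ j"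
  by (simp add: map_poly_monom poly_monom)

lemma cpoly_eq_0: "(\<And>z. cpoly p z = 0) \<Longrightarrow> p = 0"
proof -
  assume "\<And>z. cpoly p z = 0"
  hence "map_poly complex_of_real p = 0" by (simp add: poly_all_0_iff_0[symmetric])
  thus "p = 0" by (simp add: map_poly_eq_0_iff)
qed

lemma bipoly_eval_0 [simp]: "bipoly_eval 0 m z = 0"
  by (simp add: bipoly_eval_def)

lemma bipoly_eval_pCons: "bipoly_eval (pCons p P) m z = cpoly p z + m * bipoly_eval P m z"
  by (simp add: bipoly_eval_def Polynomial.map_poly_pCons)

lemma bipoly_eval_add: "bipoly_eval (P + Q) m z = bipoly_eval P m z + bipoly_eval Q m z"
  by (induction P Q rule: poly_induct2) (simp_all add: bipoly_eval_pCons cpoly_add algebra_simps)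

lemma bipoly_eval_smult: "bipoly_eval (Polynomial.smult p Q) m z = cpoly p z * bipoly_eval Q m z"
  by (induction Q) (simp_all add: bipoly_eval_pCons cpoly_mult algebra_simps)

lemma bipoly_eval_mult: "bipoly_eval (P * Q) m z = bipoly_eval P m z * bipoly_eval Q m z"
  by (induction P) (simp_all add: bipoly_eval_pCons bipoly_eval_add bipoly_eval_smult algebra_simps)

lemma bipoly_eval_1: "bipoly_eval 1 m z = 1"
proof -
  have "bipoly_eval [:1:] m z = 1" by (simp only: bipoly_eval_pCons cpoly_1 bipoly_eval_0) simp
  thus ?thesis by (simp only: pCons_one)
qed

lemma bipoly_eval_power: "bipoly_eval (P ^ n) m z = bipoly_eval P m z ^ n"
  by (induction n) (simp_all add: bipoly_eval_mult bipoly_eval_1)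

lemma bipoly_eval_sum: "bipoly_eval (sum f A) m z = (\<Sum>i\<in>A. bipoly_eval (f i) m z)"
  by (induction A rule: infinite_finite_induct) (simp_all add: bipoly_eval_add)

lemma bipoly_eval_monom: "bipoly_eval (monom p i) m z = cpoly p z * m ^ i"
  by (induction i) (simp_all add: monom_0 monom_Suc bipoly_eval_pCons)

lemma bipoly_eval_minus: "bipoly_eval (P - Q) m z = bipoly_eval P m z - bipoly_eval Q m z"
  using bipoly_eval_add[of "P - Q" Q m z] by simp

lemma bipoly_eval_const: "bipoly_eval [:p:] m z = cpoly p z"
  by (simp add: bipoly_eval_pCons)

lemma bipoly_eval_lift: "bipoly_eval (map_poly (\<lambda>a. [:a:]) f) m z = cpoly f m"
  by (induction f) (simp_all add: Polynomial.map_poly_pCons bipoly_eval_pCons cpoly_pCons)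

text \<open>If some coefficient is nonzero at a point \<open>z\<close>, then for this
  \<open>z\<close> a nonzero polynomial in \<open>m\<close> would have all but finitely many numbers
  as roots. The exceptional set \<open>S\<close> makes room for the zeros of a denominator.\<close>

lemma bipoly_eval_eq_0:
  assumes fin: "finite S" and eq: "\<And>m z. m \<notin> S \<Longrightarrow> bipoly_eval P m z = 0"
  shows "P = 0"
proof (rule ccontr)
  assume "P \<noteq> 0"
  then obtain i where "coeff P i \<noteq> 0" by (meson leading_coeff_0_iff)
  then obtain z where z: "cpoly (coeff P i) z \<noteq> 0" using cpoly_eq_0 by blast
  define q where "q = map_poly (\<lambda>p. cpoly p z) P"
  have q: "poly q m = bipoly_eval P m z" for m
    unfolding q_def by (induction P) (simp_all add: Polynomial.map_poly_pCons bipoly_eval_pCons)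
  have "coeff q i \<noteq> 0" using z by (simp add: q_def coeff_map_poly)
  hence "q \<noteq> 0" by auto
  hence "finite {m. poly q m = 0}" by (rule poly_roots_finite)
  moreover have "- S \<subseteq> {m. poly q m = 0}" using eq q by auto
  ultimately have "finite (- S)" using finite_subset by blast
  hence "finite (UNIV :: complex set)" using fin by (metis Compl_partition finite_UnI)
  thus False using infinite_UNIV_char_0 by blast
qed

text \<open>Homogenization with a free degree \<open>d\<close>, so that one power of
  \<open>v\<close> clears the denominators of several polynomials at once.\<close>

lemma cpoly_homogenize:
  assumes "degree p \<le> d" "v \<noteq> 0"
  shows "(\<Sum>j\<le>d. of_real (coeff p j) * u ^ j * v ^ (d - j)) = v ^ d * cpoly p (u / v)"
proof -
  have "cpoly p (u / v) = (\<Sum>j\<le>d. of_real (coeff p j) * (u / v) ^ j)"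
    by (subst poly_as_sum_of_monoms'[OF assms(1), symmetric]) (simp only: cpoly_sum cpoly_monom)
  hence "v ^ d * cpoly p (u / v) = (\<Sum>j\<le>d. of_real (coeff p j) * u ^ j * (v ^ d / v ^ j))"
    by (simp add: sum_distrib_left power_divide mult_ac)
  also have "\<dots> = (\<Sum>j\<le>d. of_real (coeff p j) * u ^ j * v ^ (d - j))"
    using assms(2) by (intro sum.cong refl) (simp add: power_diff)
  finally show ?thesis ..
qed

text \<open>The substitution \<open>z \<mapsto> z - N(m) / V(m)\<close>, cleared of denominators. It is invertible for all
  but finitely many \<open>m\<close>, so it does not annihilate a nonzero polynomial.\<close>

lemma bipoly_substitution:
  fixes P :: "real poly poly" and N V :: "real poly"
  assumes P: "P \<noteq> 0" and V: "V \<noteq> 0"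
  obtains Q d where "Q \<noteq> 0"
    "\<And>m z. cpoly V m \<noteq> 0 \<Longrightarrow> bipoly_eval Q m z = cpoly V m ^ d * bipoly_eval P m (z - cpoly N m / cpoly V m)"
proof -
  \<comment> \<open>Any common bound for the degrees in \<open>z\<close> will do.\<close>
  define d where "d = (\<Sum>i\<le>degree P. degree (coeff P i))"
  have d: "degree (coeff P i) \<le> d" if "i \<le> degree P" for i
    unfolding d_def using that by (intro member_le_sum) auto
  \<comment> \<open>\<open>lift\<close> regards a polynomial as one in the outer variable
    \<open>m\<close> with coefficients constant in \<open>z\<close>. Hence \<open>U\<close> is
    \<open>V(m) z - N(m)\<close>, and \<open>Q\<close> is \<open>P\<close> homogenized in its second
    variable.\<close>
  define lift where "lift = map_poly (\<lambda>a :: real. [:a:])"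
  define U where "U = lift V * [:[:0, 1:]:] - lift N"
  define Q where "Q = (\<Sum>i\<le>degree P. (\<Sum>j\<le>d. [:[:coeff (coeff P i) j:]:] * U ^ j * lift V ^ (d - j)) * monom 1 i)"
  have Q: "bipoly_eval Q m z = cpoly V m ^ d * bipoly_eval P m (z - cpoly N m / cpoly V m)"
    if nz: "cpoly V m \<noteq> 0" for m z
  proof -
    define u where "u = cpoly V m * z - cpoly N m"
    have U: "bipoly_eval U m z = u"
      unfolding U_def lift_def u_def bipoly_eval_minus bipoly_eval_mult bipoly_eval_lift bipoly_eval_const cpoly_pCons
      by simp
    have uv: "u / cpoly V m = z - cpoly N m / cpoly V m" using nz by (simp add: u_def field_simps)
    have "bipoly_eval Q m z = (\<Sum>i\<le>degree P. (\<Sum>j\<le>d. of_real (coeff (coeff P i) j) * u ^ j * cpoly V m ^ (d - j)) * m ^ i)"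
      unfolding Q_def bipoly_eval_sum bipoly_eval_mult bipoly_eval_power bipoly_eval_const bipoly_eval_monom U cpoly_const
      by (simp add: lift_def bipoly_eval_lift cpoly_1)
    also have "\<dots> = (\<Sum>i\<le>degree P. (cpoly V m ^ d * cpoly (coeff P i) (u / cpoly V m)) * m ^ i)"
      using nz d by (intro sum.cong refl) (simp add: cpoly_homogenize)
    also have "\<dots> = cpoly V m ^ d * (\<Sum>i\<le>degree P. cpoly (coeff P i) (u / cpoly V m) * m ^ i)"
      by (simp add: sum_distrib_left mult.assoc)
    also have "(\<Sum>i\<le>degree P. cpoly (coeff P i) (u / cpoly V m) * m ^ i) = bipoly_eval P m (u / cpoly V m)"
      by (subst (3) poly_as_sum_of_monoms[symmetric]) (simp only: bipoly_eval_sum bipoly_eval_monom)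
    finally show ?thesis unfolding uv .
  qed
  have "Q \<noteq> 0"
  proof
    assume Q0: "Q = 0"
    have "map_poly complex_of_real V \<noteq> 0" using V by (simp add: map_poly_eq_0_iff)
    hence fin: "finite {m. cpoly V m = 0}" by (rule poly_roots_finite)
    have "P = 0"
    proof (rule bipoly_eval_eq_0[OF fin])
      fix m z assume "m \<notin> {m. cpoly V m = 0}"
      hence nz: "cpoly V m \<noteq> 0" by simp
      \<comment> \<open>Evaluation at \<open>z + N(m) / V(m)\<close> undoes the
        substitution.\<close>
      thus "bipoly_eval P m z = 0" using Q[OF nz, of "z + cpoly N m / cpoly V m"] by (simp add: Q0)
    qed
    with P show False by simp
  qed
  with Q show thesis by (rule that[rotated])
qed

lemma cpoly_holomorphic: "cpoly p holomorphic_on S"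
  by (induction p) (auto simp: cpoly_pCons[abs_def] intro!: holomorphic_intros)

lemma bipoly_eval_holomorphic:
  assumes "f holomorphic_on S"
  shows "(\<lambda>z. bipoly_eval P (f z) z) holomorphic_on S"
  by (induction P) (auto simp: bipoly_eval_pCons intro!: holomorphic_intros cpoly_holomorphic assms)

text \<open>With finitely many atoms \<open>h\<close> is a rational function \<open>N / V\<close>,
  where \<open>V\<close> is the product of the factors \<open>1 + l k m\<close>. On \<open>D\<close>
  this denominator does not vanish at the transform, so the substitution turns the relation for
  \<open>\<mu>A\<close> into one for \<open>\<mu>\<close>.\<close>

lemma algebraic_of_fixed_point:
  fixes p l :: "nat \<Rightarrow> real" and c :: real
  assumes alg: "algebraic_distribution \<mu>A" and \<mu>: "real_distribution \<mu>"
    and D: "D \<subseteq> {z. Im z > 0}" "\<xi> islimpt D" "Im \<xi> > 0"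
    and nz: "\<And>z k. z \<in> D \<Longrightarrow> k < K \<Longrightarrow> 1 + of_real (l k) * stieltjes_transform \<mu> z \<noteq> 0"
  defines "h \<equiv> \<lambda>m. \<Sum>k<K. of_real (p k * l k / c) / (1 + of_real (l k) * m)"
  assumes pos: "\<And>z. z \<in> D \<Longrightarrow> Im (z - h (stieltjes_transform \<mu> z)) > 0"
    and fp: "\<And>z. z \<in> D \<Longrightarrow> stieltjes_transform \<mu> z = stieltjes_transform \<mu>A (z - h (stieltjes_transform \<mu> z))"
  shows "algebraic_distribution \<mu>"
proof -
  obtain P where P: "P \<noteq> 0" "\<And>z. Im z > 0 \<Longrightarrow> bipoly_eval P (stieltjes_transform \<mu>A z) z = 0"
    using alg unfolding algebraic_distribution_def by blast
  define V where "V = (\<Prod>k<K. [:1, l k:])"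
  define N where "N = (\<Sum>k<K. [:p k * l k / c:] * (\<Prod>j\<in>{..<K} - {k}. [:1, l j:]))"
  have lin: "cpoly [:1, a:] m = 1 + of_real a * m" for a m by (simp add: cpoly_pCons mult.commute)
  have cV: "cpoly V m = (\<Prod>k<K. 1 + of_real (l k) * m)" for m
    by (simp only: V_def cpoly_prod lin)
  have "V \<noteq> 0" unfolding V_def by (simp add: prod_zero_iff)
  from bipoly_substitution[OF P(1) this, of N] obtain Q d where Q: "Q \<noteq> 0"
    "\<And>m z. cpoly V m \<noteq> 0 \<Longrightarrow> bipoly_eval Q m z = cpoly V m ^ d * bipoly_eval P m (z - cpoly N m / cpoly V m)" by blast
  have NV: "cpoly V m \<noteq> 0" "cpoly N m / cpoly V m = h m" if "\<And>k. k < K \<Longrightarrow> 1 + of_real (l k) * m \<noteq> 0" for m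
  proof -
    show nzV: "cpoly V m \<noteq> 0" unfolding cV using that by (simp add: prod_zero_iff)
    have "cpoly N m = (\<Sum>k<K. of_real (p k * l k / c) * (\<Prod>j\<in>{..<K} - {k}. 1 + of_real (l j) * m))"
      by (simp only: N_def cpoly_sum cpoly_mult cpoly_const cpoly_prod lin)
    also have "\<dots> = (\<Sum>k<K. of_real (p k * l k / c) / (1 + of_real (l k) * m) * cpoly V m)"
    proof (intro sum.cong refl)
      fix k assume k: "k \<in> {..<K}"
      have "cpoly V m = (1 + of_real (l k) * m) * (\<Prod>j\<in>{..<K} - {k}. 1 + of_real (l j) * m)"
        unfolding cV using k by (intro prod.remove) auto
      thus "of_real (p k * l k / c) * (\<Prod>j\<in>{..<K} - {k}. 1 + of_real (l j) * m) =
          of_real (p k * l k / c) / (1 + of_real (l k) * m) * cpoly V m"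
        using that[of k] k by simp
    qed
    also have "\<dots> = h m * cpoly V m" by (simp add: h_def sum_distrib_right)
    finally show "cpoly N m / cpoly V m = h m" using nzV by simp
  qed
  have zero: "bipoly_eval Q (stieltjes_transform \<mu> z) z = 0" if z: "z \<in> D" for z
  proof -
    let ?m = "stieltjes_transform \<mu> z"
    have "bipoly_eval P ?m (z - h ?m) = 0" using P(2)[OF pos[OF z]] fp[OF z] by simp
    thus ?thesis using Q(2)[of ?m z] NV[of ?m] nz[OF z] by simp
  qed
  have "bipoly_eval Q (stieltjes_transform \<mu> z) z = 0" if z: "Im z > 0" for z
    by (rule analytic_continuation[of "\<lambda>z. bipoly_eval Q (stieltjes_transform \<mu> z) z" "{z. Im z > 0}" D \<xi>])
       (use D z zero upper_half_plane_connected upper_half_plane_open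
          bipoly_eval_holomorphic[OF real_distribution.stieltjes_holomorphic[OF \<mu>]] in auto)
  thus ?thesis using Q(1) unfolding algebraic_distribution_def by blast
qed

section \<open>Convergence of normalized traces\<close>

lemma average_le_quadratic_mean:
  fixes x :: "nat \<Rightarrow> real"
  shows "(\<Sum>i<L. x i) / real L \<le> sqrt ((\<Sum>i<L. (x i)\<^sup>2) / real L)"
proof (rule real_le_rsqrt)
  have "(\<Sum>i<L. x i)\<^sup>2 \<le> (\<Sum>i<L. (x i)\<^sup>2) * real L"
    using sum_squared_le_sum_of_squares[of x "{..<L}"] by simp
  hence "(\<Sum>i<L. x i)\<^sup>2 / (real L)\<^sup>2 \<le> (\<Sum>i<L. (x i)\<^sup>2) * real L / (real L)\<^sup>2"
    by (rule divide_right_mono) simp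
  thus "((\<Sum>i<L. x i) / real L)\<^sup>2 \<le> (\<Sum>i<L. (x i)\<^sup>2) / real L"
    by (cases "L = 0") (simp_all add: power_divide power2_eq_square)
qed

text \<open>\<open>\<sigma>\<close> is the fourth root of the averaged fourth powers of all
  deviations. By the power mean inequality it dominates the averages of \<open>e\<close>,
  \<open>f\<close> and \<open>k\<close>, and \<open>\<sigma>^2\<close> dominates those of their
  squares; every sum in the comparison reduces to these.\<close>

lemma resolvent_comparison_average:
  fixes \<tau> :: "nat \<Rightarrow> real" and G :: "complex mat"
  assumes n: "n > 0" and L: "L > 0" and A: "hermitian_mat n A" and z: "Im z \<ge> 2" and zh: "Im (z - h) \<ge> Im z / 2"
    and \<Lambda>: "\<And>i. i < L \<Longrightarrow> \<bar>\<tau> i\<bar> \<le> \<Lambda>" "\<Lambda> \<ge> 0"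
    and m: "\<And>i. i < L \<Longrightarrow> cmod (1 + of_real (\<tau> i) * m) \<ge> 1 / 2"
  defines "Q \<equiv> resolvent (A + covar n L \<tau> G) z" and "R \<equiv> resolvent A (z - h)"
    and "\<sigma> \<equiv> sqrt (sqrt (qdev_sum n L z (z - h) A \<tau> G / real L))" and "r \<equiv> real L / real n"
  shows "cmod (mtrace R / of_nat n - mtrace Q / of_nat n) \<le>
      2 * \<Lambda> * r * (\<sigma> + \<Lambda> * (1 + \<sigma>) / real n)
    + 4 * \<Lambda>\<^sup>2 * r / (Im z)\<^sup>2 * (cmod (m - mtrace Q / of_nat n) * (1 + \<sigma>) + \<Lambda> * (2 + 2 * \<sigma>\<^sup>2) / real n + (\<sigma> + \<sigma>\<^sup>2))
    + cmod ((\<Sum>i<L. of_real (\<tau> i) / (1 + of_real (\<tau> i) * m)) / of_nat n - h)"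
proof -
  define g where "g i = (\<lambda>b. G $$ (i, b))" for i
  define Qi where "Qi i = resolvent (A + covar n L (\<tau>(i := 0)) G) z" for i
  define \<eta> where "\<eta> i = (l2norm n (g i))\<^sup>2" for i
  define e where "e i = qdev n (Qi i) (g i)" for i
  define f where "f i = qdev n (Qi i * R) (g i)" for i
  define k where "k i = qdev n (1\<^sub>m n) (g i)" for i
  define S where "S = qdev_sum n L z (z - h) A \<tau> G / real L"
  define v where "v = Im z"
  define d where "d = cmod (m - mtrace Q / of_nat n)"
  have nn: "0 \<le> e i" "0 \<le> f i" "0 \<le> k i" "0 \<le> \<eta> i" for i by (simp_all add: e_def f_def k_def \<eta>_def)
  have S: "S = (\<Sum>i<L. e i ^ 4 + f i ^ 4 + k i ^ 4) / real L"
    by (simp add: S_def qdev_sum_def e_def f_def k_def Qi_def R_def g_def)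
  \<comment> \<open>The form of the identity matrix is the squared norm of the row, so
    \<open>k\<close> controls \<open>\<eta>\<close>.\<close>
  have k: "k i = \<bar>\<eta> i - 1\<bar>" for i
  proof -
    have "qform n (1\<^sub>m n) (g i) - mtrace (1\<^sub>m n) / of_nat n = complex_of_real (\<eta> i - 1)"
      using n by (simp add: qform_one mtrace_one \<eta>_def)
    thus ?thesis unfolding k_def qdev_def by (simp only: norm_of_real)
  qed
  have s0: "\<sigma> \<ge> 0" "S \<ge> 0"
    unfolding \<sigma>_def S by (auto intro!: divide_nonneg_nonneg sum_nonneg add_nonneg_nonneg qdev_sum_nonneg)
  have s2: "\<sigma>\<^sup>2 = sqrt S" using s0(2) by (simp add: \<sigma>_def S_def[symmetric])
  have avg2: "(\<Sum>i<L. (x i)\<^sup>2) / real L \<le> \<sigma>\<^sup>2" if "\<And>i. x i ^ 4 \<le> e i ^ 4 + f i ^ 4 + k i ^ 4" for x :: "nat \<Rightarrow> real"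
  proof -
    have "(\<Sum>i<L. (x i)\<^sup>2) / real L \<le> sqrt ((\<Sum>i<L. ((x i)\<^sup>2)\<^sup>2) / real L)" by (rule average_le_quadratic_mean)
    also have "\<dots> \<le> sqrt S"
      unfolding S using that by (intro real_sqrt_le_mono divide_right_mono sum_mono) auto
    finally show ?thesis unfolding s2 .
  qed
  have avg1: "(\<Sum>i<L. x i) / real L \<le> \<sigma>" if "\<And>i. x i ^ 4 \<le> e i ^ 4 + f i ^ 4 + k i ^ 4" for x :: "nat \<Rightarrow> real"
  proof -
    have "(\<Sum>i<L. x i) / real L \<le> sqrt ((\<Sum>i<L. (x i)\<^sup>2) / real L)" by (rule average_le_quadratic_mean)
    also have "\<dots> \<le> sqrt (\<sigma>\<^sup>2)" using avg2[of x] that by (intro real_sqrt_le_mono) auto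
    finally show ?thesis using s0 by simp
  qed
  have p4: "e i ^ 4 \<le> e i ^ 4 + f i ^ 4 + k i ^ 4" "f i ^ 4 \<le> e i ^ 4 + f i ^ 4 + k i ^ 4" "k i ^ 4 \<le> e i ^ 4 + f i ^ 4 + k i ^ 4" for i
    using zero_le_power[OF nn(1), of i 4] zero_le_power[OF nn(2), of i 4] zero_le_power[OF nn(3), of i 4] by linarith+
  have af: "(\<Sum>i<L. f i) / real L \<le> \<sigma>" and ae: "(\<Sum>i<L. e i) / real L \<le> \<sigma>" and ak: "(\<Sum>i<L. k i) / real L \<le> \<sigma>"
    and ae2: "(\<Sum>i<L. (e i)\<^sup>2) / real L \<le> \<sigma>\<^sup>2" and ak2: "(\<Sum>i<L. (k i)\<^sup>2) / real L \<le> \<sigma>\<^sup>2"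
    using avg1[of f] avg1[of e] avg1[of k] avg2[of e] avg2[of k] p4 by auto
  have one: "(\<Sum>i<L. a) / real L = a" for a :: real using L by simp
  have a\<eta>: "(\<Sum>i<L. \<eta> i) / real L \<le> 1 + \<sigma>"
  proof -
    have "(\<Sum>i<L. \<eta> i) / real L \<le> (\<Sum>i<L. 1 + k i) / real L"
      using k by (intro divide_right_mono sum_mono) (auto simp: abs_le_iff)
    also have "\<dots> = 1 + (\<Sum>i<L. k i) / real L" unfolding sum.distrib add_divide_distrib one ..
    finally show ?thesis using ak by linarith
  qed
  have a\<eta>2: "(\<Sum>i<L. (\<eta> i)\<^sup>2) / real L \<le> 2 + 2 * \<sigma>\<^sup>2"
  proof -
    have "(\<eta> i)\<^sup>2 \<le> 2 + 2 * (k i)\<^sup>2" for i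
    proof -
      have "0 \<le> (\<eta> i - 2)\<^sup>2" by simp
      also have "(\<eta> i - 2)\<^sup>2 = 2 + 2 * (k i)\<^sup>2 - (\<eta> i)\<^sup>2" unfolding k by (simp add: power2_eq_square algebra_simps)
      finally show ?thesis by simp
    qed
    hence "(\<Sum>i<L. (\<eta> i)\<^sup>2) / real L \<le> (\<Sum>i<L. 2 + 2 * (k i)\<^sup>2) / real L"
      by (intro divide_right_mono sum_mono) auto
    also have "\<dots> = 2 + 2 * ((\<Sum>i<L. (k i)\<^sup>2) / real L)"
      unfolding sum.distrib add_divide_distrib one sum_distrib_left[symmetric] by simp
    finally show ?thesis using ak2 by linarith
  qed
  have ae\<eta>: "(\<Sum>i<L. e i * \<eta> i) / real L \<le> \<sigma> + \<sigma>\<^sup>2"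
  proof -
    \<comment> \<open>The product of two random quantities is split by
      \<open>\<eta> \<le> 1 + k\<close> and \<open>e k \<le> (e^2 + k^2) / 2\<close>, which leaves
      only averages of single squares.\<close>
    have "e i * \<eta> i \<le> e i + ((e i)\<^sup>2 / 2 + (k i)\<^sup>2 / 2)" for i
    proof -
      have "e i * \<eta> i \<le> e i * (1 + k i)" using nn k by (intro mult_left_mono) (auto simp: abs_le_iff)
      also have "\<dots> = e i + e i * k i" by (simp add: algebra_simps)
      also have "e i * k i \<le> (e i)\<^sup>2 / 2 + (k i)\<^sup>2 / 2"
        using zero_le_power2[of "e i - k i"] by (simp add: power2_eq_square algebra_simps)
      finally show ?thesis by simp
    qed
    hence "(\<Sum>i<L. e i * \<eta> i) / real L \<le> (\<Sum>i<L. e i + ((e i)\<^sup>2 / 2 + (k i)\<^sup>2 / 2)) / real L"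
      by (intro divide_right_mono sum_mono) auto
    also have "\<dots> = (\<Sum>i<L. e i) / real L + ((\<Sum>i<L. (e i)\<^sup>2) / real L / 2 + (\<Sum>i<L. (k i)\<^sup>2) / real L / 2)"
      by (simp add: sum.distrib add_divide_distrib sum_divide_distrib[symmetric])
    finally show ?thesis using ae ae2 ak2 by argo
  qed
  have r0: "0 \<le> r" by (simp add: r_def)
  have rL: "x / real n = r * (x / real L)" for x using L n by (simp add: r_def)
  have t1: "(2 * \<Lambda> / real n) * (\<Sum>i<L. f i + \<Lambda> * \<eta> i / real n) \<le> 2 * \<Lambda> * r * (\<sigma> + \<Lambda> * (1 + \<sigma>) / real n)"
  proof -
    have "(2 * \<Lambda> / real n) * (\<Sum>i<L. f i + \<Lambda> * \<eta> i / real n) = 2 * \<Lambda> * ((\<Sum>i<L. f i + \<Lambda> * \<eta> i / real n) / real n)" by simp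
    also have "\<dots> = 2 * \<Lambda> * r * ((\<Sum>i<L. f i) / real L + \<Lambda> * ((\<Sum>i<L. \<eta> i) / real L) / real n)"
      unfolding rL by (simp add: sum.distrib add_divide_distrib sum_divide_distrib[symmetric] sum_distrib_left[symmetric])
    also have "\<dots> \<le> 2 * \<Lambda> * r * (\<sigma> + \<Lambda> * (1 + \<sigma>) / real n)"
      using af a\<eta> \<Lambda>(2) r0 by (intro mult_left_mono add_mono divide_right_mono) auto
    finally show ?thesis .
  qed
  have t2: "(2 * \<Lambda>\<^sup>2 / real n) * (\<Sum>i<L. (d + \<Lambda> * \<eta> i / real n + e i) * (2 / v\<^sup>2 * \<eta> i)) \<le>
      4 * \<Lambda>\<^sup>2 * r / v\<^sup>2 * (d * (1 + \<sigma>) + \<Lambda> * (2 + 2 * \<sigma>\<^sup>2) / real n + (\<sigma> + \<sigma>\<^sup>2))"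
  proof -
    have "(\<Sum>i<L. (d + \<Lambda> * \<eta> i / real n + e i) * (2 / v\<^sup>2 * \<eta> i)) =
        (\<Sum>i<L. 2 / v\<^sup>2 * (d * \<eta> i + \<Lambda> / real n * (\<eta> i)\<^sup>2 + e i * \<eta> i))"
      by (intro sum.cong refl) (simp add: power2_eq_square algebra_simps add_divide_distrib)
    also have "\<dots> = 2 / v\<^sup>2 * (d * (\<Sum>i<L. \<eta> i) + \<Lambda> / real n * (\<Sum>i<L. (\<eta> i)\<^sup>2) + (\<Sum>i<L. e i * \<eta> i))"
      by (simp only: sum.distrib sum_distrib_left[symmetric])
    finally have X: "(\<Sum>i<L. (d + \<Lambda> * \<eta> i / real n + e i) * (2 / v\<^sup>2 * \<eta> i)) =
        2 / v\<^sup>2 * (d * (\<Sum>i<L. \<eta> i) + \<Lambda> / real n * (\<Sum>i<L. (\<eta> i)\<^sup>2) + (\<Sum>i<L. e i * \<eta> i))" .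
    have "(2 * \<Lambda>\<^sup>2 / real n) * (2 / v\<^sup>2 * W) = 4 * \<Lambda>\<^sup>2 / v\<^sup>2 * (W / real n)" for W by (simp add: mult_ac)
    hence "(2 * \<Lambda>\<^sup>2 / real n) * (\<Sum>i<L. (d + \<Lambda> * \<eta> i / real n + e i) * (2 / v\<^sup>2 * \<eta> i)) =
        4 * \<Lambda>\<^sup>2 / v\<^sup>2 * ((d * (\<Sum>i<L. \<eta> i) + \<Lambda> / real n * (\<Sum>i<L. (\<eta> i)\<^sup>2) + (\<Sum>i<L. e i * \<eta> i)) / real n)"
      unfolding X .
    also have "\<dots> = 4 * \<Lambda>\<^sup>2 * r / v\<^sup>2 * (d * ((\<Sum>i<L. \<eta> i) / real L) + \<Lambda> * ((\<Sum>i<L. (\<eta> i)\<^sup>2) / real L) / real n + (\<Sum>i<L. e i * \<eta> i) / real L)"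
      unfolding rL[of "d * _ + _ + _"] by (simp add: add_divide_distrib)
    also have "\<dots> \<le> 4 * \<Lambda>\<^sup>2 * r / v\<^sup>2 * (d * (1 + \<sigma>) + \<Lambda> * (2 + 2 * \<sigma>\<^sup>2) / real n + (\<sigma> + \<sigma>\<^sup>2))"
    proof (rule mult_left_mono)
      show "d * ((\<Sum>i<L. \<eta> i) / real L) + \<Lambda> * ((\<Sum>i<L. (\<eta> i)\<^sup>2) / real L) / real n + (\<Sum>i<L. e i * \<eta> i) / real L
          \<le> d * (1 + \<sigma>) + \<Lambda> * (2 + 2 * \<sigma>\<^sup>2) / real n + (\<sigma> + \<sigma>\<^sup>2)"
        using a\<eta> a\<eta>2 ae\<eta> \<Lambda>(2) by (intro add_mono mult_left_mono divide_right_mono) (auto simp: d_def)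
    qed (use r0 in auto)
    finally show ?thesis .
  qed
  have "cmod (mtrace R / of_nat n - mtrace Q / of_nat n) \<le>
      (2 * \<Lambda> / real n) * (\<Sum>i<L. f i + \<Lambda> * \<eta> i / real n)
    + (2 * \<Lambda>\<^sup>2 / real n) * (\<Sum>i<L. (d + \<Lambda> * \<eta> i / real n + e i) * (2 / v\<^sup>2 * \<eta> i))
    + cmod ((\<Sum>i<L. of_real (\<tau> i) / (1 + of_real (\<tau> i) * m)) / of_nat n - h)"
    unfolding Q_def R_def d_def v_def e_def f_def \<eta>_def Qi_def g_def qdev_def
    by (rule resolvent_comparison[OF n A z zh \<Lambda> m])
  thus ?thesis using t1 t2 unfolding d_def[symmetric] v_def[symmetric] by linarith
qed

text \<open>The comparison bounds the distance \<open>d\<close> of the trace from \<open>m\<close>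
  by a null sequence plus \<open>q (1 + \<sigma>) d\<close>. The coefficient is eventually below
  1/2, so \<open>d\<close> is at most twice a null sequence. This is carried out for clipped
  weights; restoring the original ones changes the normalized trace by at most a multiple of the
  proportion of clipped indices.\<close>

lemma resolvent_trace_convergence:
  fixes L :: "nat \<Rightarrow> nat" and A G :: "nat \<Rightarrow> complex mat" and \<tau> :: "nat \<Rightarrow> nat \<Rightarrow> real" and c \<Lambda> :: real
  assumes A: "\<And>n. n \<ge> 1 \<Longrightarrow> hermitian_mat n (A n)" and L: "\<And>n. n \<ge> 1 \<Longrightarrow> L n \<ge> 1"
    and c: "c > 0" "(\<lambda>n. real n / real (L n)) \<longlonglongrightarrow> c"
    and z: "Im z \<ge> 2" "Im (z - h) \<ge> Im z / 2" and \<Lambda>: "\<Lambda> \<ge> 0" and small: "32 * \<Lambda>\<^sup>2 / c \<le> (Im z)\<^sup>2"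
    and m: "\<And>x. \<bar>x\<bar> \<le> \<Lambda> \<Longrightarrow> cmod (1 + complex_of_real x * m) \<ge> 1 / 2"
    and lim_A: "(\<lambda>n. mtrace (resolvent (A n) (z - h)) / of_nat n) \<longlonglongrightarrow> m"
    and lim_q: "(\<lambda>n. qdev_sum n (L n) z (z - h) (A n) (\<lambda>i. clip \<Lambda> (\<tau> n i)) (G n) / real (L n)) \<longlonglongrightarrow> 0"
    and lim_h: "(\<lambda>n. (\<Sum>i<L n. of_real (clip \<Lambda> (\<tau> n i)) / (1 + of_real (clip \<Lambda> (\<tau> n i)) * m)) / of_nat n) \<longlonglongrightarrow> h"
    and lim_t: "(\<lambda>n. real (card {i. i < L n \<and> \<tau> n i \<noteq> clip \<Lambda> (\<tau> n i)}) / real n) \<longlonglongrightarrow> 0"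
  shows "(\<lambda>n. mtrace (resolvent (A n + covar n (L n) (\<tau> n) (G n)) z) / of_nat n) \<longlonglongrightarrow> m"
proof -
  define t where "t n = (\<lambda>i. clip \<Lambda> (\<tau> n i))" for n
  define \<sigma> where "\<sigma> n = sqrt (sqrt (qdev_sum n (L n) z (z - h) (A n) (t n) (G n) / real (L n)))" for n
  define r where "r n = real (L n) / real n" for n
  define M where "M n = mtrace (resolvent (A n + covar n (L n) (t n) (G n)) z) / of_nat n" for n
  define R where "R n = mtrace (resolvent (A n) (z - h)) / of_nat n" for n
  define \<delta> where "\<delta> n = cmod ((\<Sum>i<L n. of_real (t n i) / (1 + of_real (t n i) * m)) / of_nat n - h)" for n
  define d where "d n = cmod (m - M n)" for n
  have tb: "\<bar>t n i\<bar> \<le> \<Lambda>" for n i using \<Lambda> by (auto simp: t_def clip_def)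
  have lim_r: "r \<longlonglongrightarrow> 1 / c"
    using tendsto_divide[OF tendsto_const[of 1] c(2)] c(1) by (simp add: r_def[abs_def])
  have lim_\<sigma>: "\<sigma> \<longlonglongrightarrow> 0"
    using tendsto_real_sqrt[OF tendsto_real_sqrt[OF lim_q]] by (simp add: \<sigma>_def[abs_def] t_def)
  have lim_R: "(\<lambda>n. cmod (m - R n)) \<longlonglongrightarrow> 0"
    using tendsto_norm[OF tendsto_diff[OF tendsto_const[of m] lim_A]] by (simp add: R_def)
  have lim_\<delta>: "\<delta> \<longlonglongrightarrow> 0"
    using tendsto_norm[OF tendsto_diff[OF lim_h tendsto_const[of h]]] by (simp add: \<delta>_def[abs_def] t_def)
  define q where "q n = 4 * \<Lambda>\<^sup>2 * r n / (Im z)\<^sup>2" for n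
  define E where "E n = cmod (m - R n) + (2 * \<Lambda> * r n * (\<sigma> n + \<Lambda> * (1 + \<sigma> n) / real n)
      + q n * (\<Lambda> * (2 + 2 * (\<sigma> n)\<^sup>2) / real n + (\<sigma> n + (\<sigma> n)\<^sup>2)) + \<delta> n)" for n
  have lim_n: "(\<lambda>n. x n / real n) \<longlonglongrightarrow> 0" if "x \<longlonglongrightarrow> y" for x and y :: real
    using tendsto_mult[OF that lim_inverse_n'] by simp
  have lim_q': "q \<longlonglongrightarrow> 4 * \<Lambda>\<^sup>2 * (1 / c) / (Im z)\<^sup>2"
    unfolding q_def[abs_def] using z by (intro tendsto_intros lim_r) auto
  have "(\<lambda>n. \<Lambda> * (1 + \<sigma> n)) \<longlonglongrightarrow> \<Lambda> * (1 + 0)" "(\<lambda>n. \<Lambda> * (2 + 2 * (\<sigma> n)\<^sup>2)) \<longlonglongrightarrow> \<Lambda> * (2 + 2 * 0\<^sup>2)"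
    by (intro tendsto_intros lim_\<sigma>)+
  note ln = this[THEN lim_n]
  have "E \<longlonglongrightarrow> 0 + (2 * \<Lambda> * (1 / c) * (0 + 0) + 4 * \<Lambda>\<^sup>2 * (1 / c) / (Im z)\<^sup>2 * (0 + (0 + 0\<^sup>2)) + 0)"
    unfolding E_def[abs_def] by (intro tendsto_add tendsto_mult tendsto_power tendsto_const lim_R lim_r lim_\<sigma> lim_\<delta> lim_q' ln)
  hence lim_E: "(\<lambda>n. 2 * E n) \<longlonglongrightarrow> 2 * 0" by (intro tendsto_mult tendsto_const) simp
  \<comment> \<open>The limit of the coefficient is \<open>4 \<Lambda>^2 / (c (Im z)^2)\<close>, by
    \<open>small\<close> at most 1/8.\<close>
  have qs: "eventually (\<lambda>n. q n * (1 + \<sigma> n) < 1 / 2) sequentially"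
  proof (rule order_tendstoD(2))
    show "(\<lambda>n. q n * (1 + \<sigma> n)) \<longlonglongrightarrow> 4 * \<Lambda>\<^sup>2 * (1 / c) / (Im z)\<^sup>2 * (1 + 0)"
      by (intro tendsto_intros lim_q' lim_\<sigma>)
    have "(Im z)\<^sup>2 > 0" using z by simp
    hence "32 * \<Lambda>\<^sup>2 / c / (Im z)\<^sup>2 \<le> 1" using small by (simp only: divide_le_eq_1_pos)
    moreover have eq: "4 * \<Lambda>\<^sup>2 * (1 / c) / (Im z)\<^sup>2 * (1 + 0) = (32 * \<Lambda>\<^sup>2 / c / (Im z)\<^sup>2) / 8" by simp
    ultimately show "4 * \<Lambda>\<^sup>2 * (1 / c) / (Im z)\<^sup>2 * (1 + 0) < 1 / 2" unfolding eq by argo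
  qed
  have dE: "eventually (\<lambda>n. d n \<le> 2 * E n) sequentially"
    using qs eventually_ge_at_top[of 1]
  proof eventually_elim
    case (elim n)
    have "cmod (R n - M n) \<le> 2 * \<Lambda> * r n * (\<sigma> n + \<Lambda> * (1 + \<sigma> n) / real n)
      + q n * (d n * (1 + \<sigma> n) + \<Lambda> * (2 + 2 * (\<sigma> n)\<^sup>2) / real n + (\<sigma> n + (\<sigma> n)\<^sup>2)) + \<delta> n"
      unfolding R_def M_def \<sigma>_def r_def q_def d_def \<delta>_def
      using A[of n] L[of n] elim z \<Lambda> tb m by (intro resolvent_comparison_average) auto
    also have "q n * (d n * (1 + \<sigma> n) + \<Lambda> * (2 + 2 * (\<sigma> n)\<^sup>2) / real n + (\<sigma> n + (\<sigma> n)\<^sup>2)) =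
        d n * (q n * (1 + \<sigma> n)) + q n * (\<Lambda> * (2 + 2 * (\<sigma> n)\<^sup>2) / real n + (\<sigma> n + (\<sigma> n)\<^sup>2))"
      by (simp add: algebra_simps)
    finally have RM: "cmod (R n - M n) \<le> 2 * \<Lambda> * r n * (\<sigma> n + \<Lambda> * (1 + \<sigma> n) / real n)
      + (d n * (q n * (1 + \<sigma> n)) + q n * (\<Lambda> * (2 + 2 * (\<sigma> n)\<^sup>2) / real n + (\<sigma> n + (\<sigma> n)\<^sup>2))) + \<delta> n" .
    have "d n * (q n * (1 + \<sigma> n)) \<le> d n * (1 / 2)" using elim by (intro mult_left_mono) (auto simp: d_def)
    moreover have "d n \<le> cmod (m - R n) + cmod (R n - M n)"
      unfolding d_def using norm_triangle_ineq[of "m - R n" "R n - M n"] by simp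
    ultimately have "d n \<le> E n + d n / 2" using RM unfolding E_def by linarith
    thus ?case by linarith
  qed
  have "d \<longlonglongrightarrow> 0"
    by (rule tendsto_sandwich[OF _ dE tendsto_const]) (use lim_E in \<open>auto simp: d_def\<close>)
  hence "(\<lambda>n. m - M n) \<longlonglongrightarrow> 0" unfolding d_def[abs_def] by (rule tendsto_norm_zero_cancel)
  from tendsto_diff[OF tendsto_const[of m] this] have lim_M: "M \<longlonglongrightarrow> m" by simp
  define T where "T n = mtrace (resolvent (A n + covar n (L n) (\<tau> n) (G n)) z) / of_nat n" for n
  have "(\<lambda>n. T n - M n) \<longlonglongrightarrow> 0"
  proof (rule Lim_null_comparison)
    show "eventually (\<lambda>n. norm (T n - M n) \<le> 2 / Im z * (real (card {i. i < L n \<and> \<tau> n i \<noteq> clip \<Lambda> (\<tau> n i)}) / real n)) sequentially"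
      using eventually_ge_at_top[of 1]
    proof eventually_elim
      case (elim n)
      have "norm (T n - M n) = cmod (mtrace (resolvent (A n + covar n (L n) (\<tau> n) (G n)) z) - mtrace (resolvent (A n + covar n (L n) (t n) (G n)) z)) / real n"
        unfolding T_def M_def diff_divide_distrib[symmetric] norm_divide by simp
      also have "\<dots> \<le> 2 / Im z * real (card {i. i < L n \<and> \<tau> n i \<noteq> t n i}) / real n"
        using z by (intro divide_right_mono mtrace_resolvent_covar_change A elim) auto
      finally show ?case by (simp add: t_def)
    qed
    show "(\<lambda>n. 2 / Im z * (real (card {i. i < L n \<and> \<tau> n i \<noteq> clip \<Lambda> (\<tau> n i)}) / real n)) \<longlonglongrightarrow> 0"
      using tendsto_mult[OF tendsto_const[of "2 / Im z"] lim_t] by (simp only: mult_zero_right)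
  qed
  from tendsto_add[OF this lim_M] show ?thesis by (simp add: T_def)
qed

text \<open>The weights live on the indices and not on the points, so atoms may be repeated. With
  weights \<open>1 / n\<close> this is the spectral distribution of a matrix, with weights
  \<open>p\<close> the limit distribution of \<open>T\<close>.\<close>

definition atomic_measure :: "nat \<Rightarrow> (nat \<Rightarrow> real) \<Rightarrow> (nat \<Rightarrow> real) \<Rightarrow> real measure" where
  "atomic_measure K p l = distr (point_measure {..<K} (\<lambda>k. ennreal (p k))) borel l"

lemma atomic_measure:
  assumes p: "\<And>k. k < K \<Longrightarrow> p k \<ge> 0" "(\<Sum>k<K. p k) = 1"
  shows real_distribution_atomic_measure: "real_distribution (atomic_measure K p l)"
    and integral_atomic_measure: "f \<in> borel_measurable borel \<Longrightarrow>
      integral\<^sup>L (atomic_measure K p l) f = (\<Sum>k<K. p k *\<^sub>R (f (l k) :: 'b :: {banach, second_countable_topology}))"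
    and cdf_atomic_measure: "cdf (atomic_measure K p l) x = (\<Sum>k<K. p k * indicator {l k..} x)"
proof -
  interpret prob_space "point_measure {..<K} (\<lambda>k. ennreal (p k))"
    using p sum_ennreal[of "{..<K}" p] by (intro prob_space_point_measure) auto
  have l: "l \<in> measurable (point_measure {..<K} (\<lambda>k. ennreal (p k))) borel"
    by (simp add: measurable_point_measure_eq1)
  show rd: "real_distribution (atomic_measure K p l)"
    unfolding atomic_measure_def by (rule real_distribution_distr[OF l])
  show int: "integral\<^sup>L (atomic_measure K p l) f = (\<Sum>k<K. p k *\<^sub>R f (l k))" if "f \<in> borel_measurable borel"
    for f :: "real \<Rightarrow> 'b :: {banach, second_countable_topology}"
    unfolding atomic_measure_def using p(1)
    by (subst integral_distr[OF l that]) (intro lebesgue_integral_point_measure_finite, auto)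
  interpret rd: real_distribution "atomic_measure K p l" by (rule rd)
  have "cdf (atomic_measure K p l) x = (LINT y|atomic_measure K p l. indicator {..x} y)"
    by (simp add: cdf_def)
  also have "\<dots> = (\<Sum>k<K. p k * indicator {..x} (l k))"
  proof -
    have "(LINT k|point_measure {..<K} (\<lambda>k. ennreal (p k)). indicator {..x} (l k)) = (\<Sum>k<K. p k *\<^sub>R (indicator {..x} (l k) :: real))"
      using p(1) by (intro lebesgue_integral_point_measure_finite) auto
    thus ?thesis unfolding atomic_measure_def by (subst integral_distr[OF l]) auto
  qed
  also have "\<dots> = (\<Sum>k<K. p k * indicator {l k..} x)"
    by (intro sum.cong refl) (simp add: indicator_def)
  finally show "cdf (atomic_measure K p l) x = (\<Sum>k<K. p k * indicator {l k..} x)" .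
qed

lemma cdf_uniform_atomic_measure:
  assumes "n > 0"
  shows "cdf (atomic_measure n (\<lambda>_. 1 / real n) es) x = real (card {i. i < n \<and> es i \<le> x}) / real n"
proof -
  have "(\<Sum>k<n. 1 / real n * indicator {es k..} x) = (\<Sum>k<n. indicator {i. i < n \<and> es i \<le> x} k) / real n"
    unfolding sum_divide_distrib by (intro sum.cong refl) (simp add: indicator_def)
  also have "(\<Sum>k<n. indicator {i. i < n \<and> es i \<le> x} k) = real (card ({..<n} \<inter> {i. i < n \<and> es i \<le> x}))"
  proof -
    have "(\<Sum>k<n. indicator S k) = real (card ({..<n} \<inter> S))" for S by (simp add: indicator_def sum.If_cases)
    thus ?thesis .
  qed
  also have "{..<n} \<inter> {i. i < n \<and> es i \<le> x} = {i. i < n \<and> es i \<le> x}" by auto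
  finally show ?thesis using assms by (subst cdf_atomic_measure) auto
qed

lemma hermitian_spectral_measure:
  assumes X: "hermitian_mat n X" and n: "n > 0"
  obtains \<nu> where "real_distribution \<nu>" "cdf \<nu> = spectral_cdf X"
    "\<And>z. Im z > 0 \<Longrightarrow> stieltjes_transform \<nu> z = mtrace (resolvent X z) / of_nat n"
proof -
  obtain es where es: "\<And>x. spectral_cdf X x = real (card {i. i < n \<and> es i \<le> x}) / real n"
    "\<And>z. Im z > 0 \<Longrightarrow> mtrace (resolvent X z) = (\<Sum>i<n. 1 / (of_real (es i) - z))"
    using hermitian_spectrum[OF X] by blast
  have p: "\<And>k. k < n \<Longrightarrow> 0 \<le> 1 / real n" "(\<Sum>k<n. 1 / real n) = 1" using n by auto
  show thesis
  proof (rule that)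
    show "real_distribution (atomic_measure n (\<lambda>_. 1 / real n) es)" by (rule real_distribution_atomic_measure[OF p])
    show "cdf (atomic_measure n (\<lambda>_. 1 / real n) es) = spectral_cdf X"
      using cdf_uniform_atomic_measure[OF n] es(1) by (intro ext) simp
    show "stieltjes_transform (atomic_measure n (\<lambda>_. 1 / real n) es) z = mtrace (resolvent X z) / of_nat n" if "Im z > 0" for z
      unfolding stieltjes_transform_def
      by (subst integral_atomic_measure[OF p]) (auto simp: es(2)[OF that] sum_divide_distrib scaleR_conv_of_real mult.commute)
  qed
qed

lemma diagonal_spectral_cdf:
  assumes T: "T \<in> carrier_mat L L" "diagonal_mat T" and L: "L > 0"
  shows "spectral_cdf T = cdf (atomic_measure L (\<lambda>_. 1 / real L) (\<lambda>i. Re (T $$ (i, i))))"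
proof
  fix x
  have "upper_triangular T" using T by (auto simp: diagonal_mat_def upper_triangular_def)
  hence "char_poly T = (\<Prod>a\<leftarrow>map (\<lambda>i. T $$ (i, i)) [0..<L]. [:- a, 1:])"
    using char_poly_upper_triangular[OF T(1)] T(1) by (simp add: diag_mat_def)
  hence "proots (char_poly T) = mset (map (\<lambda>i. T $$ (i, i)) [0..<L])"
    by (simp only: proots_prod_linear_factors)
  thus "spectral_cdf T x = cdf (atomic_measure L (\<lambda>_. 1 / real L) (\<lambda>i. Re (T $$ (i, i)))) x"
    unfolding cdf_uniform_atomic_measure[OF L] spectral_cdf_def
    using T(1) by (simp only: size_filter_mset_mset_map_upt) simp
qed

text \<open>With \<open>u = |y|^2\<close> one has \<open>|u - 1|^4 \<le> 8 (u^4 + 1)\<close>, so the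
  moments of order 4 and 8 suffice. The constant depends on \<open>C\<close> only and is therefore
  the same for all dimensions; the absolute values make it nonnegative.\<close>

lemma (in prob_space) gaussian_like_moment_bound:
  assumes "gaussian_like M C p q G"
  shows "\<exists>Y. Y \<in> measurable M (mat_borel p q) \<and>
    indep_vars (\<lambda>_. borel) (\<lambda>ij \<omega>. Y \<omega> $$ ij) ({..<p} \<times> {..<q}) \<and>
    (\<forall>i<p. \<forall>j<q. moment_bound (\<bar>C 4\<bar> + 8 * (\<bar>C 8\<bar> + 1)) (\<lambda>\<omega>. Y \<omega> $$ (i, j))) \<and>
    (\<forall>\<omega>\<in>space M. G \<omega> = complex_of_real (1 / sqrt (real q)) \<cdot>\<^sub>m Y \<omega>)"
proof -
  let ?\<kappa> = "\<bar>C 4\<bar> + 8 * (\<bar>C 8\<bar> + 1)"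
  obtain Y where Y: "Y \<in> measurable M (mat_borel p q)"
    "indep_vars (\<lambda>_. borel) (\<lambda>ij \<omega>. Y \<omega> $$ ij) ({..<p} \<times> {..<q})"
    "\<forall>\<omega>\<in>space M. G \<omega> = complex_of_real (1 / sqrt (real q)) \<cdot>\<^sub>m Y \<omega>"
    and Ym: "\<forall>ij \<in> {..<p} \<times> {..<q}.
           integrable M (\<lambda>\<omega>. Y \<omega> $$ ij) \<and> (LINT \<omega>|M. Y \<omega> $$ ij) = 0 \<and>
           integrable M (\<lambda>\<omega>. (cmod (Y \<omega> $$ ij))\<^sup>2) \<and> (LINT \<omega>|M. (cmod (Y \<omega> $$ ij))\<^sup>2) = 1 \<and>
           (\<forall>k>2. integrable M (\<lambda>\<omega>. cmod (Y \<omega> $$ ij) ^ k) \<and>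
                  (LINT \<omega>|M. cmod (Y \<omega> $$ ij) ^ k) \<le> C k)"
    using assms unfolding gaussian_like_def by blast
  have "moment_bound ?\<kappa> (\<lambda>\<omega>. Y \<omega> $$ (i, j))" if "i < p" "j < q" for i j
  proof -
    define y where "y \<omega> = Y \<omega> $$ (i, j)" for \<omega>
    have y1: "integrable M y" "(LINT \<omega>|M. y \<omega>) = 0" and y2: "integrable M (\<lambda>\<omega>. (cmod (y \<omega>))\<^sup>2)" "(LINT \<omega>|M. (cmod (y \<omega>))\<^sup>2) = 1"
      and yk: "\<And>k. k > 2 \<Longrightarrow> integrable M (\<lambda>\<omega>. cmod (y \<omega>) ^ k)" "\<And>k. k > 2 \<Longrightarrow> (LINT \<omega>|M. cmod (y \<omega>) ^ k) \<le> C k"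
      using bspec[OF Ym, of "(i, j)"] that unfolding y_def[abs_def] by auto
    have [measurable]: "y \<in> borel_measurable M" using y1(1) by auto
    have iZ: "integrable M (\<lambda>\<omega>. complex_of_real ((cmod (y \<omega>))\<^sup>2))"
      using y2(1) by (rule integrable_of_real)
    have Z: "(LINT \<omega>|M. complex_of_real ((cmod (y \<omega>))\<^sup>2) - 1) = 0"
    proof -
      have "(LINT \<omega>|M. complex_of_real ((cmod (y \<omega>))\<^sup>2) - 1) = (LINT \<omega>|M. complex_of_real ((cmod (y \<omega>))\<^sup>2)) - (LINT \<omega>|M. 1)"
        by (intro Bochner_Integration.integral_diff iZ) simp
      also have "(LINT \<omega>|M. complex_of_real ((cmod (y \<omega>))\<^sup>2)) = 1"
        unfolding integral_complex_of_real y2(2) by simp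
      finally show ?thesis using prob_space by simp
    qed
    have pw: "cmod (complex_of_real ((cmod x)\<^sup>2) - 1) ^ 4 \<le> 8 * (cmod x ^ 8 + 1)" for x
    proof -
      define u where "u = (cmod x)\<^sup>2"
      have "complex_of_real ((cmod x)\<^sup>2) - 1 = complex_of_real (u - 1)" by (simp add: u_def)
      hence "cmod (complex_of_real ((cmod x)\<^sup>2) - 1) ^ 4 = \<bar>u - 1\<bar> ^ 4" by (simp only: norm_of_real)
      also have "\<dots> = ((u - 1)\<^sup>2)\<^sup>2" by simp
      also have "\<dots> \<le> (2 * (u\<^sup>2 + 1))\<^sup>2"
      proof (rule power_mono)
        have "0 \<le> (u + 1)\<^sup>2" by simp
        thus "(u - 1)\<^sup>2 \<le> 2 * (u\<^sup>2 + 1)" by (simp add: power2_eq_square algebra_simps)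
      qed simp
      also have "\<dots> \<le> 8 * ((u\<^sup>2)\<^sup>2 + 1)"
        using zero_le_power2[of "u\<^sup>2 - 1"] by (simp add: power2_eq_square algebra_simps)
      also have "(u\<^sup>2)\<^sup>2 = cmod x ^ 8" by (simp add: u_def)
      finally show ?thesis .
    qed
    have i8: "integrable M (\<lambda>\<omega>. 8 * (cmod (y \<omega>) ^ 8 + 1))" using yk(1)[of 8] by simp
    have iZ4: "integrable M (\<lambda>\<omega>. cmod (complex_of_real ((cmod (y \<omega>))\<^sup>2) - 1) ^ 4)"
    proof (rule Bochner_Integration.integrable_bound[OF i8])
      show "AE \<omega> in M. norm (cmod (complex_of_real ((cmod (y \<omega>))\<^sup>2) - 1) ^ 4) \<le> norm (8 * (cmod (y \<omega>) ^ 8 + 1))"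
      proof (rule AE_I2)
        fix \<omega>
        have "0 \<le> 8 * (cmod (y \<omega>) ^ 8 + 1)" by (intro mult_nonneg_nonneg add_nonneg_nonneg) auto
        thus "norm (cmod (complex_of_real ((cmod (y \<omega>))\<^sup>2) - 1) ^ 4) \<le> norm (8 * (cmod (y \<omega>) ^ 8 + 1))"
          using pw[of "y \<omega>"] by (simp only: real_norm_def abs_of_nonneg zero_le_power norm_ge_zero)
      qed
    qed measurable
    have "(LINT \<omega>|M. cmod (complex_of_real ((cmod (y \<omega>))\<^sup>2) - 1) ^ 4) \<le> (LINT \<omega>|M. 8 * (cmod (y \<omega>) ^ 8 + 1))"
      by (intro integral_mono iZ4 i8 pw)
    also have "\<dots> = 8 * ((LINT \<omega>|M. cmod (y \<omega>) ^ 8) + 1)"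
    proof -
      have "(LINT \<omega>|M. cmod (y \<omega>) ^ 8 + 1) = (LINT \<omega>|M. cmod (y \<omega>) ^ 8) + (LINT \<omega>|M. 1)"
        using yk(1)[of 8] by (intro Bochner_Integration.integral_add) auto
      thus ?thesis using prob_space by (simp only: integral_mult_right_zero) simp
    qed
    also have "\<dots> \<le> ?\<kappa>" using yk(2)[of 8] by (intro add_increasing mult_left_mono add_mono) auto
    finally have Z4: "(LINT \<omega>|M. cmod (complex_of_real ((cmod (y \<omega>))\<^sup>2) - 1) ^ 4) \<le> ?\<kappa>" .
    have "C 4 \<le> ?\<kappa>" by (simp add: add_increasing2)
    hence y4: "(LINT \<omega>|M. cmod (y \<omega>) ^ 4) \<le> ?\<kappa>" using yk(2)[of 4] by simp
    show ?thesis
      unfolding moment_bound_def y_def[symmetric]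
      using y1 yk(1)[of 4] y4 Bochner_Integration.integrable_diff[OF iZ, of "\<lambda>_. 1"] Z iZ4 Z4 by simp
  qed
  with Y show ?thesis by blast
qed

lemma borel_measurable_clip_entry:
  assumes "X \<in> measurable M (mat_borel k k)" "i < k"
  shows "(\<lambda>\<omega>. clip \<Lambda> (Re (X \<omega> $$ (i, i)))) \<in> borel_measurable M"
proof -
  have [measurable]: "(\<lambda>\<omega>. X \<omega> $$ (i, i)) \<in> borel_measurable M"
    by (rule mat_borel_entry[OF assms(1,2,2)])
  show ?thesis unfolding clip_def by measurable
qed

text \<open>The pair of \<open>A\<close> and \<open>T\<close> is independent of \<open>G\<close>, so
  both are frozen and the bound for a deterministic matrix and deterministic weights is integrated.
  The indices 0, 1, 2 stand for \<open>A\<close>, \<open>T\<close>, \<open>G\<close>.\<close>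

lemma (in prob_space) qdev_sum_expectation:
  fixes A T G :: "'a \<Rightarrow> complex mat" and \<Lambda> :: real
  assumes L: "L \<ge> 1" and n: "n > 0"
    and A: "A \<in> measurable M (mat_borel n n)" "\<And>\<omega>. \<omega> \<in> space M \<Longrightarrow> mat_adjoint (A \<omega>) = A \<omega>"
    and T: "T \<in> measurable M (mat_borel L L)"
    and G: "gaussian_like M C L n G"
    and ind: "indep_vars (\<lambda>k. [mat_borel n n, mat_borel L L, mat_borel L n] ! k) (\<lambda>k. [A, T, G] ! k) {..<3}"
    and z: "Im z \<ge> 1" and w: "Im w \<ge> 1"
  defines "\<kappa> \<equiv> \<bar>C 4\<bar> + 8 * (\<bar>C 8\<bar> + 1)"
  defines "f \<equiv> \<lambda>\<omega>. qdev_sum n L z w (A \<omega>) (\<lambda>i. clip \<Lambda> (Re (T \<omega> $$ (i, i)))) (G \<omega>) / real L"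
  shows "f \<in> borel_measurable M"
    "(\<integral>\<^sup>+\<omega>. ennreal (f \<omega>) \<partial>M) \<le> ennreal (3 * ((4 * sqrt (27 * \<kappa> * (1 + 16 * \<kappa>)))\<^sup>2 / (real n)\<^sup>2))"
proof -
  let ?K = "3 * ((4 * sqrt (27 * \<kappa> * (1 + 16 * \<kappa>)))\<^sup>2 / (real n)\<^sup>2)"
  have \<kappa>: "\<kappa> \<ge> 0" by (simp add: \<kappa>_def)
  obtain Y where Y: "Y \<in> measurable M (mat_borel L n)"
    "indep_vars (\<lambda>_. borel) (\<lambda>ij \<omega>. Y \<omega> $$ ij) ({..<L} \<times> {..<n})"
    and Y': "\<forall>i<L. \<forall>j<n. moment_bound \<kappa> (\<lambda>\<omega>. Y \<omega> $$ (i, j))"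
    "\<forall>\<omega>\<in>space M. G \<omega> = complex_of_real (1 / sqrt (real n)) \<cdot>\<^sub>m Y \<omega>"
    using gaussian_like_moment_bound[OF G] unfolding \<kappa>_def[symmetric] by (elim exE conjE)
  have Ymb: "moment_bound \<kappa> (\<lambda>\<omega>. Y \<omega> $$ (i, j))" if "i < L" "j < n" for i j using Y'(1) that by simp
  have YG: "G \<omega> = complex_of_real (1 / sqrt (real n)) \<cdot>\<^sub>m Y \<omega>" if "\<omega> \<in> space M" for \<omega> using Y'(2) that by simp
  define M' where "M' = (\<lambda>k::nat. [mat_borel n n, mat_borel L L, mat_borel L n] ! k)"
  define X where "X = (\<lambda>k::nat. [A, T, G] ! k)"
  have M': "M' 0 = mat_borel n n" "M' 1 = mat_borel L L" "M' 2 = mat_borel L n" by (simp_all add: M'_def)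
  have X: "X 0 = A" "X 1 = T" "X 2 = G" by (simp_all add: X_def)
  note ind' = ind[folded M'_def X_def]
  have "X 2 \<in> measurable M (M' 2)" using ind' unfolding indep_vars_def by simp
  hence mG: "G \<in> measurable M (mat_borel L n)" by (simp only: M' X)
  show "f \<in> borel_measurable M"
    unfolding f_def
    by (rule borel_measurable_divide[OF borel_measurable_qdev_sum[OF A(1) mG borel_measurable_clip_entry[OF T]] borel_measurable_const])
  define F :: "(nat \<Rightarrow> complex mat) \<times> (nat \<Rightarrow> complex mat) \<Rightarrow> ennreal"
    where "F = (\<lambda>(a, g). ennreal (qdev_sum n L z w (a 0) (\<lambda>i. clip \<Lambda> (Re (a 1 $$ (i, i)))) (g 2) / real L))"
  let ?P = "PiM {0, 1} M'" and ?R = "PiM {2} M'"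
  define PX where "PX \<omega> = restrict (\<lambda>k. X k \<omega>) {0, 1}" for \<omega>
  define RX where "RX \<omega> = restrict (\<lambda>k. X k \<omega>) {2}" for \<omega>
  have PX: "PX \<omega> 0 = A \<omega>" "PX \<omega> 1 = T \<omega>" "RX \<omega> 2 = G \<omega>" for \<omega>
    by (simp_all add: PX_def RX_def X X(2)[unfolded One_nat_def])
  have iv: "indep_var ?P PX ?R RX"
    unfolding PX_def[abs_def] RX_def[abs_def] by (rule indep_var_restrict[OF ind']) auto
  have a0: "(\<lambda>p. fst p 0) \<in> measurable (?P \<Otimes>\<^sub>M ?R) (mat_borel n n)"
    unfolding M'(1)[symmetric] by (rule measurable_compose[OF measurable_fst measurable_component_singleton]) simp
  have a1: "(\<lambda>p. fst p 1) \<in> measurable (?P \<Otimes>\<^sub>M ?R) (mat_borel L L)"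
    unfolding M'(2)[symmetric] by (rule measurable_compose[OF measurable_fst measurable_component_singleton]) simp
  have a2: "(\<lambda>p. snd p 2) \<in> measurable (?P \<Otimes>\<^sub>M ?R) (mat_borel L n)"
    unfolding M'(3)[symmetric] by (rule measurable_compose[OF measurable_snd measurable_component_singleton]) simp
  have "(\<lambda>p. qdev_sum n L z w (fst p 0) (\<lambda>i. clip \<Lambda> (Re (fst p 1 $$ (i, i)))) (snd p 2) / real L) \<in> borel_measurable (?P \<Otimes>\<^sub>M ?R)"
    by (rule borel_measurable_divide[OF borel_measurable_qdev_sum[OF a0 a2 borel_measurable_clip_entry[OF a1]] borel_measurable_const])
  hence mF: "F \<in> borel_measurable (?P \<Otimes>\<^sub>M ?R)"
    unfolding F_def case_prod_beta by (rule measurable_compose[OF _ measurable_ennreal])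
  have "(\<integral>\<^sup>+\<omega>. F (PX \<omega>, RX \<omega>) \<partial>M) \<le> ennreal ?K"
  proof (rule nn_integral_indep_bound[OF iv mF])
    fix \<omega>\<^sub>1 assume \<omega>: "\<omega>\<^sub>1 \<in> space M"
    define \<tau> where "\<tau> i = clip \<Lambda> (Re (T \<omega>\<^sub>1 $$ (i, i)))" for i
    have Ah: "hermitian_mat n (A \<omega>\<^sub>1)"
      using mat_borel_carrier[OF A(1) \<omega>] A(2)[OF \<omega>] by (simp add: hermitian_mat_def)
    have Lp: "real L > 0" using L by simp
    have mq: "(\<lambda>\<omega>. qdev_sum n L z w (A \<omega>\<^sub>1) \<tau> (G \<omega>)) \<in> borel_measurable M"
      by (rule borel_measurable_qdev_sum[OF mat_borel_const[OF hermitian_matD(1)[OF Ah]] mG borel_measurable_const])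
    have "F (PX \<omega>\<^sub>1, RX \<omega>) = ennreal (1 / real L) * ennreal (qdev_sum n L z w (A \<omega>\<^sub>1) \<tau> (G \<omega>))" for \<omega>
      using qdev_sum_nonneg[of n L z w "A \<omega>\<^sub>1" \<tau> "G \<omega>"] unfolding F_def case_prod_conv PX \<tau>_def[symmetric]
      by (subst ennreal_mult[symmetric]) auto
    hence "(\<integral>\<^sup>+\<omega>. F (PX \<omega>\<^sub>1, RX \<omega>) \<partial>M) = (\<integral>\<^sup>+\<omega>. ennreal (1 / real L) * ennreal (qdev_sum n L z w (A \<omega>\<^sub>1) \<tau> (G \<omega>)) \<partial>M)"
      by (simp only:)
    also have "\<dots> = ennreal (1 / real L) * (\<integral>\<^sup>+\<omega>. ennreal (qdev_sum n L z w (A \<omega>\<^sub>1) \<tau> (G \<omega>)) \<partial>M)"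
      by (rule nn_integral_cmult) (rule measurable_compose[OF mq measurable_ennreal])
    also have "\<dots> \<le> ennreal (1 / real L) * ennreal (real L * ?K)"
      by (rule mult_left_mono[OF qdev_sum_bound[OF Y(2) \<kappa> n Ymb mat_borel_carrier[OF Y(1)] YG Ah z w]]) auto
    also have "\<dots> = ennreal (1 / real L * (real L * ?K))"
      by (intro ennreal_mult[symmetric]) auto
    also have "1 / real L * (real L * ?K) = ?K"
      using Lp by simp
    finally show "(\<integral>\<^sup>+\<omega>. F (PX \<omega>\<^sub>1, RX \<omega>) \<partial>M) \<le> ennreal ?K" .
  qed
  moreover have "F (PX \<omega>, RX \<omega>) = ennreal (f \<omega>)" for \<omega>
    unfolding F_def case_prod_conv PX f_def ..
  ultimately show "(\<integral>\<^sup>+\<omega>. ennreal (f \<omega>) \<partial>M) \<le> ennreal ?K" by simp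
qed

lemma (in prob_space) AE_qdev_sum_limit:
  fixes A T G :: "nat \<Rightarrow> 'a \<Rightarrow> complex mat" and L :: "nat \<Rightarrow> nat"
  assumes L: "\<And>N. N \<ge> 1 \<Longrightarrow> L N \<ge> 1"
    and A: "\<And>N. N \<ge> 1 \<Longrightarrow> A N \<in> measurable M (mat_borel N N)"
      "\<And>N \<omega>. N \<ge> 1 \<Longrightarrow> \<omega> \<in> space M \<Longrightarrow> mat_adjoint (A N \<omega>) = A N \<omega>"
    and T: "\<And>N. N \<ge> 1 \<Longrightarrow> T N \<in> measurable M (mat_borel (L N) (L N))"
    and G: "\<And>N. N \<ge> 1 \<Longrightarrow> gaussian_like M C (L N) N (G N)"
    and ind: "\<And>N. N \<ge> 1 \<Longrightarrow> indep_vars (\<lambda>k. [mat_borel N N, mat_borel (L N) (L N), mat_borel (L N) N] ! k)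
             (\<lambda>k. [A N, T N, G N] ! k) {..<3}"
    and z: "Im z \<ge> 1" and w: "Im w \<ge> 1"
  shows "AE \<omega> in M. (\<lambda>N. qdev_sum N (L N) z w (A N \<omega>) (\<lambda>i. clip \<Lambda> (Re (T N \<omega> $$ (i, i)))) (G N \<omega>) / real (L N)) \<longlonglongrightarrow> 0"
proof -
  define \<kappa> where "\<kappa> = \<bar>C 4\<bar> + 8 * (\<bar>C 8\<bar> + 1)"
  define K where "K = (4 * sqrt (27 * \<kappa> * (1 + 16 * \<kappa>)))\<^sup>2"
  define c where "c n = 3 * (K / (real (Suc n))\<^sup>2)" for n
  have "summable (\<lambda>n. 3 * (K * inverse ((real n)\<^sup>2)))"
    by (intro summable_mult inverse_power_summable) simp
  hence "summable (\<lambda>n. 3 * (K * inverse ((real (Suc n))\<^sup>2)))" by (subst summable_Suc_iff)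
  hence c1: "summable c" by (simp add: c_def[abs_def] divide_inverse)
  have c2: "0 \<le> c n" for n by (simp add: c_def K_def)
  define f where "f N \<omega> = qdev_sum N (L N) z w (A N \<omega>) (\<lambda>i. clip \<Lambda> (Re (T N \<omega> $$ (i, i)))) (G N \<omega>) / real (L N)" for N \<omega>
  have f0: "0 \<le> f N \<omega>" for N \<omega> by (simp add: f_def qdev_sum_nonneg)
  have m: "f (Suc n) \<in> borel_measurable M" for n
    unfolding f_def by (rule qdev_sum_expectation(1)[OF L _ A T G ind z w]) simp_all
  have e: "(\<integral>\<^sup>+\<omega>. ennreal (f (Suc n) \<omega>) \<partial>M) \<le> ennreal (c n)" for n
    unfolding f_def c_def K_def \<kappa>_def by (rule qdev_sum_expectation(2)[OF L _ A T G ind z w]) simp_all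
  have "AE \<omega> in M. (\<lambda>N. f N \<omega>) \<longlonglongrightarrow> 0"
    by (rule AE_LIMSEQ_0_of_summable_expectation[OF m f0 e c1 c2])
  thus ?thesis unfolding f_def .
qed

text \<open>The average over the diagonal is an integral against the spectral distribution of
  \<open>T N\<close>. This is a probability measure for \<open>N \<ge> 1\<close>, whence the shift
  by \<open>Suc\<close>.\<close>

lemma diagonal_average_limit:
  fixes f :: "real \<Rightarrow> 'b :: {banach, second_countable_topology}" and T :: "nat \<Rightarrow> complex mat" and L :: "nat \<Rightarrow> nat"
  assumes T: "\<And>N. N \<ge> 1 \<Longrightarrow> T N \<in> carrier_mat (L N) (L N)" "\<And>N. N \<ge> 1 \<Longrightarrow> diagonal_mat (T N)"
    and L: "\<And>N. N \<ge> 1 \<Longrightarrow> L N \<ge> 1" and \<mu>: "real_distribution \<mu>"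
    and conv: "weak_conv (\<lambda>N. spectral_cdf (T N)) (cdf \<mu>)"
    and f: "continuous_on UNIV f" "\<And>x. norm (f x) \<le> B"
  shows "(\<lambda>N. (\<Sum>i<L N. f (Re (T N $$ (i, i)))) /\<^sub>R real (L N)) \<longlonglongrightarrow> integral\<^sup>L \<mu> f"
proof -
  define \<nu> where "\<nu> N = atomic_measure (L (Suc N)) (\<lambda>_. 1 / real (L (Suc N))) (\<lambda>i. Re (T (Suc N) $$ (i, i)))" for N
  have Lp: "L (Suc N) > 0" for N using L[of "Suc N"] by simp
  have p: "\<And>k. k < L (Suc N) \<Longrightarrow> 0 \<le> 1 / real (L (Suc N))" "(\<Sum>k<L (Suc N). 1 / real (L (Suc N))) = 1" for N
    using Lp[of N] by auto
  have "cdf (\<nu> N) = spectral_cdf (T (Suc N))" for N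
    unfolding \<nu>_def using T[of "Suc N"] Lp[of N] by (intro diagonal_spectral_cdf[symmetric]) auto
  hence wc: "weak_conv_m \<nu> \<mu>"
    using conv by (auto simp: weak_conv_m_def weak_conv_def intro!: LIMSEQ_Suc)
  have rd: "real_distribution (\<nu> N)" for N
    unfolding \<nu>_def by (rule real_distribution_atomic_measure[OF p])
  have "(\<lambda>N. integral\<^sup>L (\<nu> N) f) \<longlonglongrightarrow> integral\<^sup>L \<mu> f"
    by (rule weak_conv_imp_integral_bdd_continuous_conv[OF rd \<mu> wc, where B = B])
       (use f in \<open>auto simp: continuous_on_eq_continuous_at\<close>)
  moreover have "integral\<^sup>L (\<nu> N) f = (\<Sum>i<L (Suc N). f (Re (T (Suc N) $$ (i, i)))) /\<^sub>R real (L (Suc N))" for N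
    unfolding \<nu>_def using f(1)
    by (subst integral_atomic_measure[OF p])
       (auto intro: borel_measurable_continuous_onI simp: scaleR_sum_right divide_inverse)
  ultimately show ?thesis by (subst filterlim_sequentially_Suc[symmetric]) simp
qed

section \<open>The fixed point equation\<close>

text \<open>The shift \<open>(1 / c) \<integral> x / (1 + x m) dF\<^sup>T(x)\<close> of the spectral parameter.\<close>

definition spectral_shift :: "nat \<Rightarrow> (nat \<Rightarrow> real) \<Rightarrow> (nat \<Rightarrow> real) \<Rightarrow> real \<Rightarrow> complex \<Rightarrow> complex" where
  "spectral_shift K p l c m = (\<Sum>k<K. of_real (p k * l k / c) / (1 + of_real (l k) * m))"

text \<open>Candidates for the fixed point lie in the disc of radius \<open>2 / y\<close>, and there
  \<open>|x m| \<le> 2 \<Lambda> / y \<le> 1 / 2\<close>.\<close>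

lemma one_plus_mult_bound:
  assumes "\<bar>x\<bar> \<le> \<Lambda>" "y \<ge> 4 * \<Lambda>" "y > 0" "cmod m \<le> 2 / y"
  shows "cmod (1 + complex_of_real x * m) \<ge> 1 / 2"
proof -
  have "cmod (complex_of_real x * m) \<le> \<Lambda> * (2 / y)"
    unfolding norm_mult using assms by (intro mult_mono) auto
  also have "\<dots> \<le> 1 / 2" using assms by (simp add: field_simps)
  finally have "cmod (complex_of_real x * m) \<le> 1 / 2" .
  moreover have "1 - cmod (complex_of_real x * m) \<le> cmod (1 + complex_of_real x * m)"
    using norm_diff_ineq[of 1 "complex_of_real x * m"] by simp
  ultimately show ?thesis by linarith
qed

text \<open>All denominators have modulus at least 1/2, which costs a factor 2 in the bound and a
  factor 4 in the Lipschitz constant; the weights sum to 1.\<close>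

lemma spectral_shift_bounds:
  assumes p: "\<And>k. k < K \<Longrightarrow> p k \<ge> 0" "(\<Sum>k<K. p k) = 1" and l: "\<And>k. k < K \<Longrightarrow> \<bar>l k\<bar> \<le> \<Lambda>" and c: "c > 0"
    and y: "y \<ge> 4 * \<Lambda>" "y > 0" and \<Lambda>: "\<Lambda> \<ge> 0"
  shows "cmod m \<le> 2 / y \<Longrightarrow> cmod (spectral_shift K p l c m) \<le> 2 * \<Lambda> / c"
    and "cmod m \<le> 2 / y \<Longrightarrow> cmod m' \<le> 2 / y \<Longrightarrow> cmod (spectral_shift K p l c m - spectral_shift K p l c m') \<le> 4 * \<Lambda>\<^sup>2 / c * cmod (m - m')"
proof -
  have den: "1 / 2 \<le> cmod (1 + of_real (l k) * m)" if "k < K" "cmod m \<le> 2 / y" for k m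
    using one_plus_mult_bound[OF l[OF that(1)] y that(2)] .
  {
    assume m: "cmod m \<le> 2 / y"
    have "cmod (spectral_shift K p l c m) \<le> (\<Sum>k<K. p k * (2 * \<Lambda> / c))"
      unfolding spectral_shift_def
    proof (rule sum_norm_le)
      fix k assume "k \<in> {..<K}"
      hence k: "k < K" by simp
      have "cmod (of_real (p k * l k / c) / (1 + of_real (l k) * m)) = p k * \<bar>l k\<bar> / c / cmod (1 + of_real (l k) * m)"
        using p(1)[OF k] c by (simp add: norm_divide norm_mult)
      also have "\<dots> \<le> p k * \<Lambda> / c / (1 / 2)"
        using p(1)[OF k] l[OF k] c den[OF k m] \<Lambda> by (intro frac_le divide_right_mono mult_left_mono) auto
      also have "p k * \<Lambda> / c / (1 / 2) = p k * (2 * \<Lambda> / c)" by simp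
      finally show "cmod (of_real (p k * l k / c) / (1 + of_real (l k) * m)) \<le> p k * (2 * \<Lambda> / c)" .
    qed
    also have "\<dots> = 2 * \<Lambda> / c" unfolding sum_distrib_right[symmetric] p(2) by simp
    finally show "cmod (spectral_shift K p l c m) \<le> 2 * \<Lambda> / c" .
  }
  {
    assume m: "cmod m \<le> 2 / y" "cmod m' \<le> 2 / y"
    have "cmod (spectral_shift K p l c m - spectral_shift K p l c m') \<le> (\<Sum>k<K. p k * (4 * \<Lambda>\<^sup>2 / c * cmod (m - m')))"
      unfolding spectral_shift_def sum_subtractf[symmetric]
    proof (rule sum_norm_le)
      fix k assume "k \<in> {..<K}"
      hence k: "k < K" by simp
      let ?a = "1 + complex_of_real (l k) * m" and ?b = "1 + complex_of_real (l k) * m'"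
      have ab: "1 / 2 \<le> cmod ?a" "1 / 2 \<le> cmod ?b" using den[OF k] m by auto
      hence nz: "?a \<noteq> 0" "?b \<noteq> 0" by auto
      have "q / a - q / b = q * (b - a) / (a * b)" if "a \<noteq> 0" "b \<noteq> 0" for q a b :: complex
        using that by (simp add: field_simps)
      from this[OF nz, of "of_real (p k * l k / c)"]
      have "of_real (p k * l k / c) / ?a - of_real (p k * l k / c) / ?b = of_real (p k * l k / c) * (?b - ?a) / (?a * ?b)" .
      also have "?b - ?a = of_real (l k) * (m' - m)" by (simp add: algebra_simps)
      finally have "cmod (of_real (p k * l k / c) / ?a - of_real (p k * l k / c) / ?b) =
          p k * \<bar>l k\<bar> / c * (\<bar>l k\<bar> * cmod (m - m')) / (cmod ?a * cmod ?b)"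
        using p(1)[OF k] c by (simp add: norm_divide norm_mult norm_minus_commute)
      also have "\<dots> \<le> p k * \<Lambda> / c * (\<Lambda> * cmod (m - m')) / (1 / 2 * (1 / 2))"
        using p(1)[OF k] l[OF k] c ab \<Lambda>
        by (intro frac_le mult_mono divide_right_mono mult_left_mono mult_nonneg_nonneg divide_nonneg_pos) auto
      also have "p k * \<Lambda> / c * (\<Lambda> * cmod (m - m')) / (1 / 2 * (1 / 2)) = p k * (4 * \<Lambda>\<^sup>2 / c * cmod (m - m'))"
        by (simp add: power2_eq_square)
      finally show "cmod (of_real (p k * l k / c) / ?a - of_real (p k * l k / c) / ?b) \<le> p k * (4 * \<Lambda>\<^sup>2 / c * cmod (m - m'))" .
    qed
    also have "\<dots> = 4 * \<Lambda>\<^sup>2 / c * cmod (m - m')" unfolding sum_distrib_right[symmetric] p(2) by simp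
    finally show "cmod (spectral_shift K p l c m - spectral_shift K p l c m') \<le> 4 * \<Lambda>\<^sup>2 / c * cmod (m - m')" .
  }
qed

text \<open>On the disc of radius \<open>2 / y\<close> the shift is at most
  \<open>2 \<Lambda> / c \<le> y / 2\<close>, so the shifted point has height at least
  \<open>y / 2\<close> and the image stays in the disc. The Lipschitz constant is the product of
  \<open>4 / y^2\<close> for the transform and \<open>4 \<Lambda>^2 / c\<close> for the shift, which
  is at most 1/2 because \<open>y^2 \<ge> 32 \<Lambda>^2 / c\<close>.\<close>

lemma fixed_point_exists:
  assumes \<mu>: "real_distribution \<mu>"
    and p: "\<And>k. k < K \<Longrightarrow> p k \<ge> 0" "(\<Sum>k<K. p k) = 1" and l: "\<And>k. k < K \<Longrightarrow> \<bar>l k\<bar> \<le> \<Lambda>" and c: "c > 0" and \<Lambda>: "\<Lambda> \<ge> 0"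
    and y: "y \<ge> 4 * \<Lambda>" "y \<ge> 4 * \<Lambda> / c" "y > 0" "y\<^sup>2 \<ge> 32 * \<Lambda>\<^sup>2 / c"
  shows "\<exists>m. cmod m \<le> 2 / y \<and> stieltjes_transform \<mu> (Complex 0 y - spectral_shift K p l c m) = m"
proof -
  interpret real_distribution \<mu> by (rule \<mu>)
  have sb1: "cmod (spectral_shift K p l c m) \<le> 2 * \<Lambda> / c" if "cmod m \<le> 2 / y" for m
    by (rule spectral_shift_bounds(1)[where y = y]) (use p l c y \<Lambda> that in auto)
  have sb2: "cmod (spectral_shift K p l c m - spectral_shift K p l c m') \<le> 4 * \<Lambda>\<^sup>2 / c * cmod (m - m')"
    if "cmod m \<le> 2 / y" "cmod m' \<le> 2 / y" for m m'
    by (rule spectral_shift_bounds(2)[where y = y]) (use p l c y \<Lambda> that in auto)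
  have im: "Im (Complex 0 y - spectral_shift K p l c m) \<ge> y / 2" if "cmod m \<le> 2 / y" for m
  proof -
    have "Im (spectral_shift K p l c m) \<le> 2 * \<Lambda> / c" using abs_Im_le_cmod[of "spectral_shift K p l c m"] sb1[OF that] by linarith
    also have "\<dots> \<le> y / 2" using y(2) by simp
    finally show ?thesis by simp
  qed
  have "\<exists>!m \<in> cball 0 (2 / y). stieltjes_transform \<mu> (Complex 0 y - spectral_shift K p l c m) = m"
  proof (rule Banach_fix[OF compact_imp_complete[OF compact_cball], where c = "1 / 2"])
    show "cball (0 :: complex) (2 / y) \<noteq> {}" using y by simp
    show "(\<lambda>m. stieltjes_transform \<mu> (Complex 0 y - spectral_shift K p l c m)) ` cball 0 (2 / y) \<subseteq> cball 0 (2 / y)"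
    proof safe
      fix m :: complex assume "m \<in> cball 0 (2 / y)"
      hence i: "Im (Complex 0 y - spectral_shift K p l c m) \<ge> y / 2" by (intro im) simp
      have "cmod (stieltjes_transform \<mu> (Complex 0 y - spectral_shift K p l c m)) \<le> 1 / Im (Complex 0 y - spectral_shift K p l c m)"
        using i y by (intro stieltjes_bound) linarith
      also have "\<dots> \<le> 1 / (y / 2)" using i y by (intro divide_left_mono) (auto intro!: mult_pos_pos simp del: minus_complex.sel)
      finally show "stieltjes_transform \<mu> (Complex 0 y - spectral_shift K p l c m) \<in> cball 0 (2 / y)" by simp
    qed
    fix m m' :: complex assume "m \<in> cball 0 (2 / y)" "m' \<in> cball 0 (2 / y)"
    hence mm: "cmod m \<le> 2 / y" "cmod m' \<le> 2 / y" by simp_all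
    let ?z = "\<lambda>m. Complex 0 y - spectral_shift K p l c m"
    have "cmod (stieltjes_transform \<mu> (?z m) - stieltjes_transform \<mu> (?z m')) \<le> cmod (?z m - ?z m') / (Im (?z m') * Im (?z m))"
      using im[OF mm(1)] im[OF mm(2)] y(3) by (intro stieltjes_lipschitz) linarith+
    also have "\<dots> \<le> cmod (?z m - ?z m') / (y / 2 * (y / 2))"
    proof -
      have "X / (b * a) \<le> X / (y / 2 * (y / 2))" if "0 \<le> X" "y / 2 \<le> a" "y / 2 \<le> b" for X a b
        using that y(3) by (intro divide_left_mono mult_mono mult_pos_pos) auto
      from this[OF norm_ge_zero im[OF mm(1)] im[OF mm(2)]] show ?thesis .
    qed
    also have "cmod (?z m - ?z m') = cmod (spectral_shift K p l c m - spectral_shift K p l c m')"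
      by (simp add: norm_minus_commute)
    also have "cmod (spectral_shift K p l c m - spectral_shift K p l c m') / (y / 2 * (y / 2)) \<le> (4 * \<Lambda>\<^sup>2 / c * cmod (m - m')) / (y / 2 * (y / 2))"
      using y(3) by (intro divide_right_mono sb2 mm) auto
    also have "\<dots> = (32 * \<Lambda>\<^sup>2 / c) / y\<^sup>2 * (cmod (m - m') / 2)"
      by (simp add: power2_eq_square)
    also have "\<dots> \<le> 1 * (cmod (m - m') / 2)"
    proof (rule mult_right_mono)
      have "y\<^sup>2 > 0" using y(3) by simp
      thus "32 * \<Lambda>\<^sup>2 / c / y\<^sup>2 \<le> 1" using y(4) by (simp only: divide_le_eq_1_pos)
    qed simp
    finally show "dist (stieltjes_transform \<mu> (?z m)) (stieltjes_transform \<mu> (?z m')) \<le> 1 / 2 * dist m m'"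
      by (simp add: dist_norm)
  qed auto
  thus ?thesis by auto
qed

section \<open>Limits for one realization, then for almost every one\<close>

lemma continuous_on_clip: "continuous_on UNIV (clip \<Lambda>)"
  unfolding clip_def by (intro continuous_intros)

lemma clip_bound: "\<Lambda> \<ge> 0 \<Longrightarrow> \<bar>clip \<Lambda> x\<bar> \<le> \<Lambda>"
  by (auto simp: clip_def)

lemma clip_eq: "\<bar>x\<bar> \<le> \<Lambda> \<Longrightarrow> clip \<Lambda> x = x"
  by (auto simp: clip_def)

text \<open>Purely deterministic: a realization is fixed, and the probabilistic input about
  \<open>G\<close> is contained in the hypothesis \<open>q\<close>. The margin 1 between the atoms
  and \<open>\<Lambda>\<close> lets a continuous function detect clipped entries.\<close>

lemma perturbed_resolvent_limit:
  fixes A T G :: "nat \<Rightarrow> complex mat" and L :: "nat \<Rightarrow> nat" and p l :: "nat \<Rightarrow> real" and c \<Lambda> y :: real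
  assumes L: "\<And>N. N \<ge> 1 \<Longrightarrow> L N \<ge> 1"
    and A: "\<And>N. N \<ge> 1 \<Longrightarrow> hermitian_mat N (A N)"
    and T: "\<And>N. N \<ge> 1 \<Longrightarrow> T N \<in> carrier_mat (L N) (L N)" "\<And>N. N \<ge> 1 \<Longrightarrow> diagonal_mat (T N)"
    and c: "c > 0" "(\<lambda>N. real N / real (L N)) \<longlonglongrightarrow> c"
    and p: "\<And>k. k < K \<Longrightarrow> p k \<ge> 0" "(\<Sum>k<K. p k) = 1" and l: "\<And>k. k < K \<Longrightarrow> \<bar>l k\<bar> \<le> \<Lambda> - 1" and \<Lambda>: "\<Lambda> \<ge> 1"
    and convA: "weak_conv (\<lambda>N. spectral_cdf (A N)) (cdf \<mu>A)" and \<mu>A: "real_distribution \<mu>A"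
    and convT: "weak_conv (\<lambda>N. spectral_cdf (T N)) (cdf (atomic_measure K p l))"
    and y: "y \<ge> 4 * \<Lambda>" "y \<ge> 4 * \<Lambda> / c" "y\<^sup>2 \<ge> 32 * \<Lambda>\<^sup>2 / c"
    and m: "cmod m \<le> 2 / y" "stieltjes_transform \<mu>A (Complex 0 y - spectral_shift K p l c m) = m"
    and q: "(\<lambda>N. qdev_sum N (L N) (Complex 0 y) (Complex 0 y - spectral_shift K p l c m) (A N) (\<lambda>i. clip \<Lambda> (Re (T N $$ (i, i)))) (G N) / real (L N)) \<longlonglongrightarrow> 0"
  shows "(\<lambda>N. mtrace (resolvent (A N + covar N (L N) (\<lambda>i. Re (T N $$ (i, i))) (G N)) (Complex 0 y)) / of_nat N) \<longlonglongrightarrow> m"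
proof -
  have l': "\<bar>l k\<bar> \<le> \<Lambda>" if "k < K" for k using l[OF that] by linarith
  have y0: "y > 0" "y \<ge> 2" and \<Lambda>0: "\<Lambda> \<ge> 0" using y(1) \<Lambda> by linarith+
  let ?z = "Complex 0 y" and ?h = "spectral_shift K p l c m"
  have "cmod ?h \<le> 2 * \<Lambda> / c" by (rule spectral_shift_bounds(1)[where y = y]) (use p l' c y y0 \<Lambda>0 m in auto)
  moreover have "2 * \<Lambda> / c \<le> y / 2" using y(2) by simp
  ultimately have zh: "Im (?z - ?h) \<ge> y / 2" using abs_Im_le_cmod[of ?h] by simp
  have den: "1 / 2 \<le> cmod (1 + complex_of_real x * m)" if "\<bar>x\<bar> \<le> \<Lambda>" for x
    by (rule one_plus_mult_bound[OF that y(1) y0(1) m(1)])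
  have int: "integral\<^sup>L (atomic_measure K p l) f = (\<Sum>k<K. p k *\<^sub>R f (l k))" if "f \<in> borel_measurable borel"
    for f :: "real \<Rightarrow> 'b :: {banach, second_countable_topology}"
    using integral_atomic_measure[of K p f l] p that by auto
  have rd: "real_distribution (atomic_measure K p l)" using real_distribution_atomic_measure[of K p l] p by auto
  have rL: "(\<lambda>N. real (L N) / real N) \<longlonglongrightarrow> 1 / c"
    using tendsto_divide[OF tendsto_const[of 1] c(2)] c(1) by simp
  \<comment> \<open>There are \<open>L N\<close> summands but the division is by \<open>N\<close>,
    so the ratio of the two sizes contributes \<open>1 / c\<close>.\<close>
  have avg: "(\<lambda>N. (\<Sum>i<L N. f (Re (T N $$ (i, i)))) /\<^sub>R real N) \<longlonglongrightarrow> (1 / c) *\<^sub>R (\<Sum>k<K. p k *\<^sub>R f (l k))"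
    if f: "continuous_on UNIV f" "\<And>x. norm (f x) \<le> B" for f :: "real \<Rightarrow> 'b :: {banach, second_countable_topology}" and B
  proof -
    have "(\<lambda>N. (\<Sum>i<L N. f (Re (T N $$ (i, i)))) /\<^sub>R real (L N)) \<longlonglongrightarrow> integral\<^sup>L (atomic_measure K p l) f"
      by (rule diagonal_average_limit[OF T L rd convT f])
    also have "integral\<^sup>L (atomic_measure K p l) f = (\<Sum>k<K. p k *\<^sub>R f (l k))"
      using f(1) by (intro int borel_measurable_continuous_onI)
    finally have "(\<lambda>N. (real (L N) / real N) *\<^sub>R ((\<Sum>i<L N. f (Re (T N $$ (i, i)))) /\<^sub>R real (L N))) \<longlonglongrightarrow> (1 / c) *\<^sub>R (\<Sum>k<K. p k *\<^sub>R f (l k))"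
      by (intro tendsto_scaleR rL)
    moreover have "eventually (\<lambda>N. (real (L N) / real N) *\<^sub>R ((\<Sum>i<L N. f (Re (T N $$ (i, i)))) /\<^sub>R real (L N)) =
        (\<Sum>i<L N. f (Re (T N $$ (i, i)))) /\<^sub>R real N) sequentially"
      using eventually_ge_at_top[of 1]
    proof eventually_elim
      case (elim N)
      thus ?case using L[OF elim] by (simp add: field_simps)
    qed
    ultimately show ?thesis by (rule Lim_transform_eventually)
  qed
  show ?thesis
  proof (rule resolvent_trace_convergence[where c = c and h = ?h and \<Lambda> = \<Lambda>])
    show "(\<lambda>N. (\<Sum>i<L N. of_real (clip \<Lambda> (Re (T N $$ (i, i)))) / (1 + of_real (clip \<Lambda> (Re (T N $$ (i, i)))) * m)) / of_nat N) \<longlonglongrightarrow> ?h"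
    proof -
      define \<phi> where "\<phi> x = complex_of_real (clip \<Lambda> x) / (1 + of_real (clip \<Lambda> x) * m)" for x
      have d: "1 / 2 \<le> cmod (1 + of_real (clip \<Lambda> x) * m)" for x by (rule den[OF clip_bound[OF \<Lambda>0]])
      have "1 + of_real (clip \<Lambda> x) * m \<noteq> 0" for x using d[of x] by auto
      hence "continuous_on UNIV \<phi>"
        unfolding \<phi>_def by (intro continuous_intros continuous_on_clip) auto
      moreover have "cmod (\<phi> x) \<le> \<Lambda> / (1 / 2)" for x
        unfolding \<phi>_def norm_divide norm_of_real using d[of x] clip_bound[OF \<Lambda>0, of x] by (intro frac_le) auto
      ultimately have "(\<lambda>N. (\<Sum>i<L N. \<phi> (Re (T N $$ (i, i)))) /\<^sub>R real N) \<longlonglongrightarrow> (1 / c) *\<^sub>R (\<Sum>k<K. p k *\<^sub>R \<phi> (l k))"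
        by (rule avg)
      also have "(1 / c) *\<^sub>R (\<Sum>k<K. p k *\<^sub>R \<phi> (l k)) = ?h"
        unfolding spectral_shift_def scaleR_sum_right
        by (intro sum.cong refl) (simp add: \<phi>_def clip_eq l' scaleR_conv_of_real)
      finally show ?thesis by (simp add: \<phi>_def scaleR_conv_of_real divide_inverse mult.commute)
    qed
    show "(\<lambda>N. real (card {i. i < L N \<and> Re (T N $$ (i, i)) \<noteq> clip \<Lambda> (Re (T N $$ (i, i)))}) / real N) \<longlonglongrightarrow> 0"
    proof -
      \<comment> \<open>Vanishes at every atom and equals 1 wherever clipping acts, so its average
        bounds the proportion of clipped entries and tends to 0.\<close>
      define \<psi> where "\<psi> x = min 1 (max 0 (\<bar>x\<bar> - (\<Lambda> - 1)))" for x
      have \<psi>: "0 \<le> \<psi> x" "norm (\<psi> x) \<le> 1" for x by (auto simp: \<psi>_def)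
      have "continuous_on UNIV \<psi>" unfolding \<psi>_def by (intro continuous_intros)
      from avg[OF this \<psi>(2)]
      have "(\<lambda>N. (\<Sum>i<L N. \<psi> (Re (T N $$ (i, i)))) /\<^sub>R real N) \<longlonglongrightarrow> (1 / c) *\<^sub>R (\<Sum>k<K. p k *\<^sub>R \<psi> (l k))" .
      also have "(\<Sum>k<K. p k *\<^sub>R \<psi> (l k)) = 0"
        using l by (intro sum.neutral) (auto simp: \<psi>_def)
      finally have lim: "(\<lambda>N. (\<Sum>i<L N. \<psi> (Re (T N $$ (i, i)))) / real N) \<longlonglongrightarrow> 0"
        by (simp add: divide_inverse mult.commute)
      show ?thesis
      proof (rule tendsto_sandwich[OF _ _ tendsto_const lim])
        show "eventually (\<lambda>N. real (card {i. i < L N \<and> Re (T N $$ (i, i)) \<noteq> clip \<Lambda> (Re (T N $$ (i, i)))}) / real N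
            \<le> (\<Sum>i<L N. \<psi> (Re (T N $$ (i, i)))) / real N) sequentially"
        proof (intro always_eventually allI divide_right_mono)
          fix N
          let ?S = "{i. i < L N \<and> Re (T N $$ (i, i)) \<noteq> clip \<Lambda> (Re (T N $$ (i, i)))}"
          have "\<psi> (Re (T N $$ (i, i))) = 1" if "i \<in> ?S" for i
            using that clip_eq[of "Re (T N $$ (i, i))" \<Lambda>] by (fastforce simp: \<psi>_def)
          hence "real (card ?S) = (\<Sum>i\<in>?S. \<psi> (Re (T N $$ (i, i))))" by simp
          also have "\<dots> \<le> (\<Sum>i<L N. \<psi> (Re (T N $$ (i, i))))"
            using \<psi>(1) by (intro sum_mono2) auto
          finally show "real (card ?S) \<le> (\<Sum>i<L N. \<psi> (Re (T N $$ (i, i))))" .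
        qed simp
      qed simp
    qed
    show "(\<lambda>N. mtrace (resolvent (A N) (?z - ?h)) / of_nat N) \<longlonglongrightarrow> m"
    proof -
      have ex: "\<exists>\<nu>. real_distribution \<nu> \<and> cdf \<nu> = spectral_cdf (A (Suc N)) \<and>
          (\<forall>z. Im z > 0 \<longrightarrow> stieltjes_transform \<nu> z = mtrace (resolvent (A (Suc N)) z) / of_nat (Suc N))" for N
      proof -
        have "hermitian_mat (Suc N) (A (Suc N))" by (rule A) simp
        from hermitian_spectral_measure[OF this zero_less_Suc] show ?thesis by metis
      qed
      then obtain \<nu> where \<nu>: "\<And>N. real_distribution (\<nu> N)" "\<And>N. cdf (\<nu> N) = spectral_cdf (A (Suc N))"
        "\<And>N z. Im z > 0 \<Longrightarrow> stieltjes_transform (\<nu> N) z = mtrace (resolvent (A (Suc N)) z) / of_nat (Suc N)"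
        by metis
      have wc: "weak_conv_m \<nu> \<mu>A"
        unfolding weak_conv_m_def weak_conv_def \<nu>(2)
      proof (intro allI impI)
        fix x assume "isCont (cdf \<mu>A) x"
        hence "(\<lambda>N. spectral_cdf (A N) x) \<longlonglongrightarrow> cdf \<mu>A x" using convA by (simp add: weak_conv_def)
        thus "(\<lambda>N. spectral_cdf (A (Suc N)) x) \<longlonglongrightarrow> cdf \<mu>A x" by (rule LIMSEQ_Suc)
      qed
      have pos: "Im (?z - ?h) > 0" using zh y0 by linarith
      from weak_conv_stieltjes[OF \<nu>(1) \<mu>A wc pos]
      have "(\<lambda>N. mtrace (resolvent (A (Suc N)) (?z - ?h)) / of_nat (Suc N)) \<longlonglongrightarrow> m"
        unfolding \<nu>(3)[OF pos] m(2) .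
      thus ?thesis by (rule LIMSEQ_imp_Suc)
    qed
  qed (use A L c y y0 zh \<Lambda>0 den q in auto)
qed

lemma (in prob_space) perturbed_spectral_limit:
  fixes A T G :: "nat \<Rightarrow> 'a \<Rightarrow> complex mat" and L :: "nat \<Rightarrow> nat" and C :: "nat \<Rightarrow> real" and c :: real and \<mu>A \<mu>T :: "real measure"
  assumes L: "\<And>N. N \<ge> 1 \<Longrightarrow> L N \<ge> 1"
    and A: "\<And>N. N \<ge> 1 \<Longrightarrow> A N \<in> measurable M (mat_borel N N)"
      "\<And>N \<omega>. N \<ge> 1 \<Longrightarrow> \<omega> \<in> space M \<Longrightarrow> mat_adjoint (A N \<omega>) = A N \<omega>"
    and T: "\<And>N. N \<ge> 1 \<Longrightarrow> T N \<in> measurable M (mat_borel (L N) (L N))"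
      "\<And>N \<omega>. N \<ge> 1 \<Longrightarrow> \<omega> \<in> space M \<Longrightarrow> diagonal_mat (T N \<omega>) \<and> (\<forall>i<L N. T N \<omega> $$ (i, i) \<in> \<real>)"
    and G: "\<And>N. N \<ge> 1 \<Longrightarrow> gaussian_like M C (L N) N (G N)"
    and ind: "\<And>N. N \<ge> 1 \<Longrightarrow> indep_vars (\<lambda>k. [mat_borel N N, mat_borel (L N) (L N), mat_borel (L N) N] ! k)
             (\<lambda>k. [A N, T N, G N] ! k) {..<3}"
    and limA: "spectral_limit M A \<mu>A" and alg: "algebraic_distribution \<mu>A"
    and limT: "spectral_limit M T \<mu>T" and atomic: "atomic_cdf (cdf \<mu>T)"
    and c: "c > 0" "(\<lambda>N. real N / real (L N)) \<longlonglongrightarrow> c"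
  shows "\<exists>\<mu>B. spectral_limit M (\<lambda>N \<omega>. A N \<omega> + mat_adjoint (G N \<omega>) * T N \<omega> * G N \<omega>) \<mu>B \<and> algebraic_distribution \<mu>B"
proof -
  have \<mu>A: "real_distribution \<mu>A" and \<mu>T: "real_distribution \<mu>T"
    and aeA: "AE \<omega> in M. weak_conv (\<lambda>N. spectral_cdf (A N \<omega>)) (cdf \<mu>A)"
    and aeT: "AE \<omega> in M. weak_conv (\<lambda>N. spectral_cdf (T N \<omega>)) (cdf \<mu>T)"
    using limA limT unfolding spectral_limit_def by simp_all
  obtain K and p l :: "nat \<Rightarrow> real" where
    X: "(\<forall>k<K. p k \<ge> 0) \<and> (\<Sum>k<K. p k) = 1 \<and> cdf \<mu>T = (\<lambda>x. \<Sum>k<K. p k * indicator {l k..} x)"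
    using atomic unfolding atomic_cdf_def by (elim exE) (erule that)
  note p = X[THEN conjunct1] X[THEN conjunct2, THEN conjunct1] and Tcdf = X[THEN conjunct2, THEN conjunct2]
  have p0: "p k \<ge> 0" if "k < K" for k using p that by simp
  have Teq: "cdf \<mu>T = cdf (atomic_measure K p l)"
  proof
    fix x
    have "cdf (atomic_measure K p l) x = (\<Sum>k<K. p k * indicator {l k..} x)"
      by (rule cdf_atomic_measure[OF _ p(2)]) (rule p0)
    thus "cdf \<mu>T x = cdf (atomic_measure K p l) x" unfolding Tcdf ..
  qed
  \<comment> \<open>Exceeds the moduli of all atoms by the required margin 1.\<close>
  define \<Lambda> where "\<Lambda> = 1 + (\<Sum>k<K. \<bar>l k\<bar>)"
  have l1: "\<bar>l k\<bar> \<le> \<Lambda> - 1" if "k < K" for k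
    unfolding \<Lambda>_def using that member_le_sum[of k "{..<K}" "\<lambda>k. \<bar>l k\<bar>"] by simp
  have \<Lambda>: "\<Lambda> \<ge> 1" "\<Lambda> \<ge> 0" unfolding \<Lambda>_def using sum_nonneg[of "{..<K}" "\<lambda>k. \<bar>l k\<bar>"] by auto
  have l: "\<bar>l k\<bar> \<le> \<Lambda>" if "k < K" for k using l1[OF that] by linarith
  \<comment> \<open>The sum of all the lower bounds for \<open>y\<close>, each of them nonnegative.
    The quadratic condition follows from the linear one because \<open>y \<ge> 1\<close>.\<close>
  define v where "v = nat \<lceil>4 * \<Lambda> + 4 * \<Lambda> / c + 32 * \<Lambda>\<^sup>2 / c + 2\<rceil>"
  have yv: "y \<ge> 4 * \<Lambda>" "y \<ge> 4 * \<Lambda> / c" "y > 0" "y\<^sup>2 \<ge> 32 * \<Lambda>\<^sup>2 / c" "y \<ge> 2" if "y \<ge> real v" for y :: real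
  proof -
    have nn: "0 \<le> 4 * \<Lambda>" "0 \<le> 4 * \<Lambda> / c" "0 \<le> 32 * \<Lambda>\<^sup>2 / c" using \<Lambda> c by auto
    have "4 * \<Lambda> + 4 * \<Lambda> / c + 32 * \<Lambda>\<^sup>2 / c + 2 \<le> y" using that unfolding v_def by linarith
    hence "y \<ge> 4 * \<Lambda> \<and> y \<ge> 4 * \<Lambda> / c \<and> y \<ge> 2 \<and> y \<ge> 32 * \<Lambda>\<^sup>2 / c" using nn by linarith
    moreover from this have "y * 1 \<le> y * y" by (intro mult_left_mono) auto
    ultimately show "y \<ge> 4 * \<Lambda>" "y \<ge> 4 * \<Lambda> / c" "y > 0" "y\<^sup>2 \<ge> 32 * \<Lambda>\<^sup>2 / c" "y \<ge> 2"
      unfolding power2_eq_square[of y] by linarith+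
  qed
  have "\<exists>m. cmod m \<le> 2 / y \<and> stieltjes_transform \<mu>A (Complex 0 y - spectral_shift K p l c m) = m" if "y \<ge> real v" for y
    by (rule fixed_point_exists[OF \<mu>A p0 p(2) l c(1) \<Lambda>(2) yv(1-4)[OF that]])
  hence "\<forall>y. \<exists>m. y \<ge> real v \<longrightarrow> cmod m \<le> 2 / y \<and> stieltjes_transform \<mu>A (Complex 0 y - spectral_shift K p l c m) = m" by blast
  \<comment> \<open>The fixed points are selected before any realization is considered, so the
    limits of the traces are nonrandom.\<close>
  from choice[OF this] obtain \<psi> where
    "\<forall>y. y \<ge> real v \<longrightarrow> cmod (\<psi> y) \<le> 2 / y \<and> stieltjes_transform \<mu>A (Complex 0 y - spectral_shift K p l c (\<psi> y)) = \<psi> y" ..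
  hence \<psi>: "cmod (\<psi> y) \<le> 2 / y" "stieltjes_transform \<mu>A (Complex 0 y - spectral_shift K p l c (\<psi> y)) = \<psi> y"
    if "y \<ge> real v" for y using that by blast+
  have sh: "cmod (spectral_shift K p l c (\<psi> y)) \<le> 2 * \<Lambda> / c" if "y \<ge> real v" for y
    by (rule spectral_shift_bounds(1)[where y = y]) (use p0 p(2) l c \<Lambda> yv[OF that] \<psi>(1)[OF that] in auto)
  have zh: "Im (Complex 0 y - spectral_shift K p l c (\<psi> y)) \<ge> y / 2" if "y \<ge> real v" for y
  proof -
    have "2 * \<Lambda> / c \<le> y / 2" using yv(2)[OF that] by simp
    thus ?thesis using abs_Im_le_cmod[of "spectral_shift K p l c (\<psi> y)"] sh[OF that] by simp
  qed
  \<comment> \<open>Countable, so that null sets can be united; accumulating at \<open>i v\<close>,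
    for uniqueness; and containing every \<open>i n\<close> with \<open>n \<ge> v\<close>, for the
    asymptotics that yield tightness.\<close>
  define D where "D = range (\<lambda>(a :: nat, b :: nat). Complex 0 (real v + real a / real (Suc b)))"
  have D_form: "\<exists>y\<ge>real v. z = Complex 0 y" if "z \<in> D" for z using that by (auto simp: D_def)
  have D_sub: "D \<subseteq> {z. Im z > 0}" using D_form yv(3) by fastforce
  have D_nat: "Complex 0 (real n) \<in> D" if "n \<ge> v" for n
    unfolding D_def using that by (intro image_eqI[of _ _ "(n - v, 0)"]) auto
  have D_count: "countable D" unfolding D_def by simp
  let ?\<xi> = "Complex 0 (real v)"
  have \<xi>: "Im ?\<xi> > 0" using yv(3)[of "real v"] by simp
  have D_limpt: "?\<xi> islimpt D"
    unfolding islimpt_sequential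
  proof (intro exI[of _ "\<lambda>n. Complex 0 (real v + real 1 / real (Suc n))"] conjI allI)
    show "Complex 0 (real v + real 1 / real (Suc n)) \<in> D - {?\<xi>}" for n
      unfolding D_def by (auto intro!: image_eqI[of _ _ "(1, n)"])
    have "(\<lambda>n. real v + 1 / real (Suc n)) \<longlonglongrightarrow> real v + 0"
      by (intro tendsto_intros) (use LIMSEQ_inverse_real_of_nat in \<open>simp add: inverse_eq_divide\<close>)
    thus "(\<lambda>n. Complex 0 (real v + real 1 / real (Suc n))) \<longlonglongrightarrow> ?\<xi>"
      by (intro tendsto_Complex tendsto_const) simp
  qed
  define B where "B N \<omega> = A N \<omega> + mat_adjoint (G N \<omega>) * T N \<omega> * G N \<omega>" for N \<omega>
  have herm: "hermitian_mat N (A N \<omega>)" if "N \<ge> 1" "\<omega> \<in> space M" for N \<omega>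
    using mat_borel_carrier[OF A(1)[OF that(1)] that(2)] A(2)[OF that] by (simp add: hermitian_mat_def)
  have cT: "T N \<omega> \<in> carrier_mat (L N) (L N)" if "N \<ge> 1" "\<omega> \<in> space M" for N \<omega>
    by (rule mat_borel_carrier[OF T(1)[OF that(1)] that(2)])
  have cG: "G N \<omega> \<in> carrier_mat (L N) N" if "N \<ge> 1" "\<omega> \<in> space M" for N \<omega>
  proof -
    from gaussian_like_moment_bound[OF G[OF that(1)]] obtain Y where Y: "Y \<in> measurable M (mat_borel (L N) N)"
      "\<forall>\<omega>\<in>space M. G N \<omega> = complex_of_real (1 / sqrt (real N)) \<cdot>\<^sub>m Y \<omega>" by blast
    show ?thesis using mat_borel_carrier[OF Y(1) that(2)] Y(2) that(2) by simp
  qed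
  have Beq: "B N \<omega> = A N \<omega> + covar N (L N) (\<lambda>i. Re (T N \<omega> $$ (i, i))) (G N \<omega>)" if "N \<ge> 1" "\<omega> \<in> space M" for N \<omega>
    unfolding B_def using covar_eq[OF cG[OF that] cT[OF that]] T(2)[OF that] by simp
  have hB: "hermitian_mat N (B N \<omega>)" if "N \<ge> 1" "\<omega> \<in> space M" for N \<omega>
    unfolding Beq[OF that] by (rule hermitian_mat_add_covar[OF herm[OF that]])
  define Q where "Q \<omega> z = ((\<lambda>N. qdev_sum N (L N) z (z - spectral_shift K p l c (\<psi> (Im z))) (A N \<omega>) (\<lambda>i. clip \<Lambda> (Re (T N \<omega> $$ (i, i)))) (G N \<omega>) / real (L N)) \<longlonglongrightarrow> 0)" for \<omega> z
  have "AE \<omega> in M. Q \<omega> z" if z: "z \<in> D" for z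
  proof -
    obtain y where y: "y \<ge> real v" "z = Complex 0 y" using D_form[OF z] by blast
    have "Im (Complex 0 y - spectral_shift K p l c (\<psi> y)) \<ge> 1" using zh[OF y(1)] yv(5)[OF y(1)] by linarith
    moreover have "Im (Complex 0 y) \<ge> 1" using yv(5)[OF y(1)] by simp
    ultimately show ?thesis
      unfolding Q_def y(2) complex.sel using AE_qdev_sum_limit[OF L A T(1) G ind] by simp
  qed
  hence aeQ: "AE \<omega> in M. \<forall>z\<in>D. Q \<omega> z" by (simp add: AE_ball_countable[OF D_count])
  have mass: "\<exists>y>0. Complex 0 y \<in> D \<and> 1 - y * Im (\<psi> (Im (Complex 0 y))) < \<epsilon>" if \<epsilon>: "\<epsilon> > 0" for \<epsilon>
  proof -
    \<comment> \<open>The value 0 for \<open>n < v\<close>, where nothing is known about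
      \<open>\<psi>\<close>, keeps the shift bounded for all \<open>n\<close>.\<close>
    define h where "h n = (if n \<ge> v then spectral_shift K p l c (\<psi> (real n)) else 0)" for n
    have "cmod (h n) \<le> 2 * \<Lambda> / c" for n using sh[of "real n"] \<Lambda> c by (auto simp: h_def)
    from tendsto_Re[OF real_distribution.stieltjes_asymptotics[OF \<mu>A this]]
    have "(\<lambda>n. - (real n * Im (stieltjes_transform \<mu>A (Complex 0 (real n) - h n)))) \<longlonglongrightarrow> - 1" by simp
    from tendsto_add[OF tendsto_const[of 1] this]
    have "(\<lambda>n. 1 - real n * Im (stieltjes_transform \<mu>A (Complex 0 (real n) - h n))) \<longlonglongrightarrow> 0" by simp
    hence "eventually (\<lambda>n. 1 - real n * Im (stieltjes_transform \<mu>A (Complex 0 (real n) - h n)) < \<epsilon>) sequentially"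
      using \<epsilon> by (intro order_tendstoD(2))
    hence "eventually (\<lambda>n. n \<ge> v \<and> 1 - real n * Im (stieltjes_transform \<mu>A (Complex 0 (real n) - h n)) < \<epsilon>) sequentially"
      using eventually_ge_at_top[of v] by eventually_elim auto
    then obtain n where n: "n \<ge> v" "1 - real n * Im (stieltjes_transform \<mu>A (Complex 0 (real n) - h n)) < \<epsilon>"
      by (auto simp: eventually_sequentially)
    have "stieltjes_transform \<mu>A (Complex 0 (real n) - h n) = \<psi> (real n)"
      using \<psi>(2)[of "real n"] n(1) by (simp add: h_def)
    thus ?thesis using n D_nat[OF n(1)] yv(3)[of "real n"] by (intro exI[of _ "real n"]) auto
  qed
  have lim: "\<exists>\<nu>. real_distribution \<nu> \<and> weak_conv (\<lambda>N. spectral_cdf (B N \<omega>)) (cdf \<nu>) \<and> (\<forall>z\<in>D. stieltjes_transform \<nu> z = \<psi> (Im z))"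
    if \<omega>: "\<omega> \<in> space M" "weak_conv (\<lambda>N. spectral_cdf (A N \<omega>)) (cdf \<mu>A)" "weak_conv (\<lambda>N. spectral_cdf (T N \<omega>)) (cdf \<mu>T)" "\<forall>z\<in>D. Q \<omega> z" for \<omega>
  proof -
    have "\<exists>\<nu>. real_distribution \<nu> \<and> cdf \<nu> = spectral_cdf (B (Suc N) \<omega>) \<and>
        (\<forall>z. Im z > 0 \<longrightarrow> stieltjes_transform \<nu> z = mtrace (resolvent (B (Suc N) \<omega>) z) / of_nat (Suc N))" for N
    proof -
      have "hermitian_mat (Suc N) (B (Suc N) \<omega>)" by (rule hB) (use \<omega> in auto)
      from hermitian_spectral_measure[OF this zero_less_Suc] show ?thesis by metis
    qed
    then obtain \<nu> where \<nu>: "\<And>N. real_distribution (\<nu> N)" "\<And>N. cdf (\<nu> N) = spectral_cdf (B (Suc N) \<omega>)"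
      "\<And>N z. Im z > 0 \<Longrightarrow> stieltjes_transform (\<nu> N) z = mtrace (resolvent (B (Suc N) \<omega>) z) / of_nat (Suc N)"
      by metis
    have conv: "(\<lambda>N. stieltjes_transform (\<nu> N) z) \<longlonglongrightarrow> \<psi> (Im z)" if z: "z \<in> D" for z
    proof -
      obtain y where y: "y \<ge> real v" "z = Complex 0 y" using D_form[OF z] by blast
      have pos: "Im (Complex 0 y) > 0" using yv(3)[OF y(1)] by simp
      have q: "(\<lambda>N. qdev_sum N (L N) (Complex 0 y) (Complex 0 y - spectral_shift K p l c (\<psi> y)) (A N \<omega>) (\<lambda>i. clip \<Lambda> (Re (T N \<omega> $$ (i, i)))) (G N \<omega>) / real (L N)) \<longlonglongrightarrow> 0"
        using bspec[OF \<omega>(4) z] unfolding Q_def y(2) by simp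
      have "(\<lambda>N. mtrace (resolvent (A N \<omega> + covar N (L N) (\<lambda>i. Re (T N \<omega> $$ (i, i))) (G N \<omega>)) (Complex 0 y)) / of_nat N) \<longlonglongrightarrow> \<psi> y"
        by (rule perturbed_resolvent_limit[OF L _ _ _ c p0 p(2) l1 \<Lambda>(1) \<omega>(2) \<mu>A \<omega>(3)[unfolded Teq] yv(1,2,4)[OF y(1)] \<psi>[OF y(1)] q])
           (use herm cT T(2) \<omega>(1) in auto)
      hence "(\<lambda>N. mtrace (resolvent (A (Suc N) \<omega> + covar (Suc N) (L (Suc N)) (\<lambda>i. Re (T (Suc N) \<omega> $$ (i, i))) (G (Suc N) \<omega>)) (Complex 0 y)) / of_nat (Suc N)) \<longlonglongrightarrow> \<psi> y"
        by (rule LIMSEQ_Suc)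
      moreover have "stieltjes_transform (\<nu> N) z = mtrace (resolvent (A (Suc N) \<omega> + covar (Suc N) (L (Suc N)) (\<lambda>i. Re (T (Suc N) \<omega> $$ (i, i))) (G (Suc N) \<omega>)) (Complex 0 y)) / of_nat (Suc N)" for N
        unfolding y(2) \<nu>(3)[OF pos] using Beq[of "Suc N" \<omega>] \<omega>(1) by simp
      ultimately show ?thesis by (simp only: y(2) complex.sel)
    qed
    obtain \<rho> where \<rho>: "real_distribution \<rho>" "weak_conv_m \<nu> \<rho>" "\<forall>z\<in>D. stieltjes_transform \<rho> z = \<psi> (Im z)"
      using stieltjes_convergence[OF \<nu>(1) D_sub D_limpt \<xi> conv mass] by blast
    have "weak_conv (\<lambda>N. spectral_cdf (B N \<omega>)) (cdf \<rho>)"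
      unfolding weak_conv_def
    proof (intro allI impI)
      fix x assume "isCont (cdf \<rho>) x"
      hence "(\<lambda>N. spectral_cdf (B (Suc N) \<omega>) x) \<longlonglongrightarrow> cdf \<rho> x"
        using \<rho>(2) unfolding weak_conv_m_def weak_conv_def \<nu>(2) by blast
      thus "(\<lambda>N. spectral_cdf (B N \<omega>) x) \<longlonglongrightarrow> cdf \<rho> x" by (rule LIMSEQ_imp_Suc)
    qed
    thus ?thesis using \<rho> by blast
  qed
  have good: "AE \<omega> in M. \<omega> \<in> space M \<and> weak_conv (\<lambda>N. spectral_cdf (A N \<omega>)) (cdf \<mu>A) \<and> weak_conv (\<lambda>N. spectral_cdf (T N \<omega>)) (cdf \<mu>T) \<and> (\<forall>z\<in>D. Q \<omega> z)"
    using aeA aeT aeQ AE_space by eventually_elim auto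
  \<comment> \<open>One good realization is enough to define the limit; by uniqueness on
    \<open>D\<close> every other good one leads to the same distribution.\<close>
  obtain \<omega>\<^sub>0 where \<omega>\<^sub>0: "\<omega>\<^sub>0 \<in> space M" "weak_conv (\<lambda>N. spectral_cdf (A N \<omega>\<^sub>0)) (cdf \<mu>A)" "weak_conv (\<lambda>N. spectral_cdf (T N \<omega>\<^sub>0)) (cdf \<mu>T)" "\<forall>z\<in>D. Q \<omega>\<^sub>0 z"
    using eventually_happens'[OF ae_filter_bot good] by blast
  obtain \<mu>B where \<mu>B: "real_distribution \<mu>B" "\<forall>z\<in>D. stieltjes_transform \<mu>B z = \<psi> (Im z)"
    using lim[OF \<omega>\<^sub>0] by blast
  have "AE \<omega> in M. weak_conv (\<lambda>N. spectral_cdf (B N \<omega>)) (cdf \<mu>B)"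
    using good
  proof eventually_elim
    case (elim \<omega>)
    then obtain \<nu> where \<nu>: "real_distribution \<nu>" "weak_conv (\<lambda>N. spectral_cdf (B N \<omega>)) (cdf \<nu>)" "\<forall>z\<in>D. stieltjes_transform \<nu> z = \<psi> (Im z)"
      using lim[of \<omega>] by blast
    have "\<nu> = \<mu>B" using \<nu>(3) \<mu>B(2) by (intro stieltjes_unique_limpt[OF \<nu>(1) \<mu>B(1) D_sub D_limpt \<xi>]) auto
    thus ?case using \<nu>(2) by simp
  qed
  hence "spectral_limit M B \<mu>B" unfolding spectral_limit_def using \<mu>B(1) by blast
  moreover have "algebraic_distribution \<mu>B"
  proof (rule algebraic_of_fixed_point[OF alg \<mu>B(1) D_sub D_limpt \<xi>, where K = K and l = l and p = p and c = c])
    fix z assume z: "z \<in> D"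
    obtain y where y: "y \<ge> real v" "z = Complex 0 y" using D_form[OF z] by blast
    have sz: "stieltjes_transform \<mu>B (Complex 0 y) = \<psi> y" using bspec[OF \<mu>B(2) z] unfolding y(2) by simp
    show "1 + of_real (l k) * stieltjes_transform \<mu>B z \<noteq> 0" if "k < K" for k
      using one_plus_mult_bound[OF l[OF that] yv(1)[OF y(1)] yv(3)[OF y(1)] \<psi>(1)[OF y(1)]] unfolding y(2) sz by auto
    show "0 < Im (z - (\<Sum>k<K. complex_of_real (p k * l k / c) / (1 + complex_of_real (l k) * stieltjes_transform \<mu>B z)))"
      unfolding y(2) sz spectral_shift_def[symmetric] using zh[OF y(1)] yv(3)[OF y(1)] by linarith
    show "stieltjes_transform \<mu>B z = stieltjes_transform \<mu>A (z - (\<Sum>k<K. complex_of_real (p k * l k / c) / (1 + complex_of_real (l k) * stieltjes_transform \<mu>B z)))"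
      unfolding y(2) sz spectral_shift_def[symmetric] using \<psi>(2)[OF y(1)] by simp
  qed
  ultimately show ?thesis unfolding B_def[abs_def] by blast
qed

theorem theorem5p17:
  fixes M :: "'w measure"
    and A T G :: "nat \<Rightarrow> 'w \<Rightarrow> complex mat"
    and L :: "nat \<Rightarrow> nat"
    and C :: "nat \<Rightarrow> real"
    and c :: real
    and \<mu>A \<mu>T :: "real measure"
  assumes "prob_space M"
    and "\<And>N. N \<ge> 1 \<Longrightarrow> L N \<ge> 1"
    and "\<And>N. N \<ge> 1 \<Longrightarrow> A N \<in> measurable M (mat_borel N N)"
    and "\<And>N \<omega>. N \<ge> 1 \<Longrightarrow> \<omega> \<in> space M \<Longrightarrow> mat_adjoint (A N \<omega>) = A N \<omega>"
    and "\<And>N. N \<ge> 1 \<Longrightarrow> T N \<in> measurable M (mat_borel (L N) (L N))"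
    and "\<And>N \<omega>. N \<ge> 1 \<Longrightarrow> \<omega> \<in> space M \<Longrightarrow>
           diagonal_mat (T N \<omega>) \<and> (\<forall>i<L N. T N \<omega> $$ (i, i) \<in> \<real>)"
    and "\<And>N. N \<ge> 1 \<Longrightarrow> gaussian_like M C (L N) N (G N)"
    and "\<And>N. N \<ge> 1 \<Longrightarrow>
           prob_space.indep_vars M
             (\<lambda>k. [mat_borel N N, mat_borel (L N) (L N), mat_borel (L N) N] ! k)
             (\<lambda>k. [A N, T N, G N] ! k) {..<3}"
    and "spectral_limit M A \<mu>A" and "algebraic_distribution \<mu>A"
    and "spectral_limit M T \<mu>T" and "atomic_cdf (cdf \<mu>T)"
    and "filterlim L at_top sequentially"
    and "c > 0" and "(\<lambda>N. real N / real (L N)) \<longlonglongrightarrow> c"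
  shows "\<exists>\<mu>B. spectral_limit M (\<lambda>N \<omega>. A N \<omega> + mat_adjoint (G N \<omega>) * T N \<omega> * G N \<omega>) \<mu>B \<and>
              algebraic_distribution \<mu>B"
  by (rule prob_space.perturbed_spectral_limit[OF assms(1), where L = L and C = C and c = c])
     (use assms in auto)

end
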